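(* Let $q$ be a prime power and let $V$ be an $n$-dimensional vector space over $\mathbb{F}_q$. Let $n,k_1,k_2,t$ be positive integers with $k_1\geq k_2\geq t+1$, $n\geq k_1+k_2+t+3$, and $(k_1,k_2,t)\notin\{(2,2,1),(3,2,1),(4,2,1)\}$. Let $\mathcal{F}_1\subseteq{V\brack k_1}$ and $\mathcal{F}_2\subseteq{V\brack k_2}$ be non-trivial cross $t$-intersecting families. (i) If $k_2\geq 2t+1$, then $$|\mathcal{F}_1||\mathcal{F}_2|\leq \left({n-t\brack k_1-t}-q^{(k_2+1-t)(k_1-t)}{n-k_2-1\brack k_1-t}\right)\left({n-t\brack k_2-t}+q^{k_2+1-t}{t\brack 1}\right),$$ and equality holds only if there exist a $t$-subspace $X$ and a $(k_2+1)$-subspace $M$ of $V$ with $X\subseteq M$ such that either (ia) $\mathcal{F}_1=\mathcal{A}(k_1,t+1,X,M)$ and $\mathcal{F}_2=\mathcal{B}(k_2,X,M)$, or (ib) $k_1=k_2$, $\mathcal{F}_1=\mathcal{B}(k_1,X,M)$ and $\mathcal{F}_2=\mathcal{A}(k_2,t+1,X,M)$. (ii) If $t+1\leq k_2\leq 2t$, then $$|\mathcal{F}_1||\mathcal{F}_2|\leq {n-t-1\brack k_1-t-1}\left(q^{k_2-t}{t+1\brack 1}{n-t-1\brack k_2-t}+{n-t-1\brack k_2-t-1}\right),$$ and equality holds only if there exists a $(t+1)$-subspace $T$ of $V$ such that either (iia) $\mathcal{F}_1=\mathcal{C}(k_1,T)$ and $\mathcal{F}_2=\mathcal{D}(k_2,t,T)$,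 or (iib) $k_1=k_2$, $\mathcal{F}_1=\mathcal{D}(k_1,t,T)$ and $\mathcal{F}_2=\mathcal{C}(k_2,T)$.
   Context: ${V\brack k}$ denotes the set of $k$-dimensional subspaces of $V$. Gaussian binomial: ${a\brack b}=\prod_{0\leq i<b}\frac{q^{a-i}-1}{q^{b-i}-1}$ for positive integers $a,b$, ${a\brack 0}=1$, ${a\brack c}=0$ for negative $c$. Families $\mathcal{F}_1\subseteq{V\brack k_1}$, $\mathcal{F}_2\subseteq{V\brack k_2}$ are cross $t$-intersecting if $\dim(F_1\cap F_2)\geq t$ for all $F_1\in\mathcal{F}_1,F_2\in\mathcal{F}_2$; they are non-trivial if $\dim\big(\bigcap_{F\in\mathcal{F}_1\cup\mathcal{F}_2}F\big)<t$. For an $s$-subspace $X$, an $(\ell+1)$-subspace $M$ with $X\subseteq M$, and an integer $k$: $\mathcal{A}(k,s+1,X,M)=\{F\in{V\brack k}\mid X\subseteq F,\ \dim(F\cap M)\geq s+1\}$ and $\mathcal{B}(\ell,X,M)=\{F\in{V\brack \ell}\mid X\subseteq F\}\cup{M\brack \ell}$, where ${M\brack\ell}$ is the set of $\ell$-subspaces of $M$. For a subspace $T$: $\mathcal{C}(k,T)=\{F\in{V\brack k}\mid T\subseteq F\}$ and $\mathcal{D}(\ell,s,T)=\{F\in{V\brack \ell}\mid \dim(F\cap T)\geq s\}$. *)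

theory Defs
  imports Complex_Main "HOL-Library.Cardinality"
begin

text \<open>
  The subtractions are on naturals, but this is harmless: in the numerator the factor with
  \<open>i = a\<close> is \<open>0\<close>, so the product vanishes for \<open>a < b\<close>; in the denominator \<open>i < b\<close>.  The
  empty product gives the value \<open>1\<close> for \<open>b = 0\<close>.
\<close>
definition gauss_binom :: "nat \<Rightarrow> nat \<Rightarrow> nat \<Rightarrow> real" where
  "gauss_binom q a b = (\<Prod>i<b. (real q ^ (a - i) - 1) / (real q ^ (b - i) - 1))"

definition subspaces_of_dim :: "('a::field \<Rightarrow> 'b::ab_group_add \<Rightarrow> 'b) \<Rightarrow> 'b set \<Rightarrow> nat \<Rightarrow> 'b set set" where
  "subspaces_of_dim scale W k = {F. module.subspace scale F \<and> F \<subseteq> W \<and> vector_space.dim scale F = k}"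

definition cross_intersecting :: "('a::field \<Rightarrow> 'b::ab_group_add \<Rightarrow> 'b) \<Rightarrow> nat \<Rightarrow> 'b set set \<Rightarrow> 'b set set \<Rightarrow> bool" where
  "cross_intersecting scale t \<F>1 \<F>2 \<longleftrightarrow> (\<forall>F1\<in>\<F>1. \<forall>F2\<in>\<F>2. t \<le> vector_space.dim scale (F1 \<inter> F2))"

definition cross_nontrivial :: "('a::field \<Rightarrow> 'b::ab_group_add \<Rightarrow> 'b) \<Rightarrow> nat \<Rightarrow> 'b set set \<Rightarrow> 'b set set \<Rightarrow> bool" where
  "cross_nontrivial scale t \<F>1 \<F>2 \<longleftrightarrow> vector_space.dim scale (\<Inter> (\<F>1 \<union> \<F>2)) < t"

text \<open>
  The second argument \<open>m\<close> of \<open>family_A\<close> is the full lower bound on the dimension of the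
  intersection with \<open>M\<close>; it is \<open>s + 1\<close> for an \<open>s\<close>-dimensional \<open>X\<close>.
\<close>
definition family_A :: "('a::field \<Rightarrow> 'b::ab_group_add \<Rightarrow> 'b) \<Rightarrow> nat \<Rightarrow> nat \<Rightarrow> 'b set \<Rightarrow> 'b set \<Rightarrow> 'b set set" where
  "family_A scale k m X M = {F \<in> subspaces_of_dim scale UNIV k. X \<subseteq> F \<and> m \<le> vector_space.dim scale (F \<inter> M)}"

definition family_B :: "('a::field \<Rightarrow> 'b::ab_group_add \<Rightarrow> 'b) \<Rightarrow> nat \<Rightarrow> 'b set \<Rightarrow> 'b set \<Rightarrow> 'b set set" where
  "family_B scale l X M = {F \<in> subspaces_of_dim scale UNIV l. X \<subseteq> F} \<union> subspaces_of_dim scale M l"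

definition family_C :: "('a::field \<Rightarrow> 'b::ab_group_add \<Rightarrow> 'b) \<Rightarrow> nat \<Rightarrow> 'b set \<Rightarrow> 'b set set" where
  "family_C scale k T = {F \<in> subspaces_of_dim scale UNIV k. T \<subseteq> F}"

definition family_D :: "('a::field \<Rightarrow> 'b::ab_group_add \<Rightarrow> 'b) \<Rightarrow> nat \<Rightarrow> nat \<Rightarrow> 'b set \<Rightarrow> 'b set set" where
  "family_D scale l s T = {F \<in> subspaces_of_dim scale UNIV l. s \<le> vector_space.dim scale (F \<inter> T)}"

end

theory Submission
  imports Defs
begin

text \<open>
  Enlarging the families one may assume that each consists of all subspaces of its dimension that
  meet every member of the other one in dimension at least \<open>t\<close>.  Let \<open>\<tau>\<close> of a family be the least
  dimension of a subspace meeting all its members in dimension at least \<open>t\<close> (a cover).  A member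
  containing a non-cover \<open>S\<close> of the other family also contains one of few \<open>(dim S + 1)\<close>-spaces above
  \<open>S\<close>; iterating, each family is bounded by a function that decreases in the \<open>\<tau>\<close> of the other one.
  If both \<open>\<tau>\<close> exceed \<open>t\<close>, or one is \<open>t\<close> and the other at least \<open>t + 2\<close>, the product is too small.

  Otherwise a \<open>t\<close>-space \<open>X\<close> lies in all members of one family \<open>\<F>\<close>, and the \<open>(t + 1)\<close>-dimensional
  covers of the other family \<open>\<G>\<close> are the spaces between \<open>X\<close> and \<open>Z\<close>, the intersection of all
  \<open>G + X\<close> with \<open>G\<close> in \<open>\<G>\<close> not containing \<open>X\<close>.  The product is again small unless \<open>Z\<close> has the
  largest possible dimension, which gives the families \<open>\<A>\<close>, \<open>\<B>\<close>, or \<open>Z\<close> has dimension \<open>t + 1\<close>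
  and lies in all members of \<open>\<F>\<close>, which gives \<open>\<C>\<close>, \<open>\<D>\<close>.  It remains to compare these two
  products with each other and with those obtained by exchanging the roles of the two families.
\<close>

section \<open>Gaussian binomials\<close>

text \<open>With A, B, T, M the powers of q to k - t, l - t, t, n - t and in the units of the
  numerical section, the product for \<A>, \<B> is about q M / (q - 1) and that for \<C>, \<D> about
  q T M / ((q - 1) B). So the sign of l - 2 t decides which is larger. For l = 2 t the leading terms
  agree, the comparison has to be carried to second order, and there the size of k matters: for t =
  1 the pair \<C>, \<D> wins only from k = 5 on. This is the origin of the excluded triples.

  The size of \<A> is a difference of two large numbers. It is written as the number of k-spaces
  through X times 1 - P, where P is the probability that a random subspace avoids a fixed one, and P
  is controlled by a recursion in the dimension of the fixed space.

  The hypothesis on n enters the estimates as A B T^2 q^3 \<le> M. The structural part does not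
  order k and l, so that each statement about one family can be reused with the families exchanged;
  l \<le> k serves to compare the final numbers.\<close>

lemma gauss_binom_0 [simp]: "gauss_binom q a 0 = 1"
  by (simp add: gauss_binom_def)

lemma gauss_binom_Suc_Suc:
  "gauss_binom q (Suc a) (Suc b)
    = (real q ^ Suc a - 1) / (real q ^ Suc b - 1) * gauss_binom q a b"
  unfolding gauss_binom_def by (subst prod.lessThan_Suc_shift) simp

lemma gauss_binom_eq_0: "a < b \<Longrightarrow> gauss_binom q a b = 0"
  unfolding gauss_binom_def by (rule prod_zero) (simp, rule bexI[of _ a], simp_all)

lemma gauss_binom_Suc:
  "gauss_binom q a (Suc b) = (real q ^ a - 1) / (real q ^ Suc b - 1) * gauss_binom q (a - 1) b"
proof (cases a)
  case 0
  then show ?thesis by (simp add: gauss_binom_eq_0)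
next
  case (Suc a')
  then show ?thesis by (simp only: gauss_binom_Suc_Suc diff_Suc_1)
qed

lemma gauss_binom_pos:
  assumes "2 \<le> q" "b \<le> a"
  shows "0 < gauss_binom q a b"
proof -
  have "real q ^ i > 1" if "i > 0" for i :: nat
    using assms that by (intro one_less_power) auto
  then show ?thesis
    using assms(2) unfolding gauss_binom_def by (intro prod_pos) auto
qed

lemma gauss_binom_nonneg: "2 \<le> q \<Longrightarrow> 0 \<le> gauss_binom q a b"
  using gauss_binom_pos[of q b a] gauss_binom_eq_0[of a b q] by (cases "b \<le> a") auto

lemma gauss_binom_top_Suc:
  assumes "2 \<le> q" "b \<le> a"
  shows "gauss_binom q (Suc a) b * (real q ^ (Suc a - b) - 1) = gauss_binom q a b * (real q ^ Suc a - 1)"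
  using assms(2)
proof (induction b arbitrary: a)
  case (Suc b)
  then obtain a' where a: "a = Suc a'" "b \<le> a'" by (cases a) auto
  have "gauss_binom q (Suc a) (Suc b) * (real q ^ (Suc a - Suc b) - 1)
    = (real q ^ Suc a - 1) / (real q ^ Suc b - 1) * (gauss_binom q (Suc a') b * (real q ^ (Suc a' - b) - 1))"
    by (simp only: gauss_binom_Suc_Suc a(1) diff_Suc_Suc mult.assoc)
  also have "\<dots> = (real q ^ Suc a - 1) * ((real q ^ a - 1) / (real q ^ Suc b - 1) * gauss_binom q a' b)"
    unfolding Suc.IH[OF a(2)] a(1) by simp
  also have "\<dots> = gauss_binom q a (Suc b) * (real q ^ Suc a - 1)"
    by (simp only: gauss_binom_Suc_Suc a(1) mult.commute)
  finally show ?case .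
qed simp

lemma gauss_binom_self:
  assumes "2 \<le> q" shows "gauss_binom q a a = 1"
proof (induction a)
  case (Suc a)
  have "real q ^ Suc a > 1" using assms by (intro one_less_power) auto
  then show ?case using Suc by (simp add: gauss_binom_Suc_Suc del: power_Suc)
qed simp

lemma gauss_binom_hyperplanes:
  assumes "2 \<le> q"
  shows "gauss_binom q (Suc a) a = (real q ^ Suc a - 1) / (real q - 1)"
  using gauss_binom_top_Suc[OF assms, of a a] assms by (simp add: gauss_binom_self field_simps)

lemma gauss_binom_1: "gauss_binom q a 1 = (real q ^ a - 1) / (real q - 1)"
  using gauss_binom_Suc[of q a 0] by simp

lemma gauss_binom_right_Suc:
  assumes "2 \<le> q" "b \<le> a"
  shows "gauss_binom q a (Suc b) * (real q ^ Suc b - 1) = gauss_binom q a b * (real q ^ (a - b) - 1)"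
proof (cases "b = a")
  case True
  then show ?thesis by (simp add: gauss_binom_eq_0)
next
  case False
  then obtain a' where a: "a = Suc a'" "b \<le> a'" using assms(2) by (cases a) auto
  have "real q ^ Suc b > 1" using assms by (intro one_less_power) auto
  then have "gauss_binom q a (Suc b) * (real q ^ Suc b - 1) = gauss_binom q a' b * (real q ^ Suc a' - 1)"
    by (simp add: a(1) gauss_binom_Suc_Suc del: power_Suc)
  then show ?thesis using gauss_binom_top_Suc[OF assms(1) a(2)] a(1) by simp
qed

text \<open>A lower bound free of \<open>b\<close>. It makes the summand of \<B> that counts the
  hyperplanes of \<open>M\<close> comparable with the binomials, whatever \<open>k\<close> and
  \<open>l\<close> are.\<close>

lemma gauss_binom_ge_points:
  assumes "2 \<le> q" "1 \<le> b" "b < a"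
  shows "(real q ^ a - 1) / (real q - 1) \<le> gauss_binom q a b"
  using assms(2,3)
proof (induction b arbitrary: a rule: dec_induct)
  case base
  then show ?case by (simp add: gauss_binom_1[unfolded One_nat_def])
next
  case (step b)
  then obtain a' where a: "a = Suc a'" "b < a'" by (cases a) auto
  have q1: "real q > 1" using assms(1) by simp
  have p: "1 < real q ^ Suc b" using q1 by (intro one_less_power) auto
  have "real q ^ Suc b \<le> real q ^ a'" using a q1 by (intro power_increasing) auto
  then have "(real q ^ Suc b - 1) / (real q - 1) \<le> (real q ^ a' - 1) / (real q - 1)"
    using q1 by (intro divide_right_mono) auto
  also have "\<dots> \<le> gauss_binom q a' b" using step a by simp
  finally have "(real q ^ a - 1) / (real q ^ Suc b - 1) * ((real q ^ Suc b - 1) / (real q - 1))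
      \<le> (real q ^ a - 1) / (real q ^ Suc b - 1) * gauss_binom q a' b"
    using p q1 by (intro mult_left_mono divide_nonneg_nonneg) auto
  then show ?case using p unfolding a(1) gauss_binom_Suc_Suc by simp
qed

section \<open>Counting subspaces\<close>

lemma real_card_UN_le:
  assumes "finite I" "\<And>i. i \<in> I \<Longrightarrow> real (card (f i)) \<le> c" "X \<subseteq> (\<Union>i\<in>I. f i)" "\<And>i. i \<in> I \<Longrightarrow> finite (f i)"
  shows "real (card X) \<le> real (card I) * c"
proof -
  have "card X \<le> card (\<Union>i\<in>I. f i)" using assms by (intro card_mono) auto
  also have "\<dots> \<le> (\<Sum>i\<in>I. card (f i))" using assms(1) by (rule card_UN_le)
  finally have "real (card X) \<le> (\<Sum>i\<in>I. real (card (f i)))" by (metis of_nat_mono of_nat_sum)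
  also have "\<dots> \<le> (\<Sum>i\<in>I. c)" using assms(2) by (rule sum_mono)
  finally show ?thesis by simp
qed

locale finite_field_space = finite_dimensional_vector_space scale Basis
  for scale :: "'a::{field,finite} \<Rightarrow> 'b::ab_group_add \<Rightarrow> 'b" and Basis +
  fixes q :: nat
  assumes q_eq: "q = CARD('a)"
begin

lemma q_ge_2: "2 \<le> q"
proof -
  have "card {0, 1::'a} \<le> CARD('a)" by (intro card_mono) auto
  then show ?thesis by (simp add: q_eq)
qed

lemma dim_span_Un:
  assumes "subspace S" "subspace T"
  shows "dim (span (S \<union> T)) + dim (S \<inter> T) = dim S + dim T"
proof -
  have "span (S \<union> T) = {x + y |x y. x \<in> S \<and> y \<in> T}"
    using assms by (simp add: span_Un span_eq_iff[THEN iffD2])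
  with dim_sums_Int[OF assms] show ?thesis by simp
qed

lemma span_Un_least: "subspace W \<Longrightarrow> S \<subseteq> W \<Longrightarrow> T \<subseteq> W \<Longrightarrow> span (S \<union> T) \<subseteq> W"
  by (simp add: span_minimal)

lemma subset_span_Un1: "S \<subseteq> span (S \<union> T)" and subset_span_Un2: "T \<subseteq> span (S \<union> T)"
  by (meson span_superset subset_trans sup_ge1 sup_ge2)+

text \<open>The modular law of the subspace lattice.\<close>

lemma Int_span_Un:
  assumes "subspace F" "subspace S" "subspace E" "E \<subseteq> F"
  shows "F \<inter> span (S \<union> E) = span ((F \<inter> S) \<union> E)"
proof
  show "F \<inter> span (S \<union> E) \<subseteq> span ((F \<inter> S) \<union> E)"
  proof
    fix v assume "v \<in> F \<inter> span (S \<union> E)"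
    then obtain x y where v: "v = x + y" "x \<in> S" "y \<in> E" "v \<in> F"
      using assms by (auto simp: span_Un span_eq_iff[THEN iffD2])
    have "v - y \<in> F" using v assms by (meson subsetD subspace_diff)
    then have "x \<in> F \<inter> S" using v by simp
    with v show "v \<in> span ((F \<inter> S) \<union> E)"
      by (metis UnI1 UnI2 span_add span_base)
  qed
  show "span ((F \<inter> S) \<union> E) \<subseteq> F \<inter> span (S \<union> E)"
  proof
    fix v assume v: "v \<in> span ((F \<inter> S) \<union> E)"
    have "span ((F \<inter> S) \<union> E) \<subseteq> F"
      using assms by (intro span_Un_least) auto
    moreover have "span ((F \<inter> S) \<union> E) \<subseteq> span (S \<union> E)" by (intro span_mono) auto
    ultimately show "v \<in> F \<inter> span (S \<union> E)" using v by auto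
  qed
qed

lemma dim_insert_notin:
  assumes "subspace S" "v \<notin> S" shows "dim (span (insert v S)) = dim S + 1"
  using assms by (simp add: dim_insert span_eq_iff[THEN iffD2])

lemma finite_card_subspace:
  assumes "subspace S"
  shows "finite S \<and> card S = q ^ dim S"
  using assms
proof (induction "dim S" arbitrary: S)
  case 0
  then have "S \<subseteq> {0}" by simp
  then have "S = {0}" using 0 subspace_0 by auto
  then show ?case using 0 by simp
next
  case (Suc d)
  obtain B where B: "B \<subseteq> S" "independent B" "S \<subseteq> span B" "card B = dim S"
    using basis_exists by blast
  have "B \<noteq> {}" using B(4) Suc(2) by (metis card.empty nat.distinct(1))
  then obtain v where v: "v \<in> B" by auto
  define S' where "S' = span (B - {v})"
  have fB: "finite B" using B finiteI_independent by auto
  have iB: "independent (B - {v})" using B independent_mono by blast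
  have dS': "dim S' = d"
    using iB fB v B(4) Suc(2) by (simp add: S'_def dim_eq_card_independent)
  have vn: "v \<notin> S'" using B(2) v unfolding S'_def dependent_def by blast
  have subS': "subspace S'" by (simp add: S'_def)
  have IH: "finite S'" "card S' = q ^ d"
    using Suc(1)[of S'] dS' subS' by auto
  have SB: "S = span B" using B Suc(3) by (metis span_minimal subset_antisym)
  have S_eq: "S = (\<lambda>(c, x). scale c v + x) ` (UNIV \<times> S')"
  proof
    show "S \<subseteq> (\<lambda>(c, x). scale c v + x) ` (UNIV \<times> S')"
    proof
      fix x assume "x \<in> S"
      then have "x \<in> span (insert v (B - {v}))" using SB v by (simp add: insert_absorb)
      then obtain k where "x - scale k v \<in> S'"
        using span_breakdown_eq[of x v "B - {v}"] S'_def by auto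
      then show "x \<in> (\<lambda>(c, x). scale c v + x) ` (UNIV \<times> S')"
        by (intro image_eqI[of _ _ "(k, x - scale k v)"]) auto
    qed
    have "S' \<subseteq> S" unfolding S'_def SB by (intro span_mono) auto
    then show "(\<lambda>(c, x). scale c v + x) ` (UNIV \<times> S') \<subseteq> S"
      using Suc(3) v B(1) by (auto intro!: subspace_add subspace_scale)
  qed
  have "inj_on (\<lambda>(c, x). scale c v + x) (UNIV \<times> S')"
  proof (rule inj_onI, clarsimp)
    fix c x c' x' assume h: "x \<in> S'" "x' \<in> S'" "scale c v + x = scale c' v + x'"
    have "scale (c - c') v = x' - x" using h(3) by (simp add: algebra_simps)
    then have in1: "scale (c - c') v \<in> S'" using h subS' subspace_diff by metis
    have "c = c'"
    proof (rule ccontr)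
      assume "c \<noteq> c'"
      then have "scale (inverse (c - c')) (scale (c - c') v) = v" by simp
      then show False using in1 vn subS' subspace_scale by metis
    qed
    then show "c = c' \<and> x = x'" using h(3) by simp
  qed
  then have "card S = card (UNIV \<times> S' :: ('a \<times> 'b) set)"
    unfolding S_eq by (rule card_image)
  then have "card S = q * card S'" by (simp add: card_cartesian_product q_eq)
  moreover have "finite S" unfolding S_eq using IH by simp
  ultimately show ?case using IH by (simp flip: Suc(2))
qed

lemma finite_subspace: "subspace S \<Longrightarrow> finite S"
  and card_subspace: "subspace S \<Longrightarrow> card S = q ^ dim S"
  using finite_card_subspace by auto

lemma finite_space: "finite (UNIV :: 'b set)"
  by (rule finite_subspace) simp

lemma finite_family [simp]: "finite (\<F> :: 'b set set)"
  using finite_space by (metis Finite_Set.finite_set finite_subset subset_UNIV)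

lemma finite_vectors [simp]: "finite (S :: 'b set)"
  using finite_space by (metis finite_subset subset_UNIV)

lemma subspaces_of_dim_iff:
  "F \<in> subspaces_of_dim scale W k \<longleftrightarrow> subspace F \<and> F \<subseteq> W \<and> dim F = k"
  by (simp add: subspaces_of_dim_def)

text \<open>The sets \<open>E - X\<close> partition \<open>W - M\<close>: a vector outside
  \<open>M\<close> lies in exactly one such \<open>E\<close>, its span with \<open>X\<close>, and
  this span meets \<open>M\<close> only in \<open>X\<close>. The quotient divides by the common size
  of the blocks.\<close>

lemma card_avoiding_one:
  assumes "subspace X" "subspace M" "subspace W" "X \<subseteq> M" "M \<subseteq> W"
  shows "real (card {E \<in> subspaces_of_dim scale W (dim X + 1). X \<subseteq> E \<and> E \<inter> M = X})
    = (real q ^ dim W - real q ^ dim M) / (real q ^ (dim X + 1) - real q ^ dim X)" (is "real (card ?E) = _")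
proof -
  have XE: "X \<subseteq> E" "subspace E" "dim E = dim X + 1" "E \<subseteq> W" "E \<inter> M = X" if "E \<in> ?E" for E
    using that by (auto simp: subspaces_of_dim_iff)
  have char: "E = span (insert v X)" if "E \<in> ?E" "v \<in> E" "v \<notin> X" for E v
  proof -
    have "span (insert v X) \<subseteq> E" using XE[OF that(1)] that by (intro span_minimal) auto
    then show ?thesis
      using XE[OF that(1)] dim_insert_notin[OF assms(1) that(3)]
      by (intro subspace_dim_equal[symmetric]) auto
  qed
  have un: "(\<Union>E\<in>?E. E - X) = W - M"
  proof
    show "(\<Union>E\<in>?E. E - X) \<subseteq> W - M"
      by (auto simp: subspaces_of_dim_iff)
    show "W - M \<subseteq> (\<Union>E\<in>?E. E - X)"
    proof
      fix v assume v: "v \<in> W - M"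
      then have vX: "v \<notin> X" using assms by auto
      define E where "E = span (insert v X)"
      have E: "subspace E" "X \<subseteq> E" "v \<in> E" "dim E = dim X + 1"
        using dim_insert_notin[OF assms(1) vX] unfolding E_def
        by (auto intro: span_base)
      have "E \<subseteq> W" unfolding E_def using v assms by (intro span_minimal) auto
      moreover have "E \<inter> M = X"
      proof (rule sym, rule subspace_dim_equal)
        show "X \<subseteq> E \<inter> M" using E assms by auto
        have "E \<inter> M \<subset> E" using E v by auto
        moreover have eq: "span (E \<inter> M) = E \<inter> M" "span E = E"
          using E assms by (simp_all add: span_eq_iff[THEN iffD2] subspace_inter)
        ultimately have "span (E \<inter> M) \<subset> span E" by (simp only: eq)
        then have "dim (E \<inter> M) < dim E" by (rule dim_psubset)
        then show "dim (E \<inter> M) \<le> dim X" using E by simp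
      qed (simp_all add: assms E subspace_inter)
      ultimately have "E \<in> ?E" using E by (simp add: subspaces_of_dim_iff)
      then show "v \<in> (\<Union>E\<in>?E. E - X)" using E vX by blast
    qed
  qed
  have "card (\<Union>E\<in>?E. E - X) = (\<Sum>E\<in>?E. card (E - X))"
  proof (rule card_UN_disjoint)
    show "\<forall>E\<in>?E. \<forall>E'\<in>?E. E \<noteq> E' \<longrightarrow> (E - X) \<inter> (E' - X) = {}"
    proof (intro ballI impI equals0I)
      fix E E' v assume h: "E \<in> ?E" "E' \<in> ?E" "E \<noteq> E'" "v \<in> (E - X) \<inter> (E' - X)"
      show False using char[OF h(1), of v] char[OF h(2), of v] h(3,4) by simp
    qed
  qed auto
  also have "\<dots> = (\<Sum>E\<in>?E. q ^ (dim X + 1) - q ^ dim X)"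
  proof (rule sum.cong)
    fix E assume "E \<in> ?E"
    note E = XE[OF this]
    show "card (E - X) = q ^ (dim X + 1) - q ^ dim X"
      using E assms by (simp add: card_Diff_subset card_subspace)
  qed auto
  finally have "card (W - M) = card ?E * (q ^ (dim X + 1) - q ^ dim X)"
    unfolding un by simp
  moreover have "card (W - M) = q ^ dim W - q ^ dim M"
    using assms by (simp add: card_Diff_subset card_subspace)
  ultimately have "q ^ dim W - q ^ dim M = card ?E * (q ^ (dim X + 1) - q ^ dim X)"
    by (simp only:)
  from arg_cong[OF this, of real]
  have "real (q ^ dim W - q ^ dim M) = real (card ?E) * real (q ^ (dim X + 1) - q ^ dim X)"
    by (simp only: of_nat_mult)
  moreover have "q ^ dim M \<le> q ^ dim W"
    using assms q_ge_2 by (intro power_increasing dim_subset) auto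
  moreover have "q ^ dim X \<le> q ^ (dim X + 1)"
    using q_ge_2 by (intro power_increasing) auto
  ultimately have "real q ^ dim W - real q ^ dim M
      = real (card ?E) * (real q ^ (dim X + 1) - real q ^ dim X)"
    by (simp only: of_nat_diff of_nat_power)
  moreover have "real q ^ (dim X + 1) - real q ^ dim X \<noteq> 0" using q_ge_2 by simp
  ultimately show ?thesis by (intro nonzero_eq_divide_eq[THEN iffD2]) (simp_all only: not_False_eq_True)
qed

text \<open>Induction on \<open>d\<close>, counting in two ways the pairs
  \<open>E \<subseteq> F\<close> with \<open>E\<close> one dimension above \<open>X\<close>. Through
  a fixed \<open>E\<close> the problem recurs with \<open>X\<close> replaced by \<open>E\<close> and
  \<open>M\<close> by \<open>M + E\<close>; the difference of their dimensions is kept, which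
  explains the exponent. The case \<open>M = X\<close> counts all spaces above
  \<open>X\<close>.\<close>

lemma card_avoiding:
  assumes "subspace X" "subspace M" "subspace W" "X \<subseteq> M" "M \<subseteq> W"
  shows "real (card {F \<in> subspaces_of_dim scale W (dim X + d). X \<subseteq> F \<and> F \<inter> M = X})
    = real q ^ ((dim M - dim X) * d) * gauss_binom q (dim W - dim M) d"
  using assms
proof (induction d arbitrary: X M)
  case 0
  have "F = X" if "F \<in> subspaces_of_dim scale W (dim X)" "X \<subseteq> F" for F
    using that 0 by (intro subspace_dim_equal[symmetric]) (auto simp: subspaces_of_dim_iff)
  then have "{F \<in> subspaces_of_dim scale W (dim X + 0). X \<subseteq> F \<and> F \<inter> M = X} = {X}"
    using 0 by (auto simp: subspaces_of_dim_iff)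
  then show ?case by simp
next
  case (Suc d)
  let ?S = "{F \<in> subspaces_of_dim scale W (dim X + Suc d). X \<subseteq> F \<and> F \<inter> M = X}"
  let ?E = "{E \<in> subspaces_of_dim scale W (dim X + 1). X \<subseteq> E \<and> E \<inter> M = X}"
  note XM = Suc.prems
  have dXM: "dim X \<le> dim M" "dim M \<le> dim W" using XM by (auto intro: dim_subset)
  have q1: "real q > 1" using q_ge_2 by simp
  have lines: "real (card {E \<in> ?E. E \<subseteq> F}) = (real q ^ Suc d - 1) / (real q - 1)" if "F \<in> ?S" for F
  proof -
    have F: "subspace F" "X \<subseteq> F" "F \<subseteq> W" "F \<inter> M = X" "dim F = dim X + Suc d"
      using that by (auto simp: subspaces_of_dim_iff)
    have "E \<in> {E \<in> ?E. E \<subseteq> F} \<longleftrightarrow>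
      E \<in> {E \<in> subspaces_of_dim scale F (dim X + 1). X \<subseteq> E \<and> E \<inter> X = X}" for E
    proof -
      have "E \<inter> M = X \<and> E \<subseteq> W \<and> E \<inter> X = X" if "E \<subseteq> F" "X \<subseteq> E"
      proof -
        have "E \<inter> M \<subseteq> X" using F(4) that(1) by blast
        moreover have "X \<subseteq> E \<inter> M" using XM(4) that(2) by blast
        ultimately show ?thesis using F(3) that by blast
      qed
      then show ?thesis unfolding mem_Collect_eq subspaces_of_dim_iff by meson
    qed
    then have "{E \<in> ?E. E \<subseteq> F} = {E \<in> subspaces_of_dim scale F (dim X + 1). X \<subseteq> E \<and> E \<inter> X = X}"
      by (rule set_eqI)
    then have "real (card {E \<in> ?E. E \<subseteq> F}) = (real q ^ (dim X + Suc d) - real q ^ dim X) / (real q ^ (dim X + 1) - real q ^ dim X)"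
      using card_avoiding_one[of X X F] F XM by simp
    also have "\<dots> = (real q ^ dim X * (real q ^ Suc d - 1)) / (real q ^ dim X * (real q - 1))"
      by (simp add: power_add algebra_simps)
    finally show ?thesis using q1 by simp
  qed
  have above: "real (card {F \<in> ?S. E \<subseteq> F})
      = real q ^ ((dim M - dim X) * d) * gauss_binom q (dim W - dim M - 1) d" if "E \<in> ?E" for E
  proof -
    have E: "subspace E" "X \<subseteq> E" "E \<subseteq> W" "E \<inter> M = X" "dim E = dim X + 1"
      using that by (auto simp: subspaces_of_dim_iff)
    let ?N = "span (M \<union> E)"
    have dN: "dim ?N = dim M + 1" using dim_span_Un[of M E] E XM by (simp add: Int_commute)
    \<comment> \<open>By the modular law \<open>F\<close> meets \<open>M + E\<close> in
      \<open>(F \<inter> M) + E\<close>, so the old condition on \<open>F\<close> relative to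
      \<open>X\<close>, \<open>M\<close> is the new one relative to \<open>E\<close>,
      \<open>M + E\<close>.\<close>
    have key: "F \<inter> M = X \<longleftrightarrow> F \<inter> ?N = E" if F: "subspace F" "E \<subseteq> F" for F
    proof -
      have eq: "F \<inter> ?N = span ((F \<inter> M) \<union> E)" using F E XM by (intro Int_span_Un) auto
      show ?thesis
      proof
        assume "F \<inter> M = X"
        then show "F \<inter> ?N = E" using eq E by (simp add: Un_absorb1 span_eq_iff[THEN iffD2])
      next
        assume "F \<inter> ?N = E"
        then have "F \<inter> M \<subseteq> E" using eq subset_span_Un1[of "F \<inter> M" E] by simp
        then show "F \<inter> M = X" using E F by blast
      qed
    qed
    have "F \<in> {F \<in> ?S. E \<subseteq> F}
      \<longleftrightarrow> F \<in> {F \<in> subspaces_of_dim scale W (dim E + d). E \<subseteq> F \<and> F \<inter> ?N = E}" for F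
    proof -
      have "dim E + d = dim X + Suc d" using E(5) by simp
      moreover have "X \<subseteq> F" if "E \<subseteq> F" using E(2) that by (rule subset_trans)
      ultimately show ?thesis using key[of F] unfolding mem_Collect_eq subspaces_of_dim_iff by auto
    qed
    then have "{F \<in> ?S. E \<subseteq> F} = {F \<in> subspaces_of_dim scale W (dim E + d). E \<subseteq> F \<and> F \<inter> ?N = E}"
      by (rule set_eqI)
    then show ?thesis
      using Suc.IH[of E ?N] E XM dN subset_span_Un2[of E M] span_Un_least[of W M E] by simp
  qed
  have "(\<Sum>F\<in>?S. real (card {E \<in> ?E. E \<subseteq> F})) = (\<Sum>E\<in>?E. real (card {F \<in> ?S. E \<subseteq> F}))"
    using sum.swap_restrict[of ?S ?E "\<lambda>_ _. 1 :: real" "\<lambda>F E. E \<subseteq> F"] by simp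
  then have count: "real (card ?S) * ((real q ^ Suc d - 1) / (real q - 1))
      = real (card ?E) * (real q ^ ((dim M - dim X) * d) * gauss_binom q (dim W - dim M - 1) d)"
    using lines above by simp
  have "real (card ?E) = (real q ^ dim W - real q ^ dim M) / (real q ^ (dim X + 1) - real q ^ dim X)"
    using XM by (intro card_avoiding_one)
  also have "\<dots> = real q ^ (dim M - dim X) * (real q ^ (dim W - dim M) - 1) / (real q - 1)"
  proof -
    have "real q ^ dim W - real q ^ dim M = real q ^ dim X * (real q ^ (dim M - dim X) * (real q ^ (dim W - dim M) - 1))"
      using dXM by (simp add: algebra_simps flip: power_add)
    moreover have "real q ^ (dim X + 1) - real q ^ dim X = real q ^ dim X * (real q - 1)" by (simp add: algebra_simps)
    ultimately show ?thesis using q1 by simp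
  qed
  finally have "real (card ?E) = real q ^ (dim M - dim X) * (real q ^ (dim W - dim M) - 1) / (real q - 1)" .
  note count[unfolded this]
  moreover have "real q ^ Suc d \<noteq> 1" using one_less_power[OF q1, of "Suc d"] by simp
  ultimately have "real (card ?S) = real q ^ (dim M - dim X) * (real q ^ (dim W - dim M) - 1)  *
     (real q ^ ((dim M - dim X) * d) * gauss_binom q (dim W - dim M - 1) d) / (real q ^ Suc d - 1)"
    using q1 by (simp add: divide_simps del: power_Suc)
  then show ?case unfolding gauss_binom_Suc
    by (simp add: power_add mult.commute mult.left_commute)
qed

lemma card_above:
  assumes "subspace X" "subspace W" "X \<subseteq> W" "dim X \<le> k"
  shows "real (card {F \<in> subspaces_of_dim scale W k. X \<subseteq> F}) = gauss_binom q (dim W - dim X) (k - dim X)"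
proof -
  have "{F \<in> subspaces_of_dim scale W k. X \<subseteq> F} = {F \<in> subspaces_of_dim scale W (dim X + (k - dim X)). X \<subseteq> F \<and> F \<inter> X = X}"
    using assms(4) by auto
  then show ?thesis using card_avoiding[of X X W "k - dim X"] assms by simp
qed

lemma card_subspaces_of_dim:
  assumes "subspace W"
  shows "real (card (subspaces_of_dim scale W k)) = gauss_binom q (dim W) k"
proof -
  have z: "subspace {0}" "dim {0} = 0" by (auto simp: subspace_def)
  have "{0} \<subseteq> F" if "F \<in> subspaces_of_dim scale W k" for F
    using that by (simp add: subspaces_of_dim_iff subspace_0)
  then have "subspaces_of_dim scale W k = {F \<in> subspaces_of_dim scale W k. {0} \<subseteq> F}" by blast
  then show ?thesis using card_above[of "{0}" W k] z assms by (simp add: subspace_0)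
qed

lemma ex_between:
  assumes "subspace X" "subspace W" "X \<subseteq> W" "dim X \<le> d" "d \<le> dim W"
  obtains Y where "subspace Y" "X \<subseteq> Y" "Y \<subseteq> W" "dim Y = d"
proof -
  have "0 < real (card {F \<in> subspaces_of_dim scale W d. X \<subseteq> F})"
    unfolding card_above[OF assms(1-4)] using assms q_ge_2 by (intro gauss_binom_pos) auto
  then have "{F \<in> subspaces_of_dim scale W d. X \<subseteq> F} \<noteq> {}" by (metis card.empty of_nat_0 less_irrefl)
  then show ?thesis using that by (auto simp: subspaces_of_dim_iff)
qed

lemma ex_subspace_of_dim:
  assumes "subspace W" "d \<le> dim W"
  obtains Y where "subspace Y" "Y \<subseteq> W" "dim Y = d"
  using ex_between[of "{0}" W d] assms by (auto simp: subspace_0 subspace_def)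

lemma ex_avoiding:
  assumes "subspace X" "subspace M" "subspace W" "X \<subseteq> M" "M \<subseteq> W" "d \<le> dim W - dim M"
  obtains Y where "subspace Y" "X \<subseteq> Y" "Y \<subseteq> W" "dim Y = dim X + d" "Y \<inter> M = X"
proof -
  have "0 < real (card {F \<in> subspaces_of_dim scale W (dim X + d). X \<subseteq> F \<and> F \<inter> M = X})"
    unfolding card_avoiding[OF assms(1-5)] using assms(6) q_ge_2 by (simp add: gauss_binom_pos)
  then have "{F \<in> subspaces_of_dim scale W (dim X + d). X \<subseteq> F \<and> F \<inter> M = X} \<noteq> {}"
    by (metis card.empty of_nat_0 less_irrefl)
  then obtain Y where "Y \<in> {F \<in> subspaces_of_dim scale W (dim X + d). X \<subseteq> F \<and> F \<inter> M = X}" by blast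
  then show ?thesis using that[of Y] by (simp add: subspaces_of_dim_iff)
qed

text \<open>
  A subspace \<open>W\<close> of \<open>H\<close> of dimension \<open>dim H - t + 1\<close> with \<open>W \<inter> S = {0}\<close> meets every \<open>F\<close> in
  question non-trivially, so \<open>F\<close> contains \<open>S\<close> plus a point of \<open>W\<close>.
\<close>

lemma extensions_meeting:
  assumes "subspace S" "subspace H" "dim (S \<inter> H) < t" "t \<le> dim H"
  obtains \<R> where "\<And>R. R \<in> \<R> \<Longrightarrow> subspace R \<and> S \<subseteq> R \<and> dim R = dim S + 1"
    "real (card \<R>) \<le> gauss_binom q (dim H - t + 1) 1"
    "\<And>F. subspace F \<Longrightarrow> S \<subseteq> F \<Longrightarrow> t \<le> dim (F \<inter> H) \<Longrightarrow> \<exists>R\<in>\<R>. R \<subseteq> F"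
proof -
  have sub: "subspace (S \<inter> H)" using assms(1,2) by (rule subspace_inter)
  obtain W where "subspace W" "W \<subseteq> H" "dim W = dim {0} + (dim H - t + 1)" "W \<inter> (S \<inter> H) = {0}"
    by (rule ex_avoiding[of "{0}" "S \<inter> H" H "dim H - t + 1"])
      (use assms sub in \<open>auto simp: subspace_0 subspace_def\<close>)
  then have W: "subspace W" "W \<subseteq> H" "dim W = dim H - t + 1" "W \<inter> (S \<inter> H) = {0}" by auto
  have WS: "W \<inter> S \<subseteq> {0}" using W by blast
  define \<R> where "\<R> = (\<lambda>L. span (S \<union> L)) ` subspaces_of_dim scale W 1"
  show ?thesis
  proof (rule that[of \<R>])
    fix R assume "R \<in> \<R>"
    then obtain L where L: "subspace L" "L \<subseteq> W" "dim L = 1" "R = span (S \<union> L)"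
      by (auto simp: \<R>_def subspaces_of_dim_iff)
    have "S \<inter> L \<subseteq> {0}" using WS L by blast
    then have "dim (S \<inter> L) = 0" by simp
    then have "dim (span (S \<union> L)) = dim S + 1"
      using dim_span_Un[OF assms(1) L(1)] L(3) by linarith
    then show "subspace R \<and> S \<subseteq> R \<and> dim R = dim S + 1"
      unfolding L(4) using subset_span_Un1 subspace_span by blast
  next
    have "card \<R> \<le> card (subspaces_of_dim scale W 1)" unfolding \<R>_def by (intro card_image_le) simp
    then have "real (card \<R>) \<le> real (card (subspaces_of_dim scale W 1))" by (rule of_nat_mono)
    also have "\<dots> = gauss_binom q (dim H - t + 1) 1" using card_subspaces_of_dim W by simp
    finally show "real (card \<R>) \<le> gauss_binom q (dim H - t + 1) 1" .
  next
    fix F assume F: "subspace F" "S \<subseteq> F" "t \<le> dim (F \<inter> H)"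
    have sub: "subspace (F \<inter> H)" using F assms subspace_inter by blast
    have "span (F \<inter> H \<union> W) \<subseteq> H" using W assms by (intro span_Un_least) auto
    then have "dim (span (F \<inter> H \<union> W)) \<le> dim H" by (rule dim_subset)
    then have "1 \<le> dim (F \<inter> H \<inter> W)" using dim_span_Un[OF sub W(1)] W(3) F(3) assms(4) by simp
    then obtain L where L: "subspace L" "L \<subseteq> F \<inter> H \<inter> W" "dim L = 1"
      using ex_subspace_of_dim[of "F \<inter> H \<inter> W" 1] sub W(1) subspace_inter by blast
    have "span (S \<union> L) \<subseteq> F" using F L by (intro span_Un_least) auto
    moreover have "span (S \<union> L) \<in> \<R>" unfolding \<R>_def using L by (simp add: subspaces_of_dim_iff)
    ultimately show "\<exists>R\<in>\<R>. R \<subseteq> F" by blast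
  qed
qed

definition covers :: "nat \<Rightarrow> 'b set set \<Rightarrow> 'b set \<Rightarrow> bool" where
  "covers t \<H> T \<longleftrightarrow> subspace T \<and> (\<forall>H\<in>\<H>. t \<le> dim (H \<inter> T))"

definition \<tau> :: "nat \<Rightarrow> 'b set set \<Rightarrow> nat" where
  "\<tau> t \<H> = (LEAST d. \<exists>T. covers t \<H> T \<and> dim T = d)"

definition star :: "'b set set \<Rightarrow> 'b set \<Rightarrow> 'b set set" where
  "star \<H> S = {H \<in> \<H>. S \<subseteq> H}"

text \<open>Taken for \<open>Y = M\<close>, this is the source of the summand q^(l+1-t) [t,1] in the
  bound: the members of \<B> that do not contain \<open>X\<close> are hyperplanes of
  \<open>M\<close>.\<close>

lemma card_hyperplanes_avoiding:
  assumes "subspace X" "subspace Y" "X \<subseteq> Y" "dim X < dim Y"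
  shows "real (card {H \<in> subspaces_of_dim scale Y (dim Y - 1). \<not> X \<subseteq> H})
    = real q ^ (dim Y - dim X) * ((real q ^ dim X - 1) / (real q - 1))"
proof -
  obtain y where y: "dim Y = Suc y" using assms(4) by (cases "dim Y") auto
  have yx: "Suc y - dim X = Suc (y - dim X)" using assms(4) y by simp
  let ?A = "subspaces_of_dim scale Y y" and ?B = "{H \<in> subspaces_of_dim scale Y y. X \<subseteq> H}"
  have "{H \<in> ?A. \<not> X \<subseteq> H} = ?A - ?B" by blast
  moreover have "card ?B \<le> card ?A" by (intro card_mono) auto
  moreover have "card (?A - ?B) = card ?A - card ?B" by (intro card_Diff_subset) auto
  ultimately have "real (card {H \<in> ?A. \<not> X \<subseteq> H}) = real (card ?A) - real (card ?B)" by simp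
  also have "\<dots> = gauss_binom q (Suc y) y - gauss_binom q (Suc (y - dim X)) (y - dim X)"
    using card_subspaces_of_dim[OF assms(2), of y] card_above[OF assms(1-3), of y] assms(4) y yx by simp
  also have "\<dots> = (real q ^ Suc y - real q ^ (Suc y - dim X)) / (real q - 1)"
    unfolding gauss_binom_hyperplanes[OF q_ge_2] yx by (simp add: diff_divide_distrib)
  also have "real q ^ Suc y = real q ^ (Suc y - dim X) * real q ^ dim X"
    unfolding power_add[symmetric] using assms(4) y by simp
  finally show ?thesis unfolding y by (simp add: algebra_simps del: power_Suc)
qed

text \<open>\<open>G \<inter> T\<close> and \<open>X\<close> are different subspaces of
  \<open>T\<close> of the same dimension, one less than that of \<open>T\<close>, so together they
  span \<open>T\<close>. This confines all covers of dimension \<open>t + 1\<close> above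
  \<open>X\<close> to \<open>G + X\<close>, for each \<open>G\<close> that does not contain
  \<open>X\<close>.\<close>

lemma subset_span_Un_of_inter:
  assumes "subspace T" "subspace X" "subspace G" "X \<subseteq> T" "dim T = dim X + 1"
    "dim X \<le> dim (G \<inter> T)" "\<not> X \<subseteq> G"
  shows "T \<subseteq> span (G \<union> X)" "dim (G \<inter> X) + 1 = dim X"
proof -
  have sub: "subspace (G \<inter> T)" using assms subspace_inter by blast
  have "dim (G \<inter> T) \<le> dim T" by (intro dim_subset) simp
  moreover have "dim (G \<inter> T) \<noteq> dim T"
  proof
    assume "dim (G \<inter> T) = dim T"
    then have "G \<inter> T = T" using sub assms(1) by (intro subspace_dim_equal) auto
    then show False using assms(4,7) by auto
  qed
  ultimately have d: "dim (G \<inter> T) = dim X" using assms(5,6) by simp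
  let ?U = "span ((G \<inter> T) \<union> X)"
  have UT: "?U \<subseteq> T" using assms by (intro span_Un_least) auto
  have U: "dim ?U + dim (G \<inter> T \<inter> X) = dim (G \<inter> T) + dim X" using sub assms(2) by (rule dim_span_Un)
  have eq: "G \<inter> T \<inter> X = G \<inter> X" using assms(4) by auto
  have "dim (G \<inter> X) \<noteq> dim X"
  proof
    assume "dim (G \<inter> X) = dim X"
    then have "G \<inter> X = X" using assms(2,3) subspace_inter by (intro subspace_dim_equal) auto
    then show False using assms(7) by auto
  qed
  moreover have "dim (G \<inter> X) \<le> dim X" by (intro dim_subset) simp
  moreover have "dim ?U \<le> dim T" using UT by (rule dim_subset)
  ultimately have "dim ?U = dim T" and *: "dim (G \<inter> X) + 1 = dim X" using U eq d assms(5) by auto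
  then have "?U = T" using UT assms(1) by (intro subspace_dim_equal) auto
  moreover have "?U \<subseteq> span (G \<union> X)" by (intro span_mono) auto
  ultimately show "T \<subseteq> span (G \<union> X)" by simp
  show "dim (G \<inter> X) + 1 = dim X" by (rule *)
qed

lemma dim_inter_of_hyperplane:
  assumes "subspace G" "subspace Y" "subspace M" "G \<subseteq> M" "Y \<subseteq> M" "dim M = dim G + 1"
  shows "dim Y \<le> dim (G \<inter> Y) + 1"
proof -
  have "span (G \<union> Y) \<subseteq> M" using assms by (intro span_Un_least) auto
  then have "dim (span (G \<union> Y)) \<le> dim M" by (rule dim_subset)
  then show ?thesis using dim_span_Un[of G Y] assms by simp
qed

section \<open>Sizes of the extremal families\<close>

text \<open>Among the spaces through \<open>X\<close>, those left out meet \<open>M\<close> in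
  exactly \<open>X\<close>; \<open>card_avoiding\<close> counts them.\<close>

lemma card_family_A:
  assumes X: "subspace X" "dim X = t" and M: "subspace M" "X \<subseteq> M" and "t \<le> k"
  shows "real (card (family_A scale k (t + 1) X M))
    = gauss_binom q (dim UNIV - t) (k - t) - real q ^ ((dim M - t) * (k - t)) * gauss_binom q (dim UNIV - dim M) (k - t)"
proof -
  let ?U = "{F \<in> subspaces_of_dim scale UNIV k. X \<subseteq> F}"
  let ?V = "{F \<in> subspaces_of_dim scale UNIV (t + (k - t)). X \<subseteq> F \<and> F \<inter> M = X}"
  have V: "F \<inter> M = X \<longleftrightarrow> \<not> t + 1 \<le> dim (F \<inter> M)" if "F \<in> ?U" for F
  proof
    assume "F \<inter> M = X"
    then show "\<not> t + 1 \<le> dim (F \<inter> M)" using X(2) by simp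
  next
    assume "\<not> t + 1 \<le> dim (F \<inter> M)"
    then show "F \<inter> M = X"
      using that M X by (intro subspace_dim_equal[symmetric]) (auto simp: subspaces_of_dim_iff subspace_inter)
  qed
  have VU: "?V \<subseteq> ?U" using \<open>t \<le> k\<close> by auto
  have "F \<in> family_A scale k (t + 1) X M \<longleftrightarrow> F \<in> ?U - ?V" for F
    using V[of F] \<open>t \<le> k\<close> unfolding family_A_def by auto
  then have "family_A scale k (t + 1) X M = ?U - ?V" by blast
  then have "card (family_A scale k (t + 1) X M) = card ?U - card ?V"
    using VU by (simp only:) (intro card_Diff_subset, auto)
  moreover have "card ?V \<le> card ?U" using VU by (intro card_mono) auto
  ultimately have "real (card (family_A scale k (t + 1) X M)) = real (card ?U) - real (card ?V)" by simp
  then show ?thesis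
    using card_above[of X UNIV k] card_avoiding[of X M UNIV "k - t"] X M \<open>t \<le> k\<close> by simp
qed

text \<open>Here and for \<D> an upper bound is enough: when the product attains the bound of the
  theorem, \<open>card_product_le\<close> forces the families to be the full ones.\<close>

lemma card_family_B_le:
  assumes X: "subspace X" "dim X = t" and M: "subspace M" "X \<subseteq> M" "dim M = l + 1" and "t \<le> l"
  shows "real (card (family_B scale l X M))
    \<le> gauss_binom q (dim UNIV - t) (l - t) + real q ^ (l + 1 - t) * gauss_binom q t 1"
proof -
  let ?U = "{F \<in> subspaces_of_dim scale UNIV l. X \<subseteq> F}"
  let ?V = "{H \<in> subspaces_of_dim scale M (dim M - 1). \<not> X \<subseteq> H}"
  have "family_B scale l X M \<subseteq> ?U \<union> ?V" using M(3) by (auto simp: family_B_def subspaces_of_dim_iff)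
  then have "card (family_B scale l X M) \<le> card (?U \<union> ?V)" by (intro card_mono) auto
  also have "\<dots> \<le> card ?U + card ?V" by (rule card_Un_le)
  finally have "real (card (family_B scale l X M)) \<le> real (card ?U) + real (card ?V)"
    by (simp only: of_nat_add[symmetric] of_nat_le_iff)
  then show ?thesis
    using card_above[of X UNIV l] card_hyperplanes_avoiding[OF X(1) M(1,2)] X M(3) \<open>t \<le> l\<close>
    by (simp add: gauss_binom_1[unfolded One_nat_def])
qed

lemma card_family_C:
  assumes "subspace T" "dim T = s" "s \<le> k"
  shows "real (card (family_C scale k T)) = gauss_binom q (dim UNIV - s) (k - s)"
  using card_above[of T UNIV k] assms by (simp add: family_C_def)

text \<open>Members are sorted by their trace on \<open>T\<close>, which is \<open>T\<close> itself
  or a \<open>t\<close>-subspace \<open>S\<close> of it; in the second case the member contains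
  \<open>S\<close> and avoids the rest of \<open>T\<close>.\<close>

lemma card_family_D_le:
  assumes T: "subspace T" "dim T = t + 1" and "t + 1 \<le> l"
  shows "real (card (family_D scale l t T))
    \<le> real q ^ (l - t) * gauss_binom q (t + 1) 1 * gauss_binom q (dim UNIV - t - 1) (l - t)
      + gauss_binom q (dim UNIV - t - 1) (l - t - 1)"
proof -
  let ?S = "subspaces_of_dim scale T t"
  let ?V = "\<lambda>S. {F \<in> subspaces_of_dim scale UNIV (dim S + (l - t)). S \<subseteq> F \<and> F \<inter> T = S}"
  have "family_D scale l t T \<subseteq> family_C scale l T \<union> (\<Union>S\<in>?S. ?V S)"
  proof
    fix F assume "F \<in> family_D scale l t T"
    then have F: "subspace F" "dim F = l" "t \<le> dim (F \<inter> T)" by (auto simp: family_D_def subspaces_of_dim_iff)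
    have sub: "subspace (F \<inter> T)" using F T subspace_inter by blast
    have "dim (F \<inter> T) \<le> t + 1" using dim_subset[of "F \<inter> T" T] T by simp
    then consider "dim (F \<inter> T) = t" | "dim (F \<inter> T) = t + 1" using F(3) by linarith
    then show "F \<in> family_C scale l T \<union> (\<Union>S\<in>?S. ?V S)"
    proof cases
      case 1
      then have "F \<inter> T \<in> ?S" using sub by (simp add: subspaces_of_dim_iff)
      moreover have "F \<in> ?V (F \<inter> T)" using 1 F assms(3) by (auto simp: subspaces_of_dim_iff)
      ultimately show ?thesis by blast
    next
      case 2
      then have "F \<inter> T = T" using sub T by (intro subspace_dim_equal) auto
      then have "T \<subseteq> F" by blast
      then show ?thesis using F by (simp add: family_C_def subspaces_of_dim_iff)
    qed
  qed
  then have "card (family_D scale l t T) \<le> card (family_C scale l T \<union> (\<Union>S\<in>?S. ?V S))" by (intro card_mono) auto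
  also have "\<dots> \<le> card (family_C scale l T) + card (\<Union>S\<in>?S. ?V S)" by (rule card_Un_le)
  finally have "real (card (family_D scale l t T)) \<le> real (card (family_C scale l T)) + real (card (\<Union>S\<in>?S. ?V S))"
    by (simp only: of_nat_add[symmetric] of_nat_le_iff)
  moreover have "real (card (\<Union>S\<in>?S. ?V S)) \<le> real (card ?S) * (real q ^ (l - t) * gauss_binom q (dim UNIV - t - 1) (l - t))"
  proof (rule real_card_UN_le)
    fix S assume "S \<in> ?S"
    then have S: "subspace S" "S \<subseteq> T" "dim S = t" by (auto simp: subspaces_of_dim_iff)
    show "real (card (?V S)) \<le> real q ^ (l - t) * gauss_binom q (dim UNIV - t - 1) (l - t)"
      using card_avoiding[of S T UNIV "l - t"] S T by simp
  qed auto
  moreover have "real (card ?S) = gauss_binom q (t + 1) 1"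
    using card_subspaces_of_dim[OF T(1), of t] T(2) gauss_binom_hyperplanes[OF q_ge_2, of t]
    by (simp add: gauss_binom_1[unfolded One_nat_def])
  moreover have "real (card (family_C scale l T)) = gauss_binom q (dim UNIV - t - 1) (l - t - 1)"
    using card_family_C[OF T assms(3)] by simp
  ultimately show ?thesis by (simp add: mult_ac)
qed

end

section \<open>Numerical estimates\<close>

text \<open>
  The locale is used with \<open>A = q ^ (k - t)\<close>, \<open>B = q ^ (l - t)\<close>, \<open>T = q ^ t\<close>, \<open>M = q ^ (n - t)\<close>.
  All products are measured in units of the number of pairs of a \<open>k\<close>-space and an \<open>l\<close>-space
  through two fixed \<open>(t + 1)\<close>-spaces.  In this scale \<open>\<Theta>\<close> lies below the bounds of the theorem
  and above the products of all configurations that are not extremal.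
\<close>

locale product_bounds =
  fixes q A B T M :: real
  assumes q: "2 \<le> q" and A: "q \<le> A" and B: "q \<le> B" and T: "q \<le> T"
    and M: "A * B * T\<^sup>2 * q ^ 3 \<le> M"
begin

definition \<Theta> :: real where "\<Theta> = (q * M - M / T) / (q - 1)"

lemma pos: "0 < q" "0 < q - 1" "0 < A" "0 < B" "0 < T" "0 < M" "0 < B - 1" "0 < A - 1"
  using q A B T M order.strict_trans2[OF _ M, of 0] by auto

text \<open>In this form \<Theta> is the number of \<open>t\<close>-subspaces of a
  \<open>(t + 1)\<close>-space times \<open>M / T\<close>. The product for \<C>, \<D> is 1 plus the
  same number times \<open>(M - B) / (B - 1)\<close>, so \<open>M / T\<close> is chosen as a value
  that separates \<open>B \<le> T\<close> from \<open>q * T \<le> B\<close>.\<close>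

lemma Theta_eq: "\<Theta> = (q * T - 1) * (M / T) / (q - 1)"
  using pos by (simp add: \<Theta>_def field_simps)

lemma MT: "A * B * T * q ^ 3 \<le> M / T"
proof -
  have "A * B * T * q ^ 3 * T \<le> M" using M by (simp add: power2_eq_square mult_ac)
  then show ?thesis using pos by (simp add: pos_le_divide_eq)
qed

lemma qT: "1 < q * T" using q T mult_mono[of 2 q 2 T] by simp

lemma A_le_M: "A * (B * T\<^sup>2 * q ^ 3) \<le> M" "A \<le> M"
proof -
  show *: "A * (B * T\<^sup>2 * q ^ 3) \<le> M" using M by (simp add: mult_ac)
  have "1 \<le> B * T\<^sup>2 * q ^ 3"
    using q B T by (intro mult_ge1_I one_le_power) auto
  then have "A * 1 \<le> A * (B * T\<^sup>2 * q ^ 3)" using pos by (intro mult_left_mono) auto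
  with * show "A \<le> M" by simp
qed

lemma q_lt_M: "q < M"
proof -
  have "q * 1 < A * (B * T\<^sup>2 * q ^ 3)"
  proof (rule mult_le_less_imp_less)
    have "1 * 1 < B * (T\<^sup>2 * q ^ 3)"
      using q B T by (intro mult_less_le_imp_less mult_ge1_I one_le_power) auto
    then show "1 < B * T\<^sup>2 * q ^ 3" by (simp add: mult_ac)
  qed (use A pos in auto)
  with A_le_M show ?thesis by simp
qed

text \<open>\<open>(A - q) / (M - q)\<close> is the proportion of subspaces through a point that contain a further given point.\<close>

definition r :: real where "r = (A - q) / (M - q)"

lemma r_nonneg: "0 \<le> r" using A q_lt_M by (simp add: r_def)

lemma r_le: "r \<le> 1 / (B * T\<^sup>2 * q ^ 3)"
proof -
  have "r \<le> A / M"
    using q_lt_M A_le_M pos unfolding r_def by (simp add: divide_simps algebra_simps)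
  also have "\<dots> \<le> A / (A * (B * T\<^sup>2 * q ^ 3))"
    using A_le_M pos by (intro divide_left_mono) auto
  also have "\<dots> = 1 / (B * T\<^sup>2 * q ^ 3)" using pos by simp
  finally show ?thesis .
qed

section \<open>Non-extremal configurations stay below \<Theta>\<close>

lemma Theta_ge: "q - 1 / T \<ge> q - 1 / 2" "\<Theta> = M * (q - 1 / T) / (q - 1)"
proof -
  have "1 / T \<le> 1 / 2" using T q by (intro divide_left_mono) auto
  then show "q - 1 / T \<ge> q - 1 / 2" by simp
  show "\<Theta> = M * (q - 1 / T) / (q - 1)" by (simp add: \<Theta>_def algebra_simps)
qed

text \<open>One factor \<open>(q * T - 1) / (q - 1)\<close> cancels against \<Theta>, and the rest
  follows from \<open>q A\<close> times \<open>q B\<close> times \<open>q T\<close> being at most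
  \<open>M / T\<close>. These three factors \<open>q\<close> are the constant 3 in the lower bound
  on \<open>n\<close>; for \<open>q = 2\<close> the powers of \<open>q - 1\<close> contribute
  nothing.\<close>

lemma both_covers_large:
  "((q * T - 1) / (q - 1))\<^sup>2 * ((q * A - 1) / (q - 1)) * ((q * B - 1) / (q - 1)) < \<Theta>"
proof -
  have ge: "(q - 1) ^ 3 \<ge> 1" using q by (intro one_le_power) auto
  have qAB: "1 < q * A" "1 < q * B" using q A B mult_mono[of 2 q 2 A] mult_mono[of 2 q 2 B] by auto
  have "(q * T - 1) * ((q * A - 1) * (q * B - 1)) < (q * T) * ((q * A) * (q * B))"
    using qT qAB pos by (intro mult_strict_mono) auto
  also have "\<dots> = A * B * T * q ^ 3" by (simp add: power3_eq_cube)
  also have "\<dots> \<le> M / T" by (rule MT)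
  also have "\<dots> \<le> (q - 1) ^ 3 * (M / T)"
    using mult_right_mono[OF ge, of "M / T"] pos by simp
  finally have "(q * T - 1) * ((q * T - 1) * ((q * A - 1) * (q * B - 1))) < (q * T - 1) * ((q - 1) ^ 3 * (M / T))"
    using qT by (intro mult_strict_left_mono) auto
  then have "(q * T - 1)\<^sup>2 * (q * A - 1) * (q * B - 1) / (q - 1) ^ 4
      < (q * T - 1) * ((q - 1) ^ 3 * (M / T)) / (q - 1) ^ 4"
    using pos by (intro divide_strict_right_mono) (auto simp: power2_eq_square mult_ac)
  moreover have "(q * T - 1) * ((q - 1) ^ 3 * (M / T)) / (q - 1) ^ 4 = \<Theta>"
  proof -
    have "(q - 1) ^ 4 = (q - 1) ^ 3 * (q - 1)" using power_add[of "q - 1" 3 1] by simp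
    then show ?thesis unfolding Theta_eq using pos by simp
  qed
  moreover have "((q * T - 1) / (q - 1))\<^sup>2 * ((q * A - 1) / (q - 1)) * ((q * B - 1) / (q - 1))
      = (q * T - 1)\<^sup>2 * (q * A - 1) * (q * B - 1) / (q - 1) ^ 4"
    by (simp add: power_divide power2_eq_square power4_eq_xxxx)
  ultimately show ?thesis by linarith
qed

text \<open>The left side bounds the product when a common \<open>t\<close>-space faces covers of
  dimension at least \<open>t + 2\<close>. The dangerous factor is \<open>M - 1\<close>; the
  proportion \<open>r\<close> compensates it through \<open>r * (M - 1) \<le> A\<close>, after which
  the estimate \<open>MT\<close> finishes as before.\<close>

lemma one_cover_large:
  "((q * B - 1) / (q - 1))\<^sup>2 * r * ((q\<^sup>2 * T - 1) * (q * T - 1) / ((q\<^sup>2 - 1) * (q - 1)))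
    * ((M - 1) / (B - 1)) < \<Theta>"
proof -
  have q2: "q\<^sup>2 - 1 > 0" using q power_strict_mono[of 1 q 2] by simp
  have "(A - q) * (M - 1) \<le> A * (M - q)"
  proof -
    have "(q - 1) * A + q \<le> (q - 1) * M + M"
      using A_le_M q_lt_M pos by (intro add_mono mult_left_mono) auto
    then show ?thesis by (simp add: algebra_simps)
  qed
  then have r1: "r * (M - 1) \<le> A"
    using q_lt_M by (simp add: r_def divide_simps)
  \<comment> \<open>The constant 3/2 is the largest that \<open>c\<close> below can absorb: there
    equality holds for \<open>q = 2\<close>.\<close>
  have sq: "(q * B - 1)\<^sup>2 \<le> 3 / 2 * q\<^sup>2 * B * (B - 1)"
  proof -
    have "0 \<le> q\<^sup>2 * B * (B - 3) + 4 * q * B - 2"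
    proof (cases "B \<ge> 3")
      case True
      have "2 * 2 \<le> q * B" using q B by (intro mult_mono) auto
      moreover have "0 \<le> q\<^sup>2 * B * (B - 3)" using True pos by simp
      ultimately show ?thesis by simp
    next
      case False
      have "q\<^sup>2 * B * (- 1) \<le> q\<^sup>2 * B * (B - 3)" using B q pos by (intro mult_left_mono) auto
      moreover have "2 * 2 * 1 \<le> q * B * (4 - q)" using q B False by (intro mult_mono) auto
      ultimately show ?thesis by (simp add: algebra_simps power2_eq_square)
    qed
    then show ?thesis by (simp add: algebra_simps power2_eq_square)
  qed
  have "3 / 2 * q \<le> q\<^sup>2 - 1"
  proof -
    have "0 \<le> (q - 2) * (q + 1 / 2)" using q by (intro mult_nonneg_nonneg) auto
    then show ?thesis by (simp add: algebra_simps power2_eq_square diff_divide_distrib)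
  qed
  also have "\<dots> \<le> (q - 1)\<^sup>2 * (q\<^sup>2 - 1)"
    using q q2 mult_right_mono[OF one_le_power[of "q - 1" 2], of "q\<^sup>2 - 1"] by simp
  finally have c: "3 / 2 * q \<le> (q - 1)\<^sup>2 * (q\<^sup>2 - 1)" .
  have qT2: "q\<^sup>2 * T > 1" using q T power_mono[of 2 q 2] mult_mono[of 4 "q\<^sup>2" 2 T] by auto
  have "(q * B - 1)\<^sup>2 * (q\<^sup>2 * T - 1) \<le> (3 / 2 * q\<^sup>2 * B * (B - 1)) * (q\<^sup>2 * T - 1)"
    using sq qT2 by (intro mult_right_mono) auto
  also have "\<dots> < (3 / 2 * q\<^sup>2 * B * (B - 1)) * (q\<^sup>2 * T)"
    using pos by (intro mult_strict_left_mono) auto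
  also have "\<dots> = (3 / 2 * q) * (B * (B - 1) * T * q ^ 3)" by (simp add: eval_nat_numeral)
  also have "\<dots> \<le> ((q - 1)\<^sup>2 * (q\<^sup>2 - 1)) * (B * (B - 1) * T * q ^ 3)"
    using c pos by (intro mult_right_mono) auto
  finally have main: "(q * B - 1)\<^sup>2 * (q\<^sup>2 * T - 1) < (q - 1)\<^sup>2 * (q\<^sup>2 - 1) * (B * (B - 1) * T * q ^ 3)" .
  define D where "D = (q - 1)\<^sup>2 * (q\<^sup>2 - 1) * (B - 1)"
  have D: "D > 0" unfolding D_def using pos q2 by simp
  have "((q * B - 1) / (q - 1))\<^sup>2 * r * ((q\<^sup>2 * T - 1) * (q * T - 1) / ((q\<^sup>2 - 1) * (q - 1))) * ((M - 1) / (B - 1))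
     = (q * B - 1)\<^sup>2 * (q\<^sup>2 * T - 1) / D * ((q * T - 1) / (q - 1)) * (r * (M - 1))"
    unfolding D_def by (simp add: power_divide mult_ac)
  also have "\<dots> \<le> (q * B - 1)\<^sup>2 * (q\<^sup>2 * T - 1) / D * ((q * T - 1) / (q - 1)) * A"
    using r1 D qT qT2 pos by (intro mult_left_mono mult_nonneg_nonneg divide_nonneg_nonneg) auto
  also have "\<dots> < (q - 1)\<^sup>2 * (q\<^sup>2 - 1) * (B * (B - 1) * T * q ^ 3) / D * ((q * T - 1) / (q - 1)) * A"
    using main D qT pos by (intro mult_strict_right_mono divide_strict_right_mono) auto
  also have "\<dots> = B * T * q ^ 3 * ((q * T - 1) / (q - 1)) * A"
  proof -
    have "(q - 1)\<^sup>2 * E * (B * (B - 1) * T * q ^ 3) / ((q - 1)\<^sup>2 * E * (B - 1)) = B * T * q ^ 3"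
      if "E > 0" for E using pos that by simp
    from this[OF q2] show ?thesis unfolding D_def by simp
  qed
  also have "\<dots> = ((q * T - 1) / (q - 1)) * (A * B * T * q ^ 3)" by simp
  also have "\<dots> \<le> ((q * T - 1) / (q - 1)) * (M / T)"
    using MT qT pos by (intro mult_left_mono) auto
  also have "\<dots> = \<Theta>" unfolding Theta_eq by simp
  finally show ?thesis .
qed

text \<open>\<open>W\<close> stands for \<open>q ^ (dim Z - t)\<close>, which would be
  \<open>q * B\<close> in the extremal case. Not reaching the top dimension costs a factor of about
  \<open>q\<close> in the number of covers. The rest is error: spaces that are not covers count with
  weight at most 1/16, and \<open>e\<close>, the relative contribution of the members of \<G> not
  through \<open>X\<close>, is at most 1/8.\<close>

lemma intermediate_core:
  assumes W: "q\<^sup>2 \<le> W" "W \<le> B" and e: "0 \<le> e" "e \<le> q\<^sup>2 * B * T / (M * (q - 1))"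
  shows "((W - 1) / (q - 1) + (q * B - W) / (q - 1) * ((q * B - 1) / (q - 1)) * r)
    * ((M - 1) / (B - 1) * (1 + e)) < \<Theta>"
proof -
  have q4: "4 \<le> q\<^sup>2" using q power_mono[of 2 q 2] by simp
  have T4: "4 \<le> T\<^sup>2" using q T power_mono[of 2 T 2] by simp
  have e8: "e \<le> 1 / 8"
  proof -
    have "8 * (q\<^sup>2 * B * T) \<le> (A * T * (q * (q - 1))) * (q\<^sup>2 * B * T)"
    proof (rule mult_right_mono)
      have "2 * 2 * (2 * 1) \<le> A * T * (q * (q - 1))" using q A T pos by (intro mult_mono) auto
      then show "8 \<le> A * T * (q * (q - 1))" by simp
    qed (use pos in auto)
    also have "\<dots> = A * B * T\<^sup>2 * q ^ 3 * (q - 1)" by (simp add: eval_nat_numeral)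
    also have "\<dots> \<le> M * (q - 1)" using M pos by (intro mult_right_mono) auto
    finally have "q\<^sup>2 * B * T / (M * (q - 1)) \<le> 1 / 8" using pos by (simp add: divide_simps)
    with e(2) show ?thesis by (rule order_trans)
  qed
  have F: "(q * B - W) / (q - 1) * ((q * B - 1) / (q - 1)) * r \<le> (q * B - W) / (q - 1) * (1 / 16)"
  proof -
    have "(q * B - 1) / (q - 1) * r \<le> (q * B) * (1 / (B * T\<^sup>2 * q ^ 3))"
    proof (rule mult_mono)
      have "q * B - 1 \<le> q * B * 1" by simp
      also have "\<dots> \<le> q * B * (q - 1)" using q pos by (intro mult_left_mono) auto
      finally show "(q * B - 1) / (q - 1) \<le> q * B" using pos by (simp add: divide_simps)
    qed (use r_le r_nonneg pos in auto)
    also have "\<dots> = 1 / (T\<^sup>2 * q\<^sup>2)" using pos by (simp add: divide_simps eval_nat_numeral)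
    also have "\<dots> \<le> 1 / (4 * 4)" using q4 T4 pos by (intro divide_left_mono mult_mono) auto
    finally have "(q * B - 1) / (q - 1) * r \<le> 1 / 16" by simp
    moreover have "1 * B \<le> q * B" using q pos by (intro mult_right_mono) auto
    then have "0 \<le> q * B - W" using W(2) by linarith
    ultimately have "(q * B - W) / (q - 1) * ((q * B - 1) / (q - 1) * r) \<le> (q * B - W) / (q - 1) * (1 / 16)"
      using pos by (intro mult_left_mono divide_nonneg_nonneg) auto
    then show ?thesis by (simp add: mult.assoc)
  qed
  define N where "N = (W - 1) / (q - 1) + (q * B - W) / (q - 1) * ((q * B - 1) / (q - 1)) * r"
  have "N \<le> (W - 1) / (q - 1) + (q * B - W) / (q - 1) * (1 / 16)"
    unfolding N_def using F by simp
  also have "\<dots> = (15 / 16 * W + q * B / 16 - 1) / (q - 1)"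
    by (simp add: divide_simps) (simp add: algebra_simps)?
  also have "\<dots> \<le> (15 / 16 * B + q * B / 16 - 1) / (q - 1)"
    using W pos by (intro divide_right_mono) auto
  also have "15 / 16 * B + q * B / 16 - 1 = (B - 1) + (q - 1) * B / 16"
    by (simp add: algebra_simps diff_divide_distrib)
  also have "\<dots> \<le> (B - 1) + (q - 1) * (B - 1) / 12"
  proof -
    \<comment> \<open>\<open>B\<close> is at least \<open>W\<close>, hence at least 4, and so at
      most 4/3 of \<open>B - 1\<close>.\<close>
    have "B / 16 \<le> (B - 1) / 12" using W q4 by simp
    then have "(q - 1) * (B / 16) \<le> (q - 1) * ((B - 1) / 12)" using pos by (intro mult_left_mono) auto
    then show ?thesis by simp
  qed
  finally have N: "N \<le> ((B - 1) + (q - 1) * (B - 1) / 12) / (q - 1)"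
    using pos by (simp add: divide_right_mono)
  then have "N \<le> (B - 1) * (1 / (q - 1) + 1 / 12)"
    using pos by (simp add: field_simps)
  then have "N * ((M - 1) / (B - 1) * (1 + e)) \<le> ((B - 1) * (1 / (q - 1) + 1 / 12)) * ((M - 1) / (B - 1) * (9 / 8))"
    using e8 e pos q_lt_M q unfolding N_def[symmetric]
    by (intro mult_mono mult_left_mono) auto
  also have "\<dots> = (1 / (q - 1) + 1 / 12) * (9 / 8) * (M - 1)"
  proof -
    have *: "x * X * (y / x * z) = X * z * y" if "x \<noteq> 0" for x X y z :: real using that by simp
    show ?thesis by (rule *) (use pos in simp)
  qed
  also have "\<dots> < (1 / (q - 1) + 1 / 12) * (9 / 8) * M"
    using pos by (intro mult_strict_left_mono mult_pos_pos add_pos_pos) auto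
  also have "\<dots> \<le> (q - 1 / T) / (q - 1) * M"
  proof (rule mult_right_mono)
    have "(1 + (q - 1) / 12) * (9 / 8) \<le> q - 1 / 2" using q by (simp add: field_simps)
    also have "\<dots> \<le> q - 1 / T" by (rule Theta_ge(1))
    finally have "(1 + (q - 1) / 12) * (9 / 8) \<le> q - 1 / T" .
    then have "(1 + (q - 1) / 12) * (9 / 8) / (q - 1) \<le> (q - 1 / T) / (q - 1)"
      using pos by (intro divide_right_mono) auto
    moreover have "(1 + (q - 1) / 12) * (9 / 8) / (q - 1) = (1 / (q - 1) + 1 / 12) * (9 / 8)"
      using pos by (simp add: field_simps)
    ultimately show "(1 / (q - 1) + 1 / 12) * (9 / 8) \<le> (q - 1 / T) / (q - 1)" by (simp only:)
  qed (use pos in auto)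
  also have "\<dots> = \<Theta>" using Theta_ge(2) by simp
  finally show ?thesis unfolding N_def .
qed

text \<open>For the case of a single cover above \<open>X\<close> that some member of \<F> does not
  contain. Then the members of \<G> not through \<open>X\<close> number at most
  \<open>A * q\<^sup>2 * T\<close> in the chosen units, small against \<open>M / B\<close>; the
  second factor becomes 5/4 of \<open>M / (B - 1)\<close>, without the factor of order
  \<open>T\<close> that \<D> has.\<close>

lemma line_core_with_exception:
  "(1 + q * (B - 1) / (q - 1) * ((q * B - 1) / (q - 1)) * r)
    * ((M - 1) / (B - 1) + (A - 1) / (q - 1) * q\<^sup>2 * ((T - 1) / (q - 1))) < \<Theta>"
proof -
  have T4: "4 \<le> T\<^sup>2" using q T power_mono[of 2 T 2] by simp
  define N where "N = 1 + q * (B - 1) / (q - 1) * ((q * B - 1) / (q - 1)) * r"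
  have N0: "0 \<le> N"
    unfolding N_def using pos r_nonneg q B mult_mono[of 2 q 2 B]
    by (intro add_nonneg_nonneg mult_nonneg_nonneg divide_nonneg_nonneg) auto
  have N: "N \<le> 1 + (B - 1) / (8 * (q - 1))"
  proof -
    have "(q * B - 1) / (q - 1) * r \<le> (q * B) * (1 / (B * T\<^sup>2 * q ^ 3))"
    proof (rule mult_mono)
      have "q * B - 1 \<le> q * B * 1" by simp
      also have "\<dots> \<le> q * B * (q - 1)" using q pos by (intro mult_left_mono) auto
      finally show "(q * B - 1) / (q - 1) \<le> q * B" using pos by (simp add: divide_simps)
    qed (use r_le r_nonneg pos in auto)
    also have "\<dots> = 1 / (T\<^sup>2 * q * q)" using pos by (simp add: divide_simps eval_nat_numeral)
    also have "\<dots> \<le> 1 / (4 * 2 * q)" using q T4 pos by (intro divide_left_mono mult_mono) auto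
    finally have "q * (B - 1) / (q - 1) * ((q * B - 1) / (q - 1) * r) \<le> q * (B - 1) / (q - 1) * (1 / (4 * 2 * q))"
      using pos by (intro mult_left_mono divide_nonneg_nonneg) auto
    also have "\<dots> = (B - 1) / (8 * (q - 1))" using pos by (simp add: field_simps)
    finally show ?thesis unfolding N_def by (simp add: mult.assoc)
  qed
  define G where "G = (M - 1) / (B - 1) + (A - 1) / (q - 1) * q\<^sup>2 * ((T - 1) / (q - 1))"
  have G: "G < 5 / 4 * M / (B - 1)"
  proof -
    have "4 * (A * B * T * q\<^sup>2) \<le> (T * q) * (A * B * T * q\<^sup>2)"
      using q T pos mult_mono[of 2 T 2 q] by (intro mult_right_mono) auto
    also have "\<dots> \<le> M" using M by (simp add: eval_nat_numeral mult_ac)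
    finally have le: "A * B * T * q\<^sup>2 \<le> M / 4" by simp
    have "(A - 1) / (q - 1) * q\<^sup>2 * ((T - 1) / (q - 1)) \<le> A * q\<^sup>2 * T"
    proof (intro mult_mono)
      have "A - 1 \<le> A * 1" by simp
      also have "\<dots> \<le> A * (q - 1)" using q pos by (intro mult_left_mono) auto
      finally show "(A - 1) / (q - 1) \<le> A" using pos by (simp add: divide_simps)
      have "T - 1 \<le> T * 1" by simp
      also have "\<dots> \<le> T * (q - 1)" using q pos by (intro mult_left_mono) auto
      finally show "(T - 1) / (q - 1) \<le> T" using pos by (simp add: divide_simps)
    qed (use pos T q in auto)
    then have "G \<le> (M - 1) / (B - 1) + A * q\<^sup>2 * T" by (simp add: G_def)
    also have "\<dots> = (M - 1 + A * q\<^sup>2 * T * (B - 1)) / (B - 1)" using pos by (simp add: field_simps)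
    also have "\<dots> < (M + M / 4) / (B - 1)"
    proof (rule divide_strict_right_mono)
      have "A * q\<^sup>2 * T * (B - 1) \<le> A * q\<^sup>2 * T * B" using pos by (intro mult_left_mono) auto
      with le show "M - 1 + A * q\<^sup>2 * T * (B - 1) < M + M / 4" by (simp add: mult_ac)
    qed (use pos in auto)
    finally show ?thesis by simp
  qed
  have "N * G \<le> N * (5 / 4 * M / (B - 1))" using N0 G by (intro mult_left_mono) auto
  also have "\<dots> \<le> (1 + (B - 1) / (8 * (q - 1))) * (5 / 4 * M / (B - 1))"
    using N pos by (intro mult_right_mono) auto
  also have "\<dots> = 5 / 4 * (1 / (B - 1) + 1 / (8 * (q - 1))) * M" using pos by (simp add: field_simps)
  also have "\<dots> \<le> 5 / 4 * (1 / (q - 1) + 1 / (8 * (q - 1))) * M"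
    using pos B by (intro mult_right_mono mult_left_mono add_mono divide_left_mono) auto
  also have "\<dots> = 5 / 4 * (9 / 8 / (q - 1)) * M"
  proof -
    have "1 / x + 1 / (8 * x) = 9 / 8 / x" for x :: real by (cases "x = 0") (simp_all add: field_simps)
    then show ?thesis by (simp only:)
  qed
  also have "\<dots> = 45 / 32 / (q - 1) * M" by simp
  also have "\<dots> < (q - 1 / T) / (q - 1) * M"
  proof -
    have "45 / 32 < q - 1 / T" using Theta_ge(1) q by linarith
    then show ?thesis using pos by (intro mult_strict_right_mono divide_strict_right_mono) auto
  qed
  also have "\<dots> = \<Theta>" using Theta_ge(2) by simp
  finally show ?thesis unfolding N_def G_def .
qed

section \<open>\<Theta> against the two extremal products\<close>

text \<open>The right side is a lower bound for the product for \<A>, \<B>. \<Theta> was taken short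
  of \<open>q * M / (q - 1)\<close> by a relative amount of order \<open>1 / T\<close>; the
  correction costs only \<open>q * s \<le> 1 / (4 * T)\<close>, and what remains of the margin pays
  for replacing \<open>M\<close> by \<open>M - 1\<close>.\<close>

lemma Theta_le_star:
  defines "s \<equiv> (q * B - 1) / (q - 1) * ((A - 1) / (M - 1))"
  shows "\<Theta> \<le> (q * B - 1) / (q - 1) / (1 + s) * ((M - 1) / (B - 1))"
proof -
  have M1: "1 < M" using q q_lt_M by simp
  have qB: "q * (B - 1) \<le> q * B - 1" using q by (simp add: algebra_simps)
  have qB1: "1 < q * B" using q B mult_mono[of 2 q 2 B] by simp
  have s0: "0 \<le> s" unfolding s_def using qB1 pos M1 by simp
  have "s \<le> (q * B) * (A / M)"
    unfolding s_def
  proof (rule mult_mono)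
    have "q * B - 1 \<le> q * B * 1" by simp
    also have "\<dots> \<le> q * B * (q - 1)" using q pos by (intro mult_left_mono) auto
    finally show "(q * B - 1) / (q - 1) \<le> q * B" using pos by (simp add: divide_simps)
    show "(A - 1) / (M - 1) \<le> A / M" using M1 A_le_M pos by (simp add: divide_simps algebra_simps)
  qed (use pos M1 in auto)
  also have "\<dots> \<le> (q * B) * (A / (A * (B * T\<^sup>2 * q ^ 3)))"
    using A_le_M pos by (intro mult_left_mono divide_left_mono) auto
  also have "\<dots> = 1 / (T * T * q * q)" using pos by (simp add: field_simps eval_nat_numeral)
  finally have "q * s \<le> q * (1 / (T * T * q * q))" using pos by (intro mult_left_mono) auto
  also have "\<dots> = 1 / (T * T * q)" using pos by (simp add: field_simps)
  also have "\<dots> \<le> 1 / (T * 2 * 2)" using q T pos by (intro divide_left_mono mult_mono) auto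
  finally have qs: "q * s \<le> 1 / (4 * T)" by simp
  have "(q - 1 / T) * (1 + s) \<le> q - 1 / T + q * s"
  proof -
    have "(q - 1 / T) * (1 + s) = q - 1 / T + q * s - s / T"
      by (simp add: algebra_simps add_divide_distrib)
    moreover have "0 \<le> s / T" using s0 pos by simp
    ultimately show ?thesis by linarith
  qed
  also have "\<dots> \<le> q - 3 / (4 * T)" using qs pos by (simp add: field_simps)
  finally have 1: "(q - 1 / T) * (1 + s) \<le> q - 3 / (4 * T)" .
  have "M * (q - 3 / (4 * T)) \<le> q * (M - 1)"
  proof -
    have "2 * 1 * 1 * q \<le> A * B * T * q ^ 3"
      using q A B T self_le_power[of q 3] by (intro mult_mono) auto
    then have qMT: "q \<le> 3 / 4 * (M / T)" using MT pos(1) by simp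
    have "M * (q - 3 / (4 * T)) = M * q - 3 / 4 * (M / T)" by (simp add: algebra_simps)
    also have "\<dots> \<le> M * q - q" using qMT by simp
    also have "\<dots> = q * (M - 1)" by (simp add: algebra_simps)
    finally show ?thesis .
  qed
  moreover have "M * ((q - 1 / T) * (1 + s)) \<le> M * (q - 3 / (4 * T))"
    using 1 pos by (intro mult_left_mono) auto
  ultimately have "M * ((q - 1 / T) * (1 + s)) \<le> q * (M - 1)" by (rule order_trans[rotated])
  then have "(B - 1) * (M * ((q - 1 / T) * (1 + s))) \<le> (B - 1) * (q * (M - 1))"
    using pos by (intro mult_left_mono) auto
  also have "\<dots> \<le> (q * B - 1) * (M - 1)"
    using mult_right_mono[OF qB, of "M - 1"] M1 by (simp add: mult_ac)
  finally have "(B - 1) * (M * ((q - 1 / T) * (1 + s))) \<le> (q * B - 1) * (M - 1)" .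
  then have "M * (q - 1 / T) \<le> (q * B - 1) * (M - 1) / ((1 + s) * (B - 1))"
    using s0 pos by (subst pos_le_divide_eq) (auto simp: mult_ac)
  then have "M * (q - 1 / T) / (q - 1) \<le> (q * B - 1) * (M - 1) / ((1 + s) * (B - 1)) / (q - 1)"
    using pos by (intro divide_right_mono) auto
  also have "\<dots> = (q * B - 1) / (q - 1) / (1 + s) * ((M - 1) / (B - 1))" by simp
  finally show ?thesis using Theta_ge(2) by simp
qed

text \<open>Since \<open>B - 1\<close> is at least 3/2 of \<open>T\<close>, even
  \<open>M / (B - 1)\<close> is below \<open>M / T\<close>; the \<open>B\<close> subtracted in the
  numerator then pays for the summand 1.\<close>

lemma line_less_Theta:
  assumes "q * T \<le> B"
  shows "1 + (q * T - 1) / (q - 1) * ((M - B) / (B - 1)) < \<Theta>"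
proof -
  have "3 / 2 \<le> (q * T - 1) / T"
  proof -
    have "(q * T - 1) / T = q - 1 / T" using pos by (simp add: diff_divide_distrib)
    then show ?thesis using Theta_ge(1) q by linarith
  qed
  also have "\<dots> \<le> (B - 1) / T" using assms pos by (intro divide_right_mono) auto
  finally have "M * (3 / 2) \<le> M * ((B - 1) / T)" using pos by (intro mult_left_mono) auto
  then have "M - B < (B - 1) * (M / T) - B" using pos by (simp add: mult.commute)
  then have "(q * T - 1) * (M - B) < (q * T - 1) * ((B - 1) * (M / T) - B)"
    using qT by (intro mult_strict_left_mono) auto
  moreover have "(q - 1) * (B - 1) \<le> (q * T - 1) * B"
  proof (rule mult_mono)
    show "q - 1 \<le> q * T - 1" using T q mult_left_mono[of 1 T q] by simp
  qed (use pos qT in auto)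
  ultimately have "(q - 1) * (B - 1) + (q * T - 1) * (M - B) < (q * T - 1) * (M / T) * (B - 1)"
    by (simp only: right_diff_distrib mult_ac)
  then have "((q - 1) * (B - 1) + (q * T - 1) * (M - B)) / ((q - 1) * (B - 1))
     < (q * T - 1) * (M / T) * (B - 1) / ((q - 1) * (B - 1))"
    using pos by (intro divide_strict_right_mono) auto
  then show ?thesis unfolding Theta_eq using pos by (simp add: add_divide_distrib)
qed

lemma Theta_le_line:
  assumes "B \<le> T"
  shows "\<Theta> \<le> 1 + (q * T - 1) / (q - 1) * ((M - B) / (B - 1))"
proof -
  have "B * T \<le> M"
  proof -
    have "1 * (B * T) * 1 * 1 \<le> A * (B * T) * T * q ^ 3"
      using q A T pos by (intro mult_mono one_le_power) auto
    then show ?thesis using M by (simp add: power2_eq_square mult_ac)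
  qed
  moreover have "B * M \<le> T * M" using assms pos by simp
  ultimately have "(B - 1) * M \<le> T * (M - B)" by (simp add: algebra_simps)
  then have "M / T \<le> (M - B) / (B - 1)" using pos by (simp add: divide_simps mult_ac)
  then have "(q * T - 1) / (q - 1) * (M / T) \<le> (q * T - 1) / (q - 1) * ((M - B) / (B - 1))"
    using qT pos by (intro mult_left_mono) auto
  moreover have "\<Theta> = (q * T - 1) / (q - 1) * (M / T)" by (simp add: Theta_eq)
  ultimately show ?thesis by linarith
qed

text \<open>\<open>(M - B) / (B - 1)\<close> is \<open>(M - 1) / (B - 1)\<close> minus 1, hence
  decreasing in \<open>B\<close>.\<close>

lemma line_swap:
  assumes "B < A"
  shows "1 + (q * T - 1) / (q - 1) * ((M - A) / (A - 1)) < 1 + (q * T - 1) / (q - 1) * ((M - B) / (B - 1))"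
proof -
  have "(M - 1) / (A - 1) < (M - 1) / (B - 1)"
    using assms pos q_lt_M q by (intro divide_strict_left_mono) auto
  then have "(M - A) / (A - 1) < (M - B) / (B - 1)"
    using pos by (simp add: field_simps)
  then show ?thesis using qT pos by (intro add_strict_left_mono mult_strict_left_mono) auto
qed

section \<open>The two extremal products against each other\<close>

text \<open>For \<open>l < 2 * t\<close> a factor \<open>q\<close> is to spare, and the union bound
  for meeting \<open>M\<close> outside \<open>X\<close>, which gives the first factor on the left,
  is sharp enough. After clearing denominators the gain is \<open>q * (T - B) * (M - B)\<close>, of
  order \<open>q T M\<close>, against an error of at most \<open>2 q^2 B^2 T\<close>.\<close>

lemma star_less_line_strict:
  assumes "q * B \<le> T"
  shows "(q * B - 1) / (q - 1) * ((M - 1 + q * B * (T - 1)) / (B - 1))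
    < 1 + (q * T - 1) / (q - 1) * ((M - B) / (B - 1))"
proof -
  have "2 * B \<le> q * B" using q pos by (intro mult_right_mono) auto
  with assms have BT: "B \<le> T / 2" by linarith
  have big: "16 * (q * B * B * T) \<le> M * T"
  proof -
    have "16 * (q * B * B * T) \<le> (A * T * q\<^sup>2 * q) * (q * B * B * T)"
    proof (rule mult_right_mono)
      have "2 * 2 * 4 * 1 \<le> A * T * q\<^sup>2 * q"
        using q A T power_mono[of 2 q 2] by (intro mult_mono) auto
      then show "16 \<le> A * T * q\<^sup>2 * q" by simp
    qed (use pos in auto)
    also have "\<dots> = A * B * T * q ^ 3 * (q * B) * T" by (simp add: eval_nat_numeral)
    also have "\<dots> \<le> A * B * T * q ^ 3 * T * T" using assms pos by (intro mult_right_mono mult_left_mono) auto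
    also have "\<dots> \<le> M * T" using M pos by (intro mult_right_mono) (auto simp: eval_nat_numeral mult_ac)
    finally show ?thesis .
  qed
  have BM: "B \<le> M / 2"
  proof -
    have "16 * 1 * 1 * B * T \<le> 16 * q * B * B * T" using q B pos by (intro mult_mono) auto
    also have "\<dots> \<le> M * T" using big by simp
    finally have "16 * B \<le> M" using pos by simp
    then show ?thesis using pos by simp
  qed
  have "(q * B) * (B - 1 + q * B * (T - 1)) < q * (2 * (q * B * B * T))"
  proof -
    have "B - 1 + q * B * (T - 1) < q * B * T + q * B * T"
    proof -
      have "B * 1 \<le> B * (q * T)" using qT pos by (intro mult_left_mono) auto
      moreover have "q * B * (T - 1) \<le> q * B * T" using pos by (intro mult_left_mono) auto
      ultimately show ?thesis by (simp add: mult_ac)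
    qed
    then have "q * B * (B - 1 + q * B * (T - 1)) < q * B * (q * B * T + q * B * T)"
      using pos by (intro mult_strict_left_mono) auto
    then show ?thesis by (simp add: algebra_simps)
  qed
  also have "\<dots> \<le> q * (M * T / 8)" using big pos by (intro mult_left_mono) auto
  also have "\<dots> \<le> q * ((T - B) * (M - B))"
  proof (rule mult_left_mono)
    have "(T / 2) * (M / 2) \<le> (T - B) * (M - B)" using BT BM pos by (intro mult_mono) auto
    moreover have "M * T / 8 \<le> (T / 2) * (M / 2)" using mult_pos_pos[OF pos(6) pos(5)] by simp
    ultimately show "M * T / 8 \<le> (T - B) * (M - B)" by linarith
  qed (use pos in auto)
  finally have "(q * B) * (B - 1 + q * B * (T - 1)) < q * ((T - B) * (M - B))" .
  moreover have "(q * B - 1) * (B - 1 + q * B * (T - 1)) \<le> (q * B) * (B - 1 + q * B * (T - 1))"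
    using pos T q by (intro mult_right_mono) auto
  ultimately have "(q * B - 1) * (B - 1 + q * B * (T - 1)) < q * ((T - B) * (M - B))" by simp
  moreover have "0 < (q - 1) * (B - 1)" using pos by simp
  ultimately have "(q * B - 1) * (M - 1 + q * B * (T - 1)) < (q - 1) * (B - 1) + (q * T - 1) * (M - B)"
    by (simp add: algebra_simps)
  then have "(q * B - 1) * (M - 1 + q * B * (T - 1)) / ((q - 1) * (B - 1))
     < ((q - 1) * (B - 1) + (q * T - 1) * (M - B)) / ((q - 1) * (B - 1))"
    using pos by (intro divide_strict_right_mono) auto
  also have "\<dots> = 1 + (q * T - 1) / (q - 1) * ((M - B) / (B - 1))"
    using pos by (simp add: add_divide_distrib)
  finally show ?thesis by (simp only: times_divide_times_eq)
qed

text \<open>For \<open>l = 2 * t\<close> both sides equal \<open>b / u\<close> up to bounded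
  multiples of \<open>T\<close>, where \<open>b = (q * T - 1) / (q - 1)\<close> and
  \<open>u = (T - 1) / (M - 1)\<close>. The right side falls short of it by \<open>b - 1\<close>.
  The left side must be shown to fall short by nearly \<open>T * q\<close>, a second-order effect of
  overlaps that the union bound would not see.\<close>

lemma star_less_line_diag:
  assumes "B = T" and T2: "q\<^sup>2 \<le> T" and AT: "T \<le> A"
  defines "s \<equiv> (T - 1) / (q - 1) * ((A - 1) / (M - 1))"
    and "e \<equiv> q * T * ((T - 1) / (q - 1)) / ((M - 1) / (T - 1) * ((M / q - 1) / (q - 1)))"
  shows "((T - 1) / (q - 1) + T * ((M - 1) / (M - T)) / (1 + s)) * ((M - 1) / (T - 1) * (1 + e))
    < 1 + (q * T - 1) / (q - 1) * ((M - T) / (T - 1))"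
proof -
  have M1: "1 < M" using q q_lt_M by simp
  have MT3: "A * T ^ 3 * q ^ 3 \<le> M" using M \<open>B = T\<close> by (simp add: eval_nat_numeral mult_ac)
  have T4: "4 \<le> T" using T2 q power_mono[of 2 q 2] by simp
  define u where "u = (T - 1) / (M - 1)"
  have TM: "8 * T ^ 2 * q ^ 2 \<le> M"
  proof -
    have "4 * T ^ 2 * 1 * (q ^ 2 * 2) \<le> A * T ^ 2 * T * (q ^ 2 * q)"
      using T4 AT q by (intro mult_mono) auto
    then show ?thesis using MT3 by (simp add: eval_nat_numeral mult_ac)
  qed
  have TltM: "T < M"
  proof -
    have "1 * T < 8 * T ^ 2 * q ^ 2"
    proof -
      have "1 * (T * 1) * 1 < 8 * (T * T) * q ^ 2"
        using T4 q one_le_power[of q 2] by (intro mult_less_le_imp_less mult_mono) auto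
      then show ?thesis by (simp add: power2_eq_square)
    qed
    with TM show ?thesis by simp
  qed
  have u: "0 < u" "u \<le> T / M" "u < 1"
  proof -
    show "0 < u" using T4 M1 by (simp add: u_def)
    show "u \<le> T / M" using TltM M1 by (simp add: u_def divide_simps algebra_simps)
    show "u < 1" using TltM M1 by (simp add: u_def)
  qed
  have Tu: "T * u * q\<^sup>2 \<le> 1 / 8"
  proof -
    have "T * u * q\<^sup>2 \<le> T * (T / M) * q\<^sup>2" using u pos by (intro mult_right_mono mult_left_mono) auto
    also have "\<dots> = T ^ 2 * q ^ 2 / M" by (simp add: power2_eq_square)
    also have "\<dots> \<le> 1 / 8" using TM pos by (simp add: divide_simps)
    finally show ?thesis .
  qed
  define \<alpha> where "\<alpha> = (A - 1) / (q - 1)"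
  have al: "q + 1 \<le> \<alpha>"
  proof -
    have "(q + 1) * (q - 1) \<le> A - 1" using T2 AT by (simp add: algebra_simps power2_eq_square)
    then show ?thesis using pos by (simp add: \<alpha>_def pos_le_divide_eq)
  qed
  have s_u: "s = u * \<alpha>" by (simp add: s_def u_def \<alpha>_def)
  \<comment> \<open>Chosen so that \<open>(1 - u) * (1 + u * (q + 1)) = 1 + v\<close>. By
    \<open>al\<close> this bounds the overlap correction, and expanding \<open>1 / (1 + v)\<close>
    to second order exposes the loss \<open>T * q\<close>.\<close>
  define v where "v = u * q - u\<^sup>2 * (q + 1)"
  have v0: "0 \<le> v"
  proof -
    have "u * (q + 1) \<le> T * u * q\<^sup>2"
    proof -
      have "2 * q \<le> q * q" using q by (intro mult_right_mono) auto
      then have "q + 1 \<le> q * q + q * q" using q by linarith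
      also have "\<dots> \<le> T * q\<^sup>2" using T4 mult_right_mono[of 2 T "q\<^sup>2"] by (simp add: power2_eq_square)
      finally show ?thesis using u mult_left_mono[of "q + 1" "T * q\<^sup>2" u] by (simp add: mult_ac)
    qed
    then have "u * (q + 1) \<le> q" using Tu q by simp
    then have "0 \<le> u * (q - u * (q + 1))" using u by simp
    then show ?thesis by (simp add: v_def algebra_simps power2_eq_square)
  qed
  have vq: "v \<le> u * q" using q by (simp add: v_def)
  have y: "(M - 1) / (M - T) / (1 + s) \<le> 1 - v + v\<^sup>2"
  proof -
    have "(M - T) / (M - 1) = 1 - u" using M1 by (simp add: u_def field_simps)
    then have "(M - 1) / (M - T) = 1 / (1 - u)" by (metis inverse_divide inverse_eq_divide)
    then have "(M - 1) / (M - T) / (1 + s) = 1 / ((1 - u) * (1 + u * \<alpha>))" by (simp add: s_u)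
    also have "\<dots> \<le> 1 / ((1 - u) * (1 + u * (q + 1)))"
      using u al q by (intro divide_left_mono mult_left_mono mult_pos_pos add_left_mono add_pos_nonneg mult_nonneg_nonneg) auto
    also have "(1 - u) * (1 + u * (q + 1)) = 1 + v" by (simp add: v_def algebra_simps power2_eq_square)
    also have "1 / (1 + v) \<le> 1 - v + v\<^sup>2"
    proof -
      have "(1 - v + v\<^sup>2) * (1 + v) = 1 + v ^ 3" by (simp add: algebra_simps eval_nat_numeral)
      then have "1 \<le> (1 - v + v\<^sup>2) * (1 + v)" using v0 by simp
      then show ?thesis using v0 by (simp add: divide_le_eq)
    qed
    finally show ?thesis .
  qed
  define b where "b = (q * T - 1) / (q - 1)"
  have b_eq: "(T - 1) / (q - 1) + T = b" using pos by (simp add: b_def field_simps)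
  have b_le: "b \<le> q * T - q + 1"
  proof -
    have "0 \<le> (q - 2) * q * (T - 1)" using q T4 by (intro mult_nonneg_nonneg) auto
    then have "q * T - 1 \<le> (q * T - q + 1) * (q - 1)" by (simp add: algebra_simps)
    then show ?thesis using pos by (simp add: b_def pos_divide_le_eq)
  qed
  have b0: "0 \<le> b" using qT pos by (simp add: b_def)
  have e0: "0 \<le> e" and e1: "e * (b / u) \<le> 1 / 2"
  proof -
    have qM: "M / (2 * q) \<le> M / q - 1" using q_lt_M q
    proof -
      have "1 * 1 \<le> T ^ 2 * q" using T4 q by (intro mult_mono one_le_power) auto
      then have "2 \<le> 8 * (T ^ 2 * q)" by linarith
      then have "2 * q \<le> (8 * (T ^ 2 * q)) * q" using pos by (intro mult_right_mono) auto
      then have "2 * q \<le> M" using TM by (simp add: power2_eq_square mult_ac)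
      then show ?thesis using pos by (simp add: field_simps)
    qed
    have qM0: "0 < M / q - 1" using q_lt_M pos by (simp add: field_simps)
    show "0 \<le> e" unfolding e_def using qM0 pos M1 T4 by (intro divide_nonneg_nonneg mult_nonneg_nonneg) auto
    have "e * (b / u) = q * T * (T - 1) / (M / q - 1) * b"
      unfolding e_def u_def using pos M1 qM0 T4 by (simp add: divide_simps) (simp add: field_simps)?
    also have "\<dots> \<le> q * T * T / (M / (2 * q)) * (q * T)"
      using b_le b0 qM qM0 pos T4 q by (intro mult_mono frac_le mult_left_mono) auto
    also have "\<dots> = 2 * (q ^ 3 * T ^ 3) / M" using pos by (simp add: field_simps eval_nat_numeral)
    also have "\<dots> \<le> 2 / A" using MT3 pos by (simp add: divide_simps mult_ac)
    also have "\<dots> \<le> 1 / 2" using AT T4 by (simp add: divide_simps)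
    finally show "e * (b / u) \<le> 1 / 2" .
  qed
  define X where "X = ((T - 1) / (q - 1) + T * ((M - 1) / (M - T)) / (1 + s)) * ((M - 1) / (T - 1))"
  have "X \<le> ((T - 1) / (q - 1) + T * (1 - v + v\<^sup>2)) * (1 / u)"
  proof -
    have "(T - 1) / (q - 1) + T * ((M - 1) / (M - T) / (1 + s)) \<le> (T - 1) / (q - 1) + T * (1 - v + v\<^sup>2)"
      using y pos by (intro add_left_mono mult_left_mono) auto
    moreover have "(M - 1) / (T - 1) = 1 / u" by (simp add: u_def)
    ultimately show ?thesis unfolding X_def using u by (simp add: divide_right_mono)
  qed
  also have "\<dots> = b / u - T * (v / u) + T * v\<^sup>2 / u"
    unfolding b_eq[symmetric] using u by (simp add: field_simps)
  also have "\<dots> \<le> b / u - T * q + 3 * (T * u * q\<^sup>2)"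
  proof -
    have 1: "v / u = q - u * (q + 1)" using u by (simp add: v_def field_simps power2_eq_square)
    have "v\<^sup>2 \<le> (u * q)\<^sup>2" using v0 vq by (intro power_mono) auto
    then have 2: "T * v\<^sup>2 / u \<le> T * (u * q)\<^sup>2 / u" using u pos by (intro divide_right_mono mult_left_mono) auto
    have 3: "T * (u * q)\<^sup>2 / u = T * u * q\<^sup>2" using u by (simp add: power2_eq_square)
    have "2 * q \<le> q\<^sup>2" using q by (simp add: power2_eq_square)
    then have "q + 1 \<le> 2 * q\<^sup>2" using q by linarith
    then have 4: "T * u * (q + 1) \<le> T * u * (2 * q\<^sup>2)" using pos u by (intro mult_left_mono) auto
    have 5: "T * (v / u) = T * q - T * u * (q + 1)" unfolding 1 by (simp add: algebra_simps)
    have 6: "T * u * (2 * q\<^sup>2) = 2 * (T * u * q\<^sup>2)" by simp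
    from 2 3 4 5 6 show ?thesis by linarith
  qed
  finally have X: "X \<le> b / u - T * q + 3 / 8" using Tu by simp
  have X2: "X \<le> b / u" using X T4 q mult_mono[of 1 T 1 q] by simp
  \<comment> \<open>The losses meet here: \<open>T * q - 7 / 8\<close> on the left, and
    \<open>b - 1\<close>, which is at most \<open>q * T - q\<close>, on the right. A gap of at least
    \<open>q - 7 / 8\<close> remains.\<close>
  have "X * (1 + e) = X + e * X" by (simp add: algebra_simps)
  also have "\<dots> \<le> (b / u - T * q + 3 / 8) + e * (b / u)"
    using X X2 e0 by (intro add_mono mult_left_mono) auto
  also have "\<dots> \<le> b / u - T * q + 7 / 8" using e1 by linarith
  also have "\<dots> < b / u - b + 1"
    using b_le q by (simp add: mult_ac)
  also have "\<dots> = 1 + b * ((M - T) / (T - 1))"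
  proof -
    have *: "(M - T) / (T - 1) = 1 / u - 1" using T4 by (simp add: u_def field_simps)
    show ?thesis unfolding * by (simp add: right_diff_distrib)
  qed
  finally show ?thesis unfolding X_def b_def by (simp add: mult.assoc)
qed

text \<open>For \<open>t = 1\<close>, \<open>l = 2\<close> both sides are cleared of denominators
  without any estimate. In the difference \<open>R\<close> the square of \<open>M\<close> cancels,
  and the coefficient of \<open>M\<close> is \<open>q * A - q ^ 4 - q\<^sup>2 + q\<close>. It is
  positive for \<open>A \<ge> q ^ 4\<close> but negative for \<open>A \<le> q ^ 3\<close>, that is,
  for \<open>k \<le> 4\<close>.\<close>

lemma star_less_line_one:
  assumes "B = q" "T = q" and A4: "q ^ 4 \<le> A"
  shows "(1 + q * ((M - A) / (M - q))) * ((M - 1 + q\<^sup>2 * (q - 1)) / (q - 1))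
    < 1 + (q + 1) * ((M - q) / (q - 1))"
proof -
  have Mq: "0 < M - q" using q_lt_M by simp
  define R where "R = (q - 1 + (q + 1) * (M - q)) * (M - q) - ((M - q) + q * (M - A)) * (M - 1 + q\<^sup>2 * (q - 1))"
  have "R = M * (q * A - q ^ 4 - q\<^sup>2 + q) + (q + q * A) * (q ^ 3 - q\<^sup>2 - 1) + q ^ 3 + q\<^sup>2 + q - q\<^sup>2 "
    unfolding R_def by (simp add: algebra_simps eval_nat_numeral)
  moreover have "0 \<le> M * (q * A - q ^ 4 - q\<^sup>2 + q)"
  proof -
    have "2 * q ^ 4 \<le> q * A" using q A4 pos by (intro mult_mono) auto
    moreover have "q\<^sup>2 \<le> q ^ 4" using q by (intro power_increasing) auto
    ultimately have "0 \<le> q * A - q ^ 4 - q\<^sup>2 + q" using pos(1) by linarith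
    then show ?thesis using pos by (intro mult_nonneg_nonneg) auto
  qed
  moreover have "0 \<le> (q + q * A) * (q ^ 3 - q\<^sup>2 - 1)"
  proof -
    have "2 * q\<^sup>2 \<le> q * q\<^sup>2" using q by (intro mult_right_mono) auto
    moreover have "1 \<le> q\<^sup>2" using q by (intro one_le_power) auto
    ultimately have "0 \<le> q ^ 3 - q\<^sup>2 - 1" by (simp add: eval_nat_numeral)
    then show ?thesis using pos by simp
  qed
  ultimately have "0 < R" using pos by (simp add: add_nonneg_pos)
  then have "((M - q) + q * (M - A)) * (M - 1 + q\<^sup>2 * (q - 1)) / ((M - q) * (q - 1))
     < (q - 1 + (q + 1) * (M - q)) * (M - q) / ((M - q) * (q - 1))"
    unfolding R_def using Mq pos by (intro divide_strict_right_mono) auto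
  moreover have "((M - q) + q * (M - A)) * (M - 1 + q\<^sup>2 * (q - 1)) / ((M - q) * (q - 1)) =
     (1 + q * ((M - A) / (M - q))) * ((M - 1 + q\<^sup>2 * (q - 1)) / (q - 1))"
  proof -
    have "((M - q) + q * (M - A)) / (M - q) = 1 + q * ((M - A) / (M - q))"
      using Mq by (simp add: add_divide_distrib)
    then show ?thesis by (metis times_divide_times_eq)
  qed
  moreover have "(q - 1 + (q + 1) * (M - q)) * (M - q) / ((M - q) * (q - 1)) =
     1 + (q + 1) * ((M - q) / (q - 1))"
    using Mq pos by (simp add: add_divide_distrib)
  ultimately show ?thesis by simp
qed

text \<open>Here \<open>P\<close> belongs to the pair with exchanged roles. The right side is what
  undoing the exchange gains through the larger value of \<open>1 - P\<close>; the left side is all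
  that the exchanged product can set against it, the share of its hyperplane summand. As
  \<open>1 - P\<close> is at most \<open>1 / (T\<^sup>2 * q\<^sup>2)\<close>, that share is
  small.\<close>

lemma star_swap_core:
  assumes BA: "q * B \<le> A" and g: "(M - 1) / (q - 1) \<le> g"
    and P: "1 - P \<le> (q * A - 1) / (q - 1) * ((B - 1) / (M - 1))" "P \<le> 1"
  shows "(1 - P) * (q * A * ((T - 1) / (q - 1))) < g * (P * ((A - B) / (M - B)))"
proof -
  have M1: "1 < M" using q q_lt_M by simp
  have "2 * B \<le> q * B" using q pos by (intro mult_right_mono) auto
  with BA have A2: "A / 2 \<le> A - B" by linarith
  have "1 * B < q * B" using q pos by (intro mult_strict_right_mono) auto
  then have BM: "B < M" using BA A_le_M by linarith
  have "(q * A - 1) / (q - 1) * ((B - 1) / (M - 1)) \<le> (q * A) * (B / M)"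
  proof (rule mult_mono)
    have "q * A - 1 \<le> q * A * 1" by simp
    also have "\<dots> \<le> q * A * (q - 1)" using q pos by (intro mult_left_mono) auto
    finally show "(q * A - 1) / (q - 1) \<le> q * A" using pos by (simp add: divide_simps)
    show "(B - 1) / (M - 1) \<le> B / M" using M1 BM pos by (simp add: divide_simps algebra_simps)
  qed (use pos M1 in auto)
  also have "\<dots> \<le> (q * A) * (B / (A * B * T\<^sup>2 * q ^ 3))"
    using M pos by (intro mult_left_mono divide_left_mono) auto
  also have "\<dots> = 1 / (T * (T * (q * q)))" using pos by (simp add: field_simps eval_nat_numeral)
  finally have P1: "1 - P \<le> 1 / (T * (T * (q * q)))" using P(1) by simp
  have "1 / (T * (T * (q * q))) \<le> 1 / (2 * (2 * (2 * 2)))"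
    using q T pos by (intro divide_left_mono mult_mono) auto
  with P1 have P2: "15 / 16 \<le> P" by simp
  have "(1 - P) * (q * T) \<le> 1 / (T * (T * (q * q))) * (q * T)" using P1 pos by (intro mult_right_mono) auto
  also have "\<dots> = 1 / (T * q)" using pos by (simp add: field_simps)
  also have "\<dots> \<le> 1 / (2 * 2)" using q T pos by (intro divide_left_mono mult_mono) auto
  finally have P3: "(1 - P) * (q * T) \<le> 1 / 4" by simp
  have "(1 - P) * (q * (T - 1)) \<le> (1 - P) * (q * T)"
    using P(2) pos by (intro mult_left_mono) auto
  with P3 have "(1 - P) * (q * (T - 1)) * A \<le> 1 / 4 * A" using pos by (intro mult_right_mono) auto
  also have "\<dots> < 15 / 16 * (A / 2)" using pos by simp
  also have "\<dots> \<le> P * (A - B)" using P2 A2 pos by (intro mult_mono) auto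
  finally have "(1 - P) * (q * (T - 1)) * A / (q - 1) < P * (A - B) / (q - 1)"
    using pos by (intro divide_strict_right_mono) auto
  also have "\<dots> \<le> P * (A - B) / (q - 1) * ((M - 1) / (M - B))"
  proof -
    have "1 \<le> (M - 1) / (M - B)" using BM pos by simp
    moreover have "0 \<le> P * (A - B) / (q - 1)" using P2 A2 pos by simp
    ultimately show ?thesis using mult_left_mono by fastforce
  qed
  also have "\<dots> = (M - 1) / (q - 1) * (P * ((A - B) / (M - B)))" by simp
  also have "\<dots> \<le> g * (P * ((A - B) / (M - B)))"
    using g P2 A2 BM pos by (intro mult_right_mono) auto
  finally show ?thesis by (simp add: mult_ac)
qed

end

text \<open>The probability that a random \<open>a\<close>-dimensional subspace of an \<open>m\<close>-dimensional space
  meets a fixed \<open>c\<close>-dimensional subspace trivially.\<close>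

definition avoid_prob :: "nat \<Rightarrow> nat \<Rightarrow> nat \<Rightarrow> nat \<Rightarrow> real" where
  "avoid_prob q m a c = real q ^ (c * a) * gauss_binom q (m - c) a / gauss_binom q m a"

context
  fixes q m a :: nat
  assumes q2: "2 \<le> q" and a1: "1 \<le> a" and am: "a \<le> m"
begin

lemma avoid_prob_0: "avoid_prob q m a 0 = 1"
  using gauss_binom_pos[OF q2 am] by (simp add: avoid_prob_def)

lemma avoid_prob_Suc_ratio:
  assumes "a + c < m"
  shows "avoid_prob q m a (Suc c) = avoid_prob q m a c * (real q ^ a * (real q ^ (m - c - a) - 1) / (real q ^ (m - c) - 1))"
proof -
  have mc: "m - c = Suc (m - Suc c)" "a \<le> m - Suc c" using assms by auto
  have "1 < real q ^ (m - c)" using q2 assms by (intro one_less_power) auto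
  then have "gauss_binom q (m - Suc c) a = gauss_binom q (m - c) a * (real q ^ (m - c - a) - 1) / (real q ^ (m - c) - 1)"
    using gauss_binom_top_Suc[OF q2 mc(2)] unfolding mc(1)[symmetric] by (simp add: field_simps)
  then show ?thesis unfolding avoid_prob_def by (simp add: power_add mult_ac)
qed

lemma avoid_prob_Suc:
  assumes "a + c < m"
  shows "avoid_prob q m a (Suc c) = avoid_prob q m a c * ((real q ^ m - real q ^ a * real q ^ c) / (real q ^ m - real q ^ c))"
proof -
  have m: "real q ^ m = real q ^ c * real q ^ (m - c)" "real q ^ (m - c) = real q ^ a * real q ^ (m - c - a)"
    using assms by (simp_all flip: power_add)
  have "(real q ^ m - real q ^ a * real q ^ c) / (real q ^ m - real q ^ c)
    = (real q ^ c * (real q ^ a * (real q ^ (m - c - a) - 1))) / (real q ^ c * (real q ^ (m - c) - 1))"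
    unfolding m(1) by (simp add: m(2) algebra_simps)
  also have "\<dots> = real q ^ a * (real q ^ (m - c - a) - 1) / (real q ^ (m - c) - 1)"
    using q2 by simp
  finally show ?thesis using avoid_prob_Suc_ratio[OF assms] by simp
qed

lemma powers_less: "a + c < m \<Longrightarrow> real q ^ a * real q ^ c < real q ^ m"
  and power_less_m: "c < m \<Longrightarrow> real q ^ c < real q ^ m"
  using q2 by (simp_all flip: power_add)

text \<open>The fourth bound is the union bound over the points of the fixed space. The third has
  the harmonic form \<open>1 / (1 + s)\<close>, which keeps the second-order term: it survives a
  step because \<open>(1 - y) * (1 + (s + y)) \<le> 1 + s\<close>. The second compares with the
  value for \<open>a = 1\<close>. All are proved together, since the step for the fourth uses the
  second.\<close>

lemma avoid_prob_bounds:
  assumes "a + c \<le> m"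
  shows "0 < avoid_prob q m a c"
    "avoid_prob q m a c \<le> (real q ^ m - real q ^ c) / (real q ^ m - 1)"
    "avoid_prob q m a c \<le> 1 / (1 + (real q ^ c - 1) / (real q - 1) * ((real q ^ a - 1) / (real q ^ m - 1)))"
    "1 - avoid_prob q m a c \<le> (real q ^ c - 1) / (real q - 1) * ((real q ^ a - 1) / (real q ^ m - 1))"
  using assms
proof (induction c)
  case 0
  have "1 < real q ^ m" using q2 a1 am by (intro one_less_power) auto
  case 1 show ?case by (simp add: avoid_prob_0)
  case 2 show ?case using \<open>1 < real q ^ m\<close> by (simp add: avoid_prob_0)
  case 3 show ?case by (simp add: avoid_prob_0)
  case 4 show ?case by (simp add: avoid_prob_0)
next
  case (Suc c)
  have q1: "1 < real q" using q2 by simp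
  define M A C where "M = real q ^ m" and "A = real q ^ a" and "C = real q ^ c"
  define P where "P = avoid_prob q m a c"
  define x where "x = (A - 1) / (M - 1)"
  define s where "s = (C - 1) / (real q - 1) * x"
  have AC: "A * C < M" "C < M" "1 \<le> C" "real q \<le> A"
    if "a + Suc c \<le> m"
  proof -
    show "A * C < M" using powers_less that unfolding A_def C_def M_def by simp
    show "C < M" using power_less_m[of c] that a1 unfolding C_def M_def by simp
    show "1 \<le> C" unfolding C_def using q1 by simp
    show "real q \<le> A" unfolding A_def using q1 a1 by (intro self_le_power) auto
  qed
  have eq: "avoid_prob q m a (Suc c) = P * ((M - A * C) / (M - C))" if "a + Suc c \<le> m"
    using avoid_prob_Suc that unfolding M_def A_def C_def P_def by simp
  have step: "(real q * C - 1) / (real q - 1) = (C - 1) / (real q - 1) + C"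
    using q1 by (simp add: field_simps)
  {
    case 1
    then show ?case using Suc(1) eq AC unfolding P_def by simp
  next
    case 2
    have "P * ((M - A * C) / (M - C)) \<le> (M - C) / (M - 1) * ((M - A * C) / (M - C))"
      using Suc(2) 2 AC[OF 2] unfolding P_def M_def C_def by (intro mult_right_mono) auto
    also have "\<dots> = (M - A * C) / (M - 1)" using AC[OF 2] by simp
    also have "\<dots> \<le> (M - real q * C) / (M - 1)"
      using AC[OF 2] by (intro divide_right_mono diff_left_mono mult_right_mono) auto
    finally show ?case unfolding eq[OF 2] by (simp add: M_def C_def)
  next
    case 3
    note AC = AC[OF 3]
    have M1: "1 < M" using AC by simp
    have x0: "0 \<le> x" using AC q1 M1 by (simp add: x_def)
    have s0: "0 \<le> s" unfolding s_def using x0 AC q1 by simp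
    define y where "y = C * x"
    have y0: "0 \<le> y" unfolding y_def using AC x0 by simp
    have "(M - A * C) / (M - C) \<le> 1 - y"
    proof -
      have "(M - A * C) / (M - C) = 1 - C * ((A - 1) / (M - C))" using AC by (simp add: field_simps)
      moreover have "x \<le> (A - 1) / (M - C)"
        unfolding x_def using AC q1 by (intro divide_left_mono) auto
      then have "C * x \<le> C * ((A - 1) / (M - C))" using AC by (intro mult_left_mono) auto
      ultimately show ?thesis unfolding y_def by linarith
    qed
    moreover have "P \<le> 1 / (1 + s)" using Suc(3) 3 unfolding P_def s_def x_def M_def A_def C_def by simp
    ultimately have "P * ((M - A * C) / (M - C)) \<le> 1 / (1 + s) * (1 - y)"
      using AC s0 by (intro mult_mono) auto
    also have "\<dots> \<le> 1 / (1 + (s + y))"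
    proof -
      have "(1 - y) * (1 + (s + y)) = 1 + s - y * s - y * y" by (simp add: algebra_simps)
      moreover have "0 \<le> y * s" "0 \<le> y * y" using y0 s0 by auto
      ultimately have "(1 - y) * (1 + (s + y)) \<le> 1 + s" by linarith
      then show ?thesis using y0 s0 by (simp add: divide_simps mult_ac)
    qed
    also have "s + y = (real q * C - 1) / (real q - 1) * x"
      unfolding s_def y_def step by (simp add: algebra_simps)
    finally show ?case unfolding eq[OF 3] by (simp add: x_def M_def C_def A_def)
  next
    case 4
    note AC = AC[OF 4]
    have P2: "P \<le> (M - C) / (M - 1)" using Suc(2) 4 unfolding P_def M_def C_def by simp
    have "P * ((M - A * C) / (M - C)) = P - P * (C * (A - 1) / (M - C))" using AC by (simp add: field_simps)
    moreover have "P * (C * (A - 1) / (M - C)) \<le> (M - C) / (M - 1) * (C * (A - 1) / (M - C))"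
      using P2 AC q1 by (intro mult_right_mono) auto
    moreover have "(M - C) / (M - 1) * (C * (A - 1) / (M - C)) = C * x" using AC by (simp add: x_def)
    moreover have "1 - P \<le> s" using Suc(4) 4 unfolding P_def s_def x_def M_def A_def C_def by simp
    ultimately have "1 - P * ((M - A * C) / (M - C)) \<le> s + C * x" by linarith
    also have "\<dots> = (real q * C - 1) / (real q - 1) * x"
      unfolding s_def step by (simp add: algebra_simps)
    finally show ?case unfolding eq[OF 4] by (simp add: x_def M_def C_def A_def)
  }
qed

text \<open>Two independent random subspaces meet trivially with the same probability whichever of
  them is held fixed. This links the values of \<open>P\<close> for a pair and for its
  exchange.\<close>

lemma avoid_prob_commute:
  assumes "a + c \<le> m"
  shows "avoid_prob q m a c = avoid_prob q m c a"
  using assms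
proof (induction c)
  case 0
  show ?case by (simp add: avoid_prob_0) (simp add: avoid_prob_def)
next
  case (Suc c)
  have p: "1 < real q ^ Suc c" "1 < real q ^ (m - c)"
    using q2 Suc.prems a1 by (auto intro!: one_less_power simp del: power_Suc)
  have g: "gauss_binom q m (Suc c) = gauss_binom q m c * (real q ^ (m - c) - 1) / (real q ^ Suc c - 1)"
    "gauss_binom q (m - a) (Suc c) = gauss_binom q (m - a) c * (real q ^ (m - c - a) - 1) / (real q ^ Suc c - 1)"
    using gauss_binom_right_Suc[OF q2, of c m] gauss_binom_right_Suc[OF q2, of c "m - a"] Suc.prems p(1)
    by (simp_all add: field_simps diff_commute del: power_Suc)
  have "avoid_prob q m (Suc c) a = avoid_prob q m c a * (real q ^ a * (real q ^ (m - c - a) - 1) / (real q ^ (m - c) - 1))"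
    unfolding avoid_prob_def g using p(1) by (simp add: power_add del: power_Suc)
  then show ?case using avoid_prob_Suc_ratio[of c] Suc by simp
qed

end

section \<open>Covers\<close>

locale cross_pair = finite_field_space scale Basis q
  for scale :: "'a::{field,finite} \<Rightarrow> 'b::ab_group_add \<Rightarrow> 'b" and Basis and q +
  fixes n k l t :: nat and \<F> \<G> :: "'b set set"
  assumes n_eq: "card Basis = n"
    and t_pos: "0 < t" and t_less: "t < k" "t < l" and n_large: "k + l + t + 3 \<le> n"
    and F_sub: "\<F> \<subseteq> subspaces_of_dim scale UNIV k" and G_sub: "\<G> \<subseteq> subspaces_of_dim scale UNIV l"
    and cross: "\<And>F G. F \<in> \<F> \<Longrightarrow> G \<in> \<G> \<Longrightarrow> t \<le> dim (F \<inter> G)"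
    and F_ne: "\<F> \<noteq> {}" and G_ne: "\<G> \<noteq> {}"
begin

text \<open>The locale puts no order on \<open>k\<close> and \<open>l\<close>, so each result about
  \<F> turns into one about \<G>. The later interpretations named \<open>opp\<close> rest on
  this.\<close>

lemma swap_pair: "cross_pair scale Basis q n l k t \<G> \<F>"
  using n_eq t_pos t_less n_large F_sub G_sub cross F_ne G_ne
  by unfold_locales (simp_all, subst Int_commute, simp)

lemma dim_space: "dim UNIV = n" using n_eq by simp

lemma F: "F \<in> \<F> \<Longrightarrow> subspace F \<and> dim F = k"
  and G: "G \<in> \<G> \<Longrightarrow> subspace G \<and> dim G = l"
  using F_sub G_sub by (auto simp: subspaces_of_dim_iff)

lemma card_star_le:
  assumes "subspace S" "dim S \<le> k"
  shows "real (card (star \<F> S)) \<le> gauss_binom q (n - dim S) (k - dim S)"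
proof -
  have "card (star \<F> S) \<le> card {F \<in> subspaces_of_dim scale UNIV k. S \<subseteq> F}"
    using F_sub by (intro card_mono) (auto simp: star_def)
  then have "real (card (star \<F> S)) \<le> real (card {F \<in> subspaces_of_dim scale UNIV k. S \<subseteq> F})"
    by (rule of_nat_mono)
  also have "\<dots> = gauss_binom q (n - dim S) (k - dim S)"
    using card_above[of S UNIV k] assms dim_space by simp
  finally show ?thesis .
qed

lemma card_star_step:
  assumes S: "subspace S" "\<not> covers t \<G> S"
    and c: "\<And>R. subspace R \<Longrightarrow> S \<subseteq> R \<Longrightarrow> dim R = dim S + 1 \<Longrightarrow> real (card (star \<F> R)) \<le> c" "0 \<le> c"
  shows "real (card (star \<F> S)) \<le> gauss_binom q (l - t + 1) 1 * c"
proof -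
  obtain H where H: "H \<in> \<G>" "dim (S \<inter> H) < t"
  proof -
    obtain H where "H \<in> \<G>" "\<not> t \<le> dim (H \<inter> S)" using S unfolding covers_def by blast
    then show ?thesis using that[of H] by (simp add: Int_commute)
  qed
  have dH: "subspace H" "dim H = l" using G H(1) by auto
  obtain \<R> where R: "\<And>R. R \<in> \<R> \<Longrightarrow> subspace R \<and> S \<subseteq> R \<and> dim R = dim S + 1"
    "real (card \<R>) \<le> gauss_binom q (dim H - t + 1) 1"
    "\<And>F. subspace F \<Longrightarrow> S \<subseteq> F \<Longrightarrow> t \<le> dim (F \<inter> H) \<Longrightarrow> \<exists>R\<in>\<R>. R \<subseteq> F"
    using extensions_meeting[OF S(1) dH(1) H(2)] dH(2) t_less by (metis less_imp_le_nat)
  have "real (card (star \<F> S)) \<le> real (card \<R>) * c"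
  proof (rule real_card_UN_le)
    show "star \<F> S \<subseteq> (\<Union>R\<in>\<R>. star \<F> R)"
    proof
      fix F' assume "F' \<in> star \<F> S"
      then have h: "F' \<in> \<F>" "S \<subseteq> F'" by (auto simp: star_def)
      then obtain R where "R \<in> \<R>" "R \<subseteq> F'" using R(3)[of F'] F[of F'] cross[of F' H] H(1) by auto
      with h show "F' \<in> (\<Union>R\<in>\<R>. star \<F> R)" by (auto simp: star_def)
    qed
  qed (use R c in auto)
  also have "\<dots> \<le> gauss_binom q (l - t + 1) 1 * c"
    using R(2) G[OF H(1)] c(2) by (intro mult_right_mono) auto
  finally show ?thesis .
qed

lemma card_star_iterate:
  assumes no: "\<And>S. covers t \<G> S \<Longrightarrow> d \<le> dim S" and "d \<le> k"
    and "subspace S" "dim S \<le> d"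
  shows "real (card (star \<F> S))
    \<le> gauss_binom q (l - t + 1) 1 ^ (d - dim S) * gauss_binom q (n - d) (k - d)"
  using assms(3,4)
proof (induction "d - dim S" arbitrary: S)
  case 0
  then show ?case using card_star_le[of S] \<open>d \<le> k\<close> by simp
next
  case (Suc i)
  have "real (card (star \<F> S)) \<le> gauss_binom q (l - t + 1) 1 * (gauss_binom q (l - t + 1) 1 ^ i * gauss_binom q (n - d) (k - d))"
  proof (rule card_star_step)
    show "\<not> covers t \<G> S" using no[of S] Suc(2) by linarith
  next
    fix R assume R: "subspace R" "S \<subseteq> R" "dim R = dim S + 1"
    then have "i = d - dim R" "dim R \<le> d" using Suc(2) by linarith+
    then show "real (card (star \<F> R)) \<le> gauss_binom q (l - t + 1) 1 ^ i * gauss_binom q (n - d) (k - d)"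
      using Suc.hyps(1)[of R] R by simp
  next
    show "0 \<le> gauss_binom q (l - t + 1) 1 ^ i * gauss_binom q (n - d) (k - d)"
      using q_ge_2 by (intro mult_nonneg_nonneg zero_le_power gauss_binom_nonneg)
  qed (rule Suc(3))
  then show ?case unfolding Suc(2)[symmetric] by (simp add: mult.assoc)
qed

text \<open>Every member meets the cover in dimension at least \<open>t\<close> and so contains one
  of the \<open>t\<close>-subspaces of the cover.\<close>

lemma card_cover_le:
  assumes T: "covers t \<F> T" and c: "\<And>S. subspace S \<Longrightarrow> dim S = t \<Longrightarrow> real (card (star \<F> S)) \<le> c"
  shows "real (card \<F>) \<le> gauss_binom q (dim T) t * c"
proof -
  have "real (card \<F>) \<le> real (card (subspaces_of_dim scale T t)) * c"
  proof (rule real_card_UN_le)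
    show "\<F> \<subseteq> (\<Union>S\<in>subspaces_of_dim scale T t. star \<F> S)"
    proof
      fix F' assume F': "F' \<in> \<F>"
      then have "subspace (F' \<inter> T)" "t \<le> dim (F' \<inter> T)"
        using T F subspace_inter by (auto simp: covers_def)
      then obtain S where "subspace S" "S \<subseteq> F' \<inter> T" "dim S = t" by (rule ex_subspace_of_dim)
      then have "S \<in> subspaces_of_dim scale T t" "F' \<in> star \<F> S"
        using F' by (auto simp: star_def subspaces_of_dim_iff)
      then show "F' \<in> (\<Union>S\<in>subspaces_of_dim scale T t. star \<F> S)" by blast
    qed
  qed (use c in \<open>auto simp: subspaces_of_dim_iff\<close>)
  then show ?thesis using card_subspaces_of_dim T by (simp add: covers_def)
qed

lemma covers_dim_ge: "covers t \<F> T \<Longrightarrow> t \<le> dim T"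
proof -
  assume T: "covers t \<F> T"
  obtain F' where "F' \<in> \<F>" using F_ne by blast
  then have "t \<le> dim (F' \<inter> T)" using T by (simp add: covers_def)
  also have "\<dots> \<le> dim T" by (intro dim_subset) simp
  finally show ?thesis .
qed

lemma member_covers: "G' \<in> \<G> \<Longrightarrow> covers t \<F> G'"
  using cross G by (simp add: covers_def)

lemma tau: "\<exists>T. covers t \<F> T \<and> dim T = \<tau> t \<F>" "covers t \<F> T \<Longrightarrow> \<tau> t \<F> \<le> dim T" "\<tau> t \<F> \<le> l" "t \<le> \<tau> t \<F>"
proof -
  obtain G' where "G' \<in> \<G>" using G_ne by blast
  then have *: "covers t \<F> G'" "dim G' = l" using member_covers G by auto
  then have "\<exists>d T. covers t \<F> T \<and> dim T = d" by blast
  then show 1: "\<exists>T. covers t \<F> T \<and> dim T = \<tau> t \<F>" unfolding \<tau>_def by (rule LeastI_ex)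
  show 2: "\<tau> t \<F> \<le> dim T" if "covers t \<F> T" for T
    unfolding \<tau>_def using that by (intro Least_le exI conjI) auto
  show "\<tau> t \<F> \<le> l" using 2[OF *(1)] *(2) by simp
  from 1 obtain T where T: "covers t \<F> T" "dim T = \<tau> t \<F>" by blast
  show "t \<le> \<tau> t \<F>" using covers_dim_ge[OF T(1)] T(2) by simp
qed

abbreviation gb :: "nat \<Rightarrow> nat \<Rightarrow> real" where "gb \<equiv> gauss_binom q"

sublocale bnd: product_bounds "real q" "real q ^ (k - t)" "real q ^ (l - t)" "real q ^ t" "real q ^ (n - t)"
proof
  have q1: "1 \<le> real q" using q_ge_2 by simp
  show "2 \<le> real q" using q_ge_2 by simp
  show "real q \<le> real q ^ (k - t)" "real q \<le> real q ^ (l - t)" "real q \<le> real q ^ t"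
    using t_less t_pos q1 by (auto intro!: self_le_power)
  have "real q ^ (k - t) * real q ^ (l - t) * (real q ^ t)\<^sup>2 * real q ^ 3 = real q ^ ((k - t) + (l - t) + t * 2 + 3)"
    by (simp add: power_add power_mult)
  also have "\<dots> \<le> real q ^ (n - t)" using n_large t_less q1 by (intro power_increasing) auto
  finally show "real q ^ (k - t) * real q ^ (l - t) * (real q ^ t)\<^sup>2 * real q ^ 3 \<le> real q ^ (n - t)" .
qed

section \<open>Sizes of stars and products in the chosen units\<close>

definition \<phi> :: "nat \<Rightarrow> real" where "\<phi> j = gb (n - t - 1) (j - t - 1)"

lemma gb_point: "gb x 1 = (real q ^ x - 1) / (real q - 1)"
  by (rule gauss_binom_1)

lemma phi_pos: "0 < \<phi> k" "0 < \<phi> l"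
  using q_ge_2 n_large t_less by (auto simp: \<phi>_def intro!: gauss_binom_pos)

lemma gb_nonneg [simp]: "0 \<le> gb x y"
  using q_ge_2 by (rule gauss_binom_nonneg)

lemma gb_phi: "gb (n - t) (k - t) = (real q ^ (n - t) - 1) / (real q ^ (k - t) - 1) * \<phi> k"
proof -
  have "k - t = Suc (k - t - 1)" using t_less by simp
  then show ?thesis using gauss_binom_Suc[of q "n - t" "k - t - 1"] by (simp add: \<phi>_def)
qed

lemma gb_r: "t + 2 \<le> k \<Longrightarrow> gb (n - (t + 2)) (k - (t + 2)) = bnd.r * \<phi> k"
proof -
  assume k: "t + 2 \<le> k"
  have kk: "k - t - 1 = Suc (k - (t + 2))" "k - t = Suc (Suc (k - (t + 2)))" using k by auto
  have nn: "n - t = Suc (n - t - 1)" using n_large by simp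
  have q1: "real q > 1" using q_ge_2 by simp
  have p: "real q ^ i > 1" if "i > 0" for i :: nat using that q1 by (intro one_less_power)
  have 1: "\<phi> k = (real q ^ (n - t - 1) - 1) / (real q ^ (k - t - 1) - 1) * gb (n - (t + 2)) (k - (t + 2))"
    unfolding \<phi>_def kk(1) gauss_binom_Suc using n_large by simp
  have "bnd.r = (real q * real q ^ (k - t - 1) - real q) / (real q * real q ^ (n - t - 1) - real q)"
    unfolding bnd.r_def by (metis kk nn power_Suc)
  also have "\<dots> = (real q * (real q ^ (k - t - 1) - 1)) / (real q * (real q ^ (n - t - 1) - 1))"
    by (simp add: algebra_simps)
  also have "\<dots> = (real q ^ (k - t - 1) - 1) / (real q ^ (n - t - 1) - 1)"
    using q1 by simp
  finally have 2: "bnd.r = (real q ^ (k - t - 1) - 1) / (real q ^ (n - t - 1) - 1)" .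
  have "real q ^ (k - t - 1) > 1" "real q ^ (n - t - 1) > 1" using k n_large by (auto intro!: p)
  then show ?thesis unfolding 1 2 by simp
qed

lemma card_star_point:
  assumes "subspace R" "dim R = t + 1"
  shows "real (card (star \<F> R)) \<le> \<phi> k"
  using card_star_le[of R] assms t_less by (simp add: \<phi>_def)

lemma card_star_line:
  assumes R: "subspace R" "dim R = t + 2"
  shows "real (card (star \<F> R)) \<le> bnd.r * \<phi> k"
proof (cases "t + 2 \<le> k")
  case True
  then show ?thesis using card_star_le[of R] R gb_r by simp
next
  case False
  \<comment> \<open>Here \<open>k = t + 1\<close>, no member is large enough, and \<open>r\<close>
    is zero as well because \<open>A = q\<close>.\<close>
  have "star \<F> R = {}"
  proof (rule equals0I)
    fix H assume "H \<in> star \<F> R"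
    then have "R \<subseteq> H" "dim H = k" using F by (auto simp: star_def)
    then show False using dim_subset[of R H] R False by simp
  qed
  then show ?thesis using bnd.r_nonneg phi_pos by simp
qed

lemma card_star_noncover:
  assumes R: "subspace R" "dim R = t + 1" "\<not> covers t \<G> R"
  shows "real (card (star \<F> R)) \<le> gb (l - t + 1) 1 * (bnd.r * \<phi> k)"
proof (rule card_star_step[OF R(1,3)])
  show "real (card (star \<F> R')) \<le> bnd.r * \<phi> k" if "subspace R'" "dim R' = dim R + 1" for R'
    using that R(2) by (intro card_star_line) auto
  show "0 \<le> bnd.r * \<phi> k" using bnd.r_nonneg phi_pos by simp
qed

text \<open>
  The part of the bound on the product of the two families that depends on \<open>d = \<tau> t \<G>\<close>.
\<close>

definition \<omega> :: "nat \<Rightarrow> real" where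
  "\<omega> d = gb d t * (gb (l - t + 1) 1 ^ (d - t) * gb (n - d) (k - d))"

text \<open>One more dimension multiplies the first binomial by at most \<open>2 * T\<close>, adds a
  factor of at most \<open>q * B\<close>, and shrinks the last binomial at least by
  \<open>B * T\<^sup>2 * q ^ 3\<close>. The ratio is at most
  \<open>2 / (T * q\<^sup>2)\<close>.\<close>

lemma omega_Suc:
  assumes "t \<le> d" "d < k"
  shows "\<omega> (Suc d) \<le> \<omega> d"
proof -
  define y where "y = real q ^ (Suc d - t)"
  define c where "c = gb (l - t + 1) 1"
  have q1: "real q > 1" using q_ge_2 by simp
  have p: "real q ^ i > 1" if "i > 0" for i :: nat using that q1 by (intro one_less_power)
  have y: "2 \<le> y"
  proof -
    have "real q \<le> y" unfolding y_def using q1 assms by (intro self_le_power) auto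
    then show ?thesis using q_ge_2 by simp
  qed
  have yT: "y * real q ^ t = real q ^ Suc d"
    unfolding y_def power_add[symmetric] using assms by simp
  have 1: "gb (Suc d) t = gb d t * ((y * real q ^ t - 1) / (y - 1))"
    using gauss_binom_top_Suc[OF q_ge_2 assms(1)] y unfolding yT y_def[symmetric] by (simp add: field_simps)
  have kd: "k - d = Suc (k - Suc d)" "n - d - 1 = n - Suc d" using assms by auto
  define z where "z = (real q ^ (k - d) - 1) / (real q ^ (n - d) - 1)"
  have pk: "real q ^ (k - d) > 1" and pn: "real q ^ (n - d) > 1"
    using assms n_large by (auto intro!: p)
  have 2: "gb (n - Suc d) (k - Suc d) = z * gb (n - d) (k - d)"
  proof -
    have "gb (n - d) (k - d) = (real q ^ (n - d) - 1) / (real q ^ (k - d) - 1) * gb (n - Suc d) (k - Suc d)"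
      using gauss_binom_Suc[of q "n - d" "k - Suc d"] kd by simp
    then show ?thesis using pk pn by (simp add: z_def)
  qed
  have 3: "c ^ (Suc d - t) = c * c ^ (d - t)" using assms by (simp add: Suc_diff_le)
  have eq: "\<omega> (Suc d) = (((y * real q ^ t - 1) / (y - 1)) * (c * z)) * \<omega> d"
    unfolding \<omega>_def c_def[symmetric] 1 2 3 by simp
  have "(y * real q ^ t - 1) / (y - 1) \<le> 2 * real q ^ t"
  proof -
    have "real q ^ t * 2 \<le> real q ^ t * y" using y by (intro mult_left_mono) auto
    then show ?thesis using y by (simp add: pos_divide_le_eq algebra_simps)
  qed
  moreover have "c * z \<le> (real q * real q ^ (l - t)) * (1 / (real q ^ (l - t) * (real q ^ t)\<^sup>2 * real q ^ 3))"
  proof (rule mult_mono)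
    have "c = (real q * real q ^ (l - t) - 1) / (real q - 1)" by (simp add: c_def gb_point[unfolded One_nat_def])
    also have "\<dots> \<le> real q * real q ^ (l - t) / 1" using q_ge_2 by (intro frac_le) auto
    finally show "c \<le> real q * real q ^ (l - t)" by simp
    have nk: "real q ^ (k - d) \<le> real q ^ (n - d)" using n_large q1 by (intro power_increasing) auto
    have "z \<le> real q ^ (k - d) / real q ^ (n - d)"
    proof -
      have "(u - 1) / (v - 1) \<le> u / v" if "1 < v" "u \<le> v" for u v :: real
        using that by (simp add: divide_simps algebra_simps)
      from this[OF pn nk] show ?thesis unfolding z_def .
    qed
    also have "\<dots> = real q ^ (k - t) / real q ^ (n - t)"
    proof -
      have "real q ^ (k - t) = real q ^ (d - t) * real q ^ (k - d)"
        "real q ^ (n - t) = real q ^ (d - t) * real q ^ (n - d)"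
        using assms n_large by (auto simp flip: power_add)
      then show ?thesis using q1 by simp
    qed
    also have "\<dots> \<le> 1 / (real q ^ (l - t) * (real q ^ t)\<^sup>2 * real q ^ 3)"
      using bnd.A_le_M(1) bnd.pos q1 by (simp add: divide_simps)
    finally show "z \<le> 1 / (real q ^ (l - t) * (real q ^ t)\<^sup>2 * real q ^ 3)" .
    show "0 \<le> z" unfolding z_def using pk pn by simp
  qed (use bnd.pos in auto)
  moreover have "(real q * real q ^ (l - t)) * (1 / (real q ^ (l - t) * (real q ^ t)\<^sup>2 * real q ^ 3))
      = 1 / (real q ^ t * (real q ^ t * (real q * real q)))"
    using q1 by (simp add: field_simps eval_nat_numeral)
  moreover have "0 \<le> c * z" unfolding c_def z_def using pk pn by (intro mult_nonneg_nonneg) auto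
  ultimately have "((y * real q ^ t - 1) / (y - 1)) * (c * z)
      \<le> (2 * real q ^ t) * (1 / (real q ^ t * (real q ^ t * (real q * real q))))"
    by (intro mult_mono) auto
  also have "\<dots> = 2 / (real q ^ t * (real q * real q))" using q1 by simp
  also have "\<dots> \<le> 2 / (1 * (2 * 2))" using q_ge_2 q1 by (intro divide_left_mono mult_mono one_le_power) auto
  also have "2 / (1 * (2 * 2)) \<le> (1 :: real)" by simp
  finally have "((y * real q ^ t - 1) / (y - 1)) * (c * z) \<le> 1" .
  moreover have "0 \<le> \<omega> d" unfolding \<omega>_def by simp
  ultimately show ?thesis unfolding eq using mult_right_mono by fastforce
qed

lemma omega_antimono:
  assumes "t \<le> d" "d \<le> d'" "d' \<le> k"
  shows "\<omega> d' \<le> \<omega> d"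
  using assms(2,1,3)
proof (induction rule: dec_induct)
  case (step m)
  then show ?case using omega_Suc[of m] by simp
qed simp

lemma omega_1: "\<omega> (t + 1) = (real q * real q ^ t - 1) / (real q - 1) * ((real q * real q ^ (l - t) - 1) / (real q - 1)) * \<phi> k"
  using gauss_binom_hyperplanes[OF q_ge_2, of t]
  by (simp add: \<omega>_def \<phi>_def gb_point[unfolded One_nat_def])

lemma omega_2:
  assumes "t + 2 \<le> k"
  shows "\<omega> (t + 2) = ((real q)\<^sup>2 * real q ^ t - 1) * (real q * real q ^ t - 1) / (((real q)\<^sup>2 - 1) * (real q - 1))
    * ((real q * real q ^ (l - t) - 1) / (real q - 1))\<^sup>2 * (bnd.r * \<phi> k)"
proof -
  have "(real q)\<^sup>2 > 1" using q_ge_2 by (intro one_less_power) auto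
  then have "gb (t + 2) t = gb (t + 1) t * ((real q)\<^sup>2 * real q ^ t - 1) / ((real q)\<^sup>2 - 1)"
    using gauss_binom_top_Suc[OF q_ge_2, of t "Suc t"] by (simp add: field_simps eval_nat_numeral)
  also have "gb (t + 1) t = (real q * real q ^ t - 1) / (real q - 1)"
    using gauss_binom_hyperplanes[OF q_ge_2, of t] by simp
  finally have "gb (t + 2) t = ((real q)\<^sup>2 * real q ^ t - 1) * (real q * real q ^ t - 1) / (((real q)\<^sup>2 - 1) * (real q - 1))"
    by (simp add: mult_ac)
  moreover have "gb (n - (t + 2)) (k - (t + 2)) = bnd.r * \<phi> k" using gb_r assms .
  ultimately show ?thesis unfolding \<omega>_def by (simp add: gb_point[unfolded One_nat_def] power2_eq_square)
qed

lemma card_F_le: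
  "real (card \<F>) \<le> gb (\<tau> t \<F>) t * (gb (l - t + 1) 1 ^ (\<tau> t \<G> - t) * gb (n - \<tau> t \<G>) (k - \<tau> t \<G>))"
proof -
  interpret opp: cross_pair scale Basis q n l k t \<G> \<F> by (rule swap_pair)
  obtain T where T: "covers t \<F> T" "dim T = \<tau> t \<F>" using tau(1) by blast
  have "real (card \<F>) \<le> gb (dim T) t * (gb (l - t + 1) 1 ^ (\<tau> t \<G> - t) * gb (n - \<tau> t \<G>) (k - \<tau> t \<G>))"
  proof (rule card_cover_le[OF T(1)])
    fix S assume S: "subspace S" "dim S = t"
    show "real (card (star \<F> S)) \<le> gb (l - t + 1) 1 ^ (\<tau> t \<G> - t) * gb (n - \<tau> t \<G>) (k - \<tau> t \<G>)"
      using card_star_iterate[of "\<tau> t \<G>" S] opp.tau S by simp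
  qed
  then show ?thesis unfolding T(2) .
qed

lemma no_small_covers:
  assumes "t < \<tau> t \<F>" "t < \<tau> t \<G>"
  shows "real (card \<F>) * real (card \<G>) < \<phi> k * \<phi> l * bnd.\<Theta>"
proof -
  interpret opp: cross_pair scale Basis q n l k t \<G> \<F> by (rule swap_pair)
  have "real (card \<F>) * real (card \<G>) \<le>
    (gb (\<tau> t \<F>) t * (gb (l - t + 1) 1 ^ (\<tau> t \<G> - t) * gb (n - \<tau> t \<G>) (k - \<tau> t \<G>))) *
    (gb (\<tau> t \<G>) t * (gb (k - t + 1) 1 ^ (\<tau> t \<F> - t) * gb (n - \<tau> t \<F>) (l - \<tau> t \<F>)))"
    using card_F_le opp.card_F_le by (intro mult_mono) auto
  \<comment> \<open>The factors are regrouped by cover number instead of by family: each family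
    contributes one factor depending on \<tau> of \<F> and one depending on \<tau> of \<G>.\<close>
  also have "\<dots> = \<omega> (\<tau> t \<G>) * opp.\<omega> (\<tau> t \<F>)"
    by (simp add: \<omega>_def opp.\<omega>_def)
  also have "\<dots> \<le> \<omega> (t + 1) * opp.\<omega> (t + 1)"
    using assms tau opp.tau
    by (intro mult_mono omega_antimono opp.omega_antimono) (auto simp: \<omega>_def opp.\<omega>_def)
  also have "\<dots> = \<phi> k * \<phi> l * (((real q * real q ^ t - 1) / (real q - 1))\<^sup>2
      * ((real q * real q ^ (k - t) - 1) / (real q - 1)) * ((real q * real q ^ (l - t) - 1) / (real q - 1)))"
    unfolding omega_1 opp.omega_1 by (simp add: power2_eq_square \<phi>_def opp.\<phi>_def mult_ac)
  also have "\<dots> < \<phi> k * \<phi> l * bnd.\<Theta>"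
    using bnd.both_covers_large phi_pos by (intro mult_strict_left_mono) auto
  finally show ?thesis .
qed

lemma one_large_cover:
  assumes "t + 1 < \<tau> t \<G>" "subspace X" "dim X = t" "\<And>F. F \<in> \<F> \<Longrightarrow> X \<subseteq> F"
  shows "real (card \<F>) * real (card \<G>) < \<phi> k * \<phi> l * bnd.\<Theta>"
proof -
  interpret opp: cross_pair scale Basis q n l k t \<G> \<F> by (rule swap_pair)
  have "covers t \<F> X" unfolding covers_def using assms F by (auto simp: Int_absorb1)
  then have tF: "\<tau> t \<F> = t" using tau(2)[of X] tau(4) assms(3) by simp
  have "real (card \<F>) * real (card \<G>) \<le>
    (gb t t * (gb (l - t + 1) 1 ^ (\<tau> t \<G> - t) * gb (n - \<tau> t \<G>) (k - \<tau> t \<G>))) *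
    (gb (\<tau> t \<G>) t * (gb (k - t + 1) 1 ^ (t - t) * gb (n - t) (l - t)))"
    using card_F_le opp.card_F_le unfolding tF by (intro mult_mono) auto
  also have "\<dots> = \<omega> (\<tau> t \<G>) * gb (n - t) (l - t)"
    using gauss_binom_self[OF q_ge_2] by (simp add: \<omega>_def)
  also have "\<dots> \<le> \<omega> (t + 2) * gb (n - t) (l - t)"
    using assms opp.tau by (intro mult_right_mono omega_antimono) auto
  also have "\<dots> = \<phi> k * \<phi> l * (((real q * real q ^ (l - t) - 1) / (real q - 1))\<^sup>2 * bnd.r *
     (((real q)\<^sup>2 * real q ^ t - 1) * (real q * real q ^ t - 1) / (((real q)\<^sup>2 - 1) * (real q - 1)))
    * ((real q ^ (n - t) - 1) / (real q ^ (l - t) - 1)))"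
  proof -
    have "t + 2 \<le> k" using assms opp.tau by simp
    from omega_2[OF this] opp.gb_phi show ?thesis by (simp add: \<phi>_def opp.\<phi>_def)
  qed
  also have "\<dots> < \<phi> k * \<phi> l * bnd.\<Theta>"
    using bnd.one_cover_large phi_pos by (intro mult_strict_left_mono) auto
  finally show ?thesis .
qed

text \<open>Inclusions are enough here; equality of the families is recovered later from equality of
  the products.\<close>

definition large_pair_structure :: "'b set \<Rightarrow> bool" where
  "large_pair_structure X \<longleftrightarrow>
    (\<exists>M \<in> subspaces_of_dim scale UNIV (l + 1). X \<subseteq> M \<and> \<F> \<subseteq> family_A scale k (t + 1) X M \<and> \<G> \<subseteq> family_B scale l X M)
    \<or> (\<exists>T \<in> subspaces_of_dim scale UNIV (t + 1). \<F> \<subseteq> family_C scale k T \<and> \<G> \<subseteq> family_D scale l t T)"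

lemma gb_shift:
  assumes "i \<le> l - t"
  shows "gb (n - t - i) (l - t - i) \<le> (real q ^ (l - t) / real q ^ (n - t)) ^ i * gb (n - t) (l - t)"
  using assms
proof (induction i)
  case (Suc i)
  have q1: "real q > 1" using q_ge_2 by simp
  define u where "u = real q ^ (l - t - i)"
  define v where "v = real q ^ (n - t - i)"
  have u: "1 < u" unfolding u_def using Suc.prems q1 by (intro one_less_power) auto
  have uv: "u \<le> v" unfolding u_def v_def using q1 n_large by (intro power_increasing) auto
  have eq: "u / v = real q ^ (l - t) / real q ^ (n - t)"
  proof -
    have "real q ^ (l - t) = real q ^ i * u" "real q ^ (n - t) = real q ^ i * v"
      using Suc.prems n_large unfolding u_def v_def by (auto simp flip: power_add)
    then show ?thesis using q1 by simp
  qed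
  have "l - t - i = Suc (l - t - Suc i)" using Suc.prems by simp
  then have "gb (n - t - i) (l - t - i) = (v - 1) / (u - 1) * gb (n - t - Suc i) (l - t - Suc i)"
    using gauss_binom_Suc[of q "n - t - i" "l - t - Suc i"] by (simp add: u_def v_def)
  then have "gb (n - t - Suc i) (l - t - Suc i) = (u - 1) / (v - 1) * gb (n - t - i) (l - t - i)"
    using u uv by simp
  also have "\<dots> \<le> u / v * gb (n - t - i) (l - t - i)"
  proof (rule mult_right_mono)
    show "(u - 1) / (v - 1) \<le> u / v" using u uv by (simp add: divide_simps algebra_simps)
  qed simp
  also have "\<dots> \<le> u / v * ((real q ^ (l - t) / real q ^ (n - t)) ^ i * gb (n - t) (l - t))"
    using Suc u uv by (intro mult_left_mono) auto
  finally show ?case unfolding eq by (simp add: mult.assoc)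
qed simp

end

section \<open>A common subspace and a cover of dimension one more\<close>

locale pointed_pair = cross_pair +
  fixes X T
  assumes X: "subspace X" "dim X = t" and X_sub: "\<And>F. F \<in> \<F> \<Longrightarrow> X \<subseteq> F"
    and T: "covers t \<G> T" "dim T = t + 1" "X \<subseteq> T"
    and nontrivial: "\<exists>G\<in>\<G>. \<not> X \<subseteq> G"
begin

definition \<G>' where "\<G>' = {G \<in> \<G>. \<not> X \<subseteq> G}"

definition Z where "Z = (\<Inter>G\<in>\<G>'. span (G \<union> X))"

lemma G': "G \<in> \<G>' \<Longrightarrow> G \<in> \<G> \<and> subspace G \<and> dim G = l \<and> \<not> X \<subseteq> G"
  using G by (auto simp: \<G>'_def)

lemma G'_ne: "\<G>' \<noteq> {}" using nontrivial by (auto simp: \<G>'_def)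

lemma dim_G'_X: "G \<in> \<G>' \<Longrightarrow> dim (G \<inter> X) + 1 = t"
  and T_sub_G'_X: "G \<in> \<G>' \<Longrightarrow> T \<subseteq> span (G \<union> X)"
  using subset_span_Un_of_inter[of T X G] T X G' unfolding covers_def by auto

lemma dim_span_G'_X: "G \<in> \<G>' \<Longrightarrow> dim (span (G \<union> X)) = l + 1"
  using dim_span_Un[of G X] G'[of G] X dim_G'_X[of G] by simp

lemma Z: "subspace Z" "X \<subseteq> Z" "T \<subseteq> Z" "G \<in> \<G>' \<Longrightarrow> Z \<subseteq> span (G \<union> X)"
proof -
  show "subspace Z" unfolding Z_def by (intro subspace_Inter) auto
  show "T \<subseteq> Z" unfolding Z_def using T_sub_G'_X by blast
  then show "X \<subseteq> Z" using T by simp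
  show "G \<in> \<G>' \<Longrightarrow> Z \<subseteq> span (G \<union> X)" unfolding Z_def by blast
qed

lemma dim_Z: "t + 1 \<le> dim Z" "dim Z \<le> l + 1"
proof -
  show "t + 1 \<le> dim Z" using dim_subset[OF Z(3)] T by simp
  obtain G where "G \<in> \<G>'" using G'_ne by blast
  then show "dim Z \<le> l + 1" using dim_subset[OF Z(4)] dim_span_G'_X by metis
qed

definition w where "w = dim Z - t"

lemma w: "1 \<le> w" "w \<le> l - t + 1" "dim Z = t + w"
  using dim_Z t_less unfolding w_def by auto

text \<open>\<open>G\<close> is a hyperplane of \<open>G + X\<close>, so it cuts any
  \<open>Y\<close> inside \<open>G + X\<close> in at most one dimension less; it does not contain
  \<open>Y\<close>, because it does not contain \<open>X\<close>.\<close>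

lemma dim_G'_inter:
  assumes "G \<in> \<G>'" "subspace Y" "X \<subseteq> Y" "Y \<subseteq> span (G \<union> X)"
  shows "dim (G \<inter> Y) + 1 = dim Y"
proof -
  have "dim (G \<inter> Y) \<noteq> dim Y"
  proof
    assume "dim (G \<inter> Y) = dim Y"
    then have "G \<inter> Y = Y" using G'[OF assms(1)] assms(2) subspace_inter by (intro subspace_dim_equal) auto
    then show False using G'[OF assms(1)] assms(3) by auto
  qed
  moreover have "dim (G \<inter> Y) \<le> dim Y" by (intro dim_subset) simp
  moreover have "dim Y \<le> dim (G \<inter> Y) + 1"
    using dim_inter_of_hyperplane[of G Y "span (G \<union> X)"] G'[OF assms(1)] assms subset_span_Un1 dim_span_G'_X
    by simp
  ultimately show ?thesis by simp
qed

text \<open>Each such \<open>G\<close> is counted through its trace \<open>G \<inter> Y\<close>, a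
  hyperplane of \<open>Y\<close> that does not contain \<open>X\<close>.\<close>

lemma card_G'_through:
  assumes Y: "subspace Y" "X \<subseteq> Y" "t < dim Y" "dim Y \<le> l + 1"
  shows "real (card {G \<in> \<G>'. Y \<subseteq> span (G \<union> X)})
    \<le> real q ^ (dim Y - t) * ((real q ^ t - 1) / (real q - 1)) * gb (n - (dim Y - 1)) (l - (dim Y - 1))"
proof -
  interpret opp: cross_pair scale Basis q n l k t \<G> \<F> by (rule swap_pair)
  let ?H = "{H \<in> subspaces_of_dim scale Y (dim Y - 1). \<not> X \<subseteq> H}"
  have "real (card {G \<in> \<G>'. Y \<subseteq> span (G \<union> X)}) \<le> real (card ?H) * gb (n - (dim Y - 1)) (l - (dim Y - 1))"
  proof (rule real_card_UN_le)
    show "{G \<in> \<G>'. Y \<subseteq> span (G \<union> X)} \<subseteq> (\<Union>H\<in>?H. star \<G> H)"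
    proof
      fix G assume "G \<in> {G \<in> \<G>'. Y \<subseteq> span (G \<union> X)}"
      then have h: "G \<in> \<G>'" "Y \<subseteq> span (G \<union> X)" by auto
      note G' = G'[OF h(1)]
      have "dim (G \<inter> Y) + 1 = dim Y" using dim_G'_inter h Y by blast
      then have "G \<inter> Y \<in> ?H"
        using G' Y subspace_inter by (auto simp: subspaces_of_dim_iff)
      moreover have "G \<in> star \<G> (G \<inter> Y)" using G' by (simp add: star_def)
      ultimately show "G \<in> (\<Union>H\<in>?H. star \<G> H)" by blast
    qed
    show "real (card (star \<G> H)) \<le> gb (n - (dim Y - 1)) (l - (dim Y - 1))" if "H \<in> ?H" for H
      using opp.card_star_le[of H] that Y by (auto simp: subspaces_of_dim_iff)
  qed auto
  then show ?thesis using card_hyperplanes_avoiding[OF X(1) Y(1,2)] Y(3) X(2) by simp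
qed

lemma card_G_le: "real (card \<G>) \<le> gb (n - t) (l - t) + real (card \<G>')"
proof -
  interpret opp: cross_pair scale Basis q n l k t \<G> \<F> by (rule swap_pair)
  have "card \<G> \<le> card (star \<G> X \<union> \<G>')" by (intro card_mono) (auto simp: star_def \<G>'_def)
  also have "\<dots> \<le> card (star \<G> X) + card \<G>'" by (rule card_Un_le)
  finally have "real (card \<G>) \<le> real (card (star \<G> X)) + real (card \<G>')"
    by (simp only: of_nat_add[symmetric] of_nat_le_iff)
  then show ?thesis using opp.card_star_le[of X] X t_less by simp
qed

text \<open>The intersection is \<open>(F' \<inter> G') + X\<close> by the modular law. Because
  \<open>F'\<close> contains \<open>X\<close>, only the \<open>(t - 1)\<close>-space
  \<open>G' \<inter> X\<close> is shared, so adding \<open>X\<close> raises the dimension by exactly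
  one.\<close>

lemma dim_F_inter_G'_X:
  assumes "F' \<in> \<F>" "G' \<in> \<G>'"
  shows "t + 1 \<le> dim (F' \<inter> span (G' \<union> X))"
proof -
  note G' = G'[OF assms(2)]
  have F': "subspace F'" "X \<subseteq> F'" using F X_sub assms by auto
  have sub: "subspace (F' \<inter> G')" using F' G' subspace_inter by blast
  have "F' \<inter> span (G' \<union> X) = span ((F' \<inter> G') \<union> X)" using F' G' X by (intro Int_span_Un) auto
  moreover have "F' \<inter> G' \<inter> X = G' \<inter> X" using F' by auto
  ultimately have "dim (F' \<inter> span (G' \<union> X)) + dim (G' \<inter> X) = dim (F' \<inter> G') + t"
    using dim_span_Un[OF sub X(1)] X(2) by simp
  then show ?thesis using cross[of F' G'] dim_G'_X[of G'] assms G' by simp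
qed

lemma ex_point_F_G':
  assumes "F' \<in> \<F>" "G' \<in> \<G>'"
  obtains R where "subspace R" "X \<subseteq> R" "dim R = t + 1" "R \<subseteq> F'" "R \<subseteq> span (G' \<union> X)"
proof -
  have "subspace (F' \<inter> span (G' \<union> X))" using F assms subspace_inter by auto
  moreover have "X \<subseteq> F' \<inter> span (G' \<union> X)" using X_sub assms subset_span_Un2 by auto
  ultimately obtain R where "subspace R" "X \<subseteq> R" "R \<subseteq> F' \<inter> span (G' \<union> X)" "dim R = t + 1"
    using ex_between[of X "F' \<inter> span (G' \<union> X)" "t + 1"] X dim_F_inter_G'_X[OF assms] by auto
  then show ?thesis using that by auto
qed

lemma cover_sub_Z:
  assumes "covers t \<G> R" "X \<subseteq> R" "dim R = t + 1"
  shows "R \<subseteq> Z"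
proof -
  have "R \<subseteq> span (G \<union> X)" if "G \<in> \<G>'" for G
  proof (rule subset_span_Un_of_inter(1))
    show "dim X \<le> dim (G \<inter> R)" using assms(1) G'[OF that] X(2) by (simp add: covers_def)
  qed (use assms X G'[OF that] in \<open>simp_all add: covers_def\<close>)
  then show ?thesis unfolding Z_def by blast
qed

lemma card_points:
  assumes "subspace W" "X \<subseteq> W"
  shows "real (card {R \<in> subspaces_of_dim scale W (t + 1). X \<subseteq> R}) = (real q ^ (dim W - t) - 1) / (real q - 1)"
  using card_above[OF X(1) assms, of "t + 1"] X(2) by (simp add: gb_point[unfolded One_nat_def])

text \<open>With one member of \<open>\<G>'\<close> fixed, each member of \<F> contains a
  \<open>(t + 1)\<close>-space between \<open>X\<close> and the span of that member with
  \<open>X\<close>. Such a space inside \<open>Z\<close> costs \<open>\<phi> k\<close>. Any other is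
  not a cover of \<G>, and one further extension step brings in the proportion
  \<open>r\<close>.\<close>

lemma card_F_le_w:
  "real (card \<F>) \<le> ((real q ^ w - 1) / (real q - 1)
    + (real q * real q ^ (l - t) - real q ^ w) / (real q - 1) * ((real q * real q ^ (l - t) - 1) / (real q - 1)) * bnd.r) * \<phi> k"
proof -
  obtain G\<^sub>0 where G0: "G\<^sub>0 \<in> \<G>'" using G'_ne by blast
  let ?M = "span (G\<^sub>0 \<union> X)"
  let ?P = "{R \<in> subspaces_of_dim scale Z (t + 1). X \<subseteq> R}"
  let ?Q = "{R \<in> subspaces_of_dim scale ?M (t + 1). X \<subseteq> R}"
  have M: "subspace ?M" "X \<subseteq> ?M" "dim ?M = l + 1" "Z \<subseteq> ?M"
    using subset_span_Un2 dim_span_G'_X Z(4) G0 by auto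
  have lt: "l + 1 - t = Suc (l - t)" using t_less by simp
  have PQ: "?P \<subseteq> ?Q" using M(4) by (auto simp: subspaces_of_dim_iff)
  have "card (?Q - ?P) = card ?Q - card ?P" using PQ by (intro card_Diff_subset) auto
  moreover have "card ?P \<le> card ?Q" using PQ by (intro card_mono) auto
  ultimately have cQP: "real (card (?Q - ?P)) = real (card ?Q) - real (card ?P)" by simp
  have cP: "real (card ?P) = (real q ^ w - 1) / (real q - 1)" using card_points[OF Z(1,2)] w(3) by simp
  have cQ: "real (card ?Q) = (real q * real q ^ (l - t) - 1) / (real q - 1)"
    using card_points[OF M(1,2)] M(3) lt by simp
  let ?c = "(real q * real q ^ (l - t) - 1) / (real q - 1)"
  have "\<F> \<subseteq> (\<Union>R\<in>?P. star \<F> R) \<union> (\<Union>R\<in>?Q - ?P. star \<F> R)"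
  proof
    fix F' assume F': "F' \<in> \<F>"
    then obtain R where R: "subspace R" "X \<subseteq> R" "dim R = t + 1" "R \<subseteq> F'" "R \<subseteq> ?M"
      using ex_point_F_G'[OF _ G0] by blast
    then have "R \<in> ?Q" "F' \<in> star \<F> R" using F' by (auto simp: subspaces_of_dim_iff star_def)
    then show "F' \<in> (\<Union>R\<in>?P. star \<F> R) \<union> (\<Union>R\<in>?Q - ?P. star \<F> R)" by blast
  qed
  then have "card \<F> \<le> card ((\<Union>R\<in>?P. star \<F> R) \<union> (\<Union>R\<in>?Q - ?P. star \<F> R))"
    by (intro card_mono finite_family)
  also have "\<dots> \<le> card (\<Union>R\<in>?P. star \<F> R) + card (\<Union>R\<in>?Q - ?P. star \<F> R)"
    by (rule card_Un_le)
  finally have "real (card \<F>) \<le> real (card (\<Union>R\<in>?P. star \<F> R)) + real (card (\<Union>R\<in>?Q - ?P. star \<F> R))"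
    by (simp only: of_nat_add[symmetric] of_nat_le_iff)
  moreover have "real (card (\<Union>R\<in>?P. star \<F> R)) \<le> real (card ?P) * \<phi> k"
  proof (rule real_card_UN_le)
    show "real (card (star \<F> R)) \<le> \<phi> k" if "R \<in> ?P" for R
      using that by (intro card_star_point) (auto simp: subspaces_of_dim_iff)
  qed auto
  moreover have "real (card (\<Union>R\<in>?Q - ?P. star \<F> R)) \<le> real (card (?Q - ?P)) * (?c * (bnd.r * \<phi> k))"
  proof (rule real_card_UN_le)
    fix R assume R: "R \<in> ?Q - ?P"
    then have R': "subspace R" "dim R = t + 1" "X \<subseteq> R" "\<not> R \<subseteq> Z" by (auto simp: subspaces_of_dim_iff)
    then have "\<not> covers t \<G> R" using cover_sub_Z by blast
    from card_star_noncover[OF R'(1,2) this]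
    show "real (card (star \<F> R)) \<le> ?c * (bnd.r * \<phi> k)" by (simp add: gb_point[unfolded One_nat_def])
  qed auto
  ultimately have "real (card \<F>) \<le> real (card ?P) * \<phi> k + real (card (?Q - ?P)) * (?c * (bnd.r * \<phi> k))"
    by linarith
  also have "\<dots> = (real (card ?P) + real (card (?Q - ?P)) * ?c * bnd.r) * \<phi> k" by (simp only: distrib_right mult.assoc)
  finally have le: "real (card \<F>) \<le> (real (card ?P) + real (card (?Q - ?P)) * ?c * bnd.r) * \<phi> k" .
  have "real (card (?Q - ?P)) = (real q * real q ^ (l - t) - real q ^ w) / (real q - 1)"
    unfolding cQP cP cQ by (simp flip: diff_divide_distrib)
  with le show ?thesis unfolding cP by (simp only:)
qed

lemma card_product_intermediate:
  assumes "2 \<le> w" "w \<le> l - t"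
  shows "real (card \<F>) * real (card \<G>) < \<phi> k * \<phi> l * bnd.\<Theta>"
proof -
  interpret opp: cross_pair scale Basis q n l k t \<G> \<F> by (rule swap_pair)
  have q1: "real q > 1" using q_ge_2 by simp
  define B where "B = real q ^ (l - t)"
  define M where "M = real q ^ (n - t)"
  define p where "p = (real q ^ t - 1) / (real q - 1)"
  have BM: "0 < B" "B \<le> M" "0 < M" "real q * B \<le> M"
  proof -
    show "0 < B" "0 < M" unfolding B_def M_def using q1 by auto
    show "B \<le> M" unfolding B_def M_def using q1 n_large by (intro power_increasing) auto
    have "real q * B = real q ^ (Suc (l - t))" unfolding B_def by simp
    also have "\<dots> \<le> M" unfolding M_def using q1 n_large by (intro power_increasing) auto
    finally show "real q * B \<le> M" .
  qed
  have p0: "0 \<le> p" unfolding p_def using bnd.pos q1 by simp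
  obtain i where i: "w = Suc (Suc i)" using assms(1) by (metis Suc_le_D numeral_2_eq_2 Suc_le_mono)
  define e where "e = real q ^ w * p * (B / M) ^ (w - 1)"
  have e0: "0 \<le> e" unfolding e_def using p0 BM by simp
  have e_le: "e \<le> (real q)\<^sup>2 * B * real q ^ t / (M * (real q - 1))"
  proof -
    \<comment> \<open>As \<open>q * B \<le> M\<close>, each dimension of \<open>Z\<close> beyond
      \<open>t + 2\<close> only makes \<open>e\<close> smaller.\<close>
    have "e = (real q)\<^sup>2 * (B / M) * p * (real q * B / M) ^ i"
      unfolding e_def i by (simp add: power_divide power_mult_distrib power2_eq_square)
    also have "\<dots> \<le> (real q)\<^sup>2 * (B / M) * p * 1"
      using BM p0 by (intro mult_left_mono power_le_one) auto
    also have "\<dots> \<le> (real q)\<^sup>2 * (B / M) * (real q ^ t / (real q - 1)) * 1"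
      unfolding p_def using BM q1 by (intro mult_right_mono mult_left_mono divide_right_mono) auto
    finally show ?thesis by simp
  qed
  have "\<G>' = {G \<in> \<G>'. Z \<subseteq> span (G \<union> X)}" using Z(4) by blast
  then have "real (card \<G>') \<le> real q ^ w * p * gb (n - (t + w - 1)) (l - (t + w - 1))"
    using card_G'_through[OF Z(1,2)] w dim_Z p_def by simp
  also have "\<dots> = real q ^ w * p * gb (n - t - (w - 1)) (l - t - (w - 1))"
    using w(1) by (simp add: diff_diff_left)
  also have "\<dots> \<le> real q ^ w * p * ((B / M) ^ (w - 1) * gb (n - t) (l - t))"
    unfolding B_def M_def using p0 assms by (intro mult_left_mono gb_shift) auto
  also have "\<dots> = e * gb (n - t) (l - t)" by (simp add: e_def)
  finally have "real (card \<G>) \<le> (1 + e) * gb (n - t) (l - t)"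
    using card_G_le by (simp add: distrib_right)
  also have "\<dots> = (M - 1) / (B - 1) * (1 + e) * \<phi> l"
    using opp.gb_phi by (simp add: \<phi>_def opp.\<phi>_def B_def M_def)
  finally have G_le: "real (card \<G>) \<le> (M - 1) / (B - 1) * (1 + e) * \<phi> l" .
  define N where "N = (real q ^ w - 1) / (real q - 1) + (real q * B - real q ^ w) / (real q - 1) * ((real q * B - 1) / (real q - 1)) * bnd.r"
  have F_le: "real (card \<F>) \<le> N * \<phi> k" using card_F_le_w by (simp add: N_def B_def)
  have "real (card \<F>) * real (card \<G>) \<le> (N * \<phi> k) * ((M - 1) / (B - 1) * (1 + e) * \<phi> l)"
    using F_le G_le by (intro mult_mono) auto
  also have "\<dots> = \<phi> k * \<phi> l * (N * ((M - 1) / (B - 1) * (1 + e)))" by simp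
  also have "\<dots> < \<phi> k * \<phi> l * bnd.\<Theta>"
  proof (rule mult_strict_left_mono)
    show "N * ((M - 1) / (B - 1) * (1 + e)) < bnd.\<Theta>"
      unfolding N_def B_def M_def
    proof (rule bnd.intermediate_core)
      show "(real q)\<^sup>2 \<le> real q ^ w" using assms q1 by (intro power_increasing) auto
      show "real q ^ w \<le> real q ^ (l - t)" using assms q1 by (intro power_increasing) auto
    qed (use e0 e_le in \<open>simp_all add: B_def M_def\<close>)
  qed (use phi_pos in auto)
  finally show ?thesis .
qed

text \<open>For each \<open>G\<close> in \<open>\<G>'\<close>, the spaces \<open>F\<^sub>0\<close>
  and \<open>G + X\<close> share a \<open>(t + 1)\<close>-space \<open>R\<close> above
  \<open>X\<close>. It differs from \<open>Z\<close>, since \<open>F\<^sub>0\<close> does not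
  contain \<open>Z\<close>, so \<open>G + X\<close> contains the \<open>(t + 2)\<close>-space
  \<open>Z + R\<close>. There are only as many choices of \<open>R\<close> as points of
  \<open>F\<^sub>0\<close> modulo \<open>X\<close>.\<close>

lemma card_product_exceptional:
  assumes w1: "w = 1" and F0: "F\<^sub>0 \<in> \<F>" "\<not> Z \<subseteq> F\<^sub>0"
  shows "real (card \<F>) * real (card \<G>) < \<phi> k * \<phi> l * bnd.\<Theta>"
proof -
  interpret opp: cross_pair scale Basis q n l k t \<G> \<F> by (rule swap_pair)
  have q1: "real q > 1" using q_ge_2 by simp
  have dZ: "dim Z = t + 1" using w w1 by simp
  have F0': "subspace F\<^sub>0" "dim F\<^sub>0 = k" "X \<subseteq> F\<^sub>0" using F X_sub F0 by auto
  define p where "p = (real q ^ t - 1) / (real q - 1)"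
  let ?R = "{R \<in> subspaces_of_dim scale F\<^sub>0 (t + 1). X \<subseteq> R}"
  have dY: "dim (span (Z \<union> R)) = t + 2" if R: "R \<in> ?R" for R
  proof -
    have R': "subspace R" "R \<subseteq> F\<^sub>0" "dim R = t + 1" "X \<subseteq> R" using R by (auto simp: subspaces_of_dim_iff)
    have "dim (Z \<inter> R) \<noteq> t + 1"
    proof
      assume "dim (Z \<inter> R) = t + 1"
      then have "Z \<inter> R = Z" using Z(1) R' dZ subspace_inter by (intro subspace_dim_equal) auto
      then show False using F0(2) R'(2) by blast
    qed
    moreover have "dim (Z \<inter> R) \<le> t + 1" using dim_subset[of "Z \<inter> R" Z] dZ by simp
    moreover have "t \<le> dim (Z \<inter> R)" using dim_subset[of X "Z \<inter> R"] Z(2) R' X by simp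
    ultimately have "dim (Z \<inter> R) = t" by simp
    then show ?thesis using dim_span_Un[OF Z(1) R'(1)] dZ R'(3) by simp
  qed
  have "real (card \<G>') \<le> real (card ?R) * ((real q)\<^sup>2 * p * \<phi> l)"
  proof (rule real_card_UN_le)
    show "\<G>' \<subseteq> (\<Union>R\<in>?R. {G \<in> \<G>'. span (Z \<union> R) \<subseteq> span (G \<union> X)})"
    proof
      fix G assume G: "G \<in> \<G>'"
      then obtain R where R: "subspace R" "X \<subseteq> R" "dim R = t + 1" "R \<subseteq> F\<^sub>0" "R \<subseteq> span (G \<union> X)"
        using ex_point_F_G'[OF F0(1)] by blast
      then have "R \<in> ?R" by (simp add: subspaces_of_dim_iff)
      moreover have "span (Z \<union> R) \<subseteq> span (G \<union> X)" using R Z(4)[OF G] by (intro span_Un_least) auto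
      ultimately show "G \<in> (\<Union>R\<in>?R. {G \<in> \<G>'. span (Z \<union> R) \<subseteq> span (G \<union> X)})" using G by blast
    qed
    fix R assume R: "R \<in> ?R"
    have XY: "X \<subseteq> span (Z \<union> R)" using Z(2) subset_span_Un1 by blast
    show "real (card {G \<in> \<G>'. span (Z \<union> R) \<subseteq> span (G \<union> X)}) \<le> (real q)\<^sup>2 * p * \<phi> l"
      using card_G'_through[OF _ XY] t_less unfolding dY[OF R] by (simp add: p_def \<phi>_def)
  qed auto
  moreover have "real (card ?R) = (real q ^ (k - t) - 1) / (real q - 1)"
    using card_points[OF F0'(1,3)] F0'(2) by simp
  ultimately have cG: "real (card \<G>) \<le> ((real q ^ (n - t) - 1) / (real q ^ (l - t) - 1)
      + (real q ^ (k - t) - 1) / (real q - 1) * (real q)\<^sup>2 * p) * \<phi> l"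
    using card_G_le opp.gb_phi by (simp add: distrib_right \<phi>_def opp.\<phi>_def mult.assoc)
  have cF: "real (card \<F>) \<le> (1 + real q * (real q ^ (l - t) - 1) / (real q - 1)
      * ((real q * real q ^ (l - t) - 1) / (real q - 1)) * bnd.r) * \<phi> k"
    using card_F_le_w q1 by (simp add: w1 right_diff_distrib)
  from cF cG have "real (card \<F>) * real (card \<G>) \<le>
     ((1 + real q * (real q ^ (l - t) - 1) / (real q - 1)
      * ((real q * real q ^ (l - t) - 1) / (real q - 1)) * bnd.r) * \<phi> k) *
     (((real q ^ (n - t) - 1) / (real q ^ (l - t) - 1)
      + (real q ^ (k - t) - 1) / (real q - 1) * (real q)\<^sup>2 * p) * \<phi> l)"
    by (rule mult_mono') auto
  also have "\<dots> = \<phi> k * \<phi> l * ((1 + real q * (real q ^ (l - t) - 1) / (real q - 1)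
      * ((real q * real q ^ (l - t) - 1) / (real q - 1)) * bnd.r) *
     ((real q ^ (n - t) - 1) / (real q ^ (l - t) - 1)
      + (real q ^ (k - t) - 1) / (real q - 1) * (real q)\<^sup>2 * p))"
    by (simp only: mult_ac)
  also have "\<dots> < \<phi> k * \<phi> l * bnd.\<Theta>"
    using bnd.line_core_with_exception phi_pos unfolding p_def by (intro mult_strict_left_mono) auto
  finally show ?thesis .
qed

lemma pointed_structure:
  "real (card \<F>) * real (card \<G>) < \<phi> k * \<phi> l * bnd.\<Theta> \<or> large_pair_structure X"
proof -
  consider "w = 1" | "2 \<le> w" "w \<le> l - t" | "w = l - t + 1" using w(1,2) by linarith
  then show ?thesis
  proof cases
    case 1
    show ?thesis
    proof (cases "\<forall>F\<in>\<F>. Z \<subseteq> F")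
      case True
      have dZ: "dim Z = t + 1" using w(3) 1 by simp
      have TZ: "T = Z" using T Z dZ unfolding covers_def by (intro subspace_dim_equal) auto
      have "\<F> \<subseteq> family_C scale k Z" using True F_sub by (auto simp: family_C_def)
      moreover have "\<G> \<subseteq> family_D scale l t Z"
        using G_sub T(1) unfolding TZ covers_def by (auto simp: family_D_def)
      moreover have "Z \<in> subspaces_of_dim scale UNIV (t + 1)"
        using Z(1) dZ by (simp add: subspaces_of_dim_iff)
      ultimately show ?thesis unfolding large_pair_structure_def by blast
    next
      case False
      then show ?thesis using card_product_exceptional[OF 1] by blast
    qed
  next
    case 2
    then show ?thesis using card_product_intermediate by blast
  next
    case 3
    have dZ: "dim Z = l + 1" using w(3) 3 t_less by simp
    \<comment> \<open>Equal dimensions make all the spaces \<open>G + X\<close> coincide with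
      \<open>Z\<close>, which thereby takes the role of \<open>M\<close> in \<A> and \<B>.\<close>
    have eq: "span (G \<union> X) = Z" if "G \<in> \<G>'" for G
      using Z(1) Z(4)[OF that] dZ dim_span_G'_X[OF that] by (intro subspace_dim_equal[symmetric]) auto
    obtain G\<^sub>0 where G0: "G\<^sub>0 \<in> \<G>'" using G'_ne by blast
    have "t + 1 \<le> dim (F' \<inter> Z)" if "F' \<in> \<F>" for F'
      using dim_F_inter_G'_X[OF that G0] unfolding eq[OF G0] .
    then have "\<F> \<subseteq> family_A scale k (t + 1) X Z" using F_sub X_sub by (auto simp: family_A_def)
    moreover have "\<G> \<subseteq> family_B scale l X Z"
    proof
      fix G assume G: "G \<in> \<G>"
      show "G \<in> family_B scale l X Z"
      proof (cases "X \<subseteq> G")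
        case True
        then show ?thesis using G G_sub by (auto simp: family_B_def)
      next
        case False
        then have Gm: "G \<in> \<G>'" using G by (simp add: \<G>'_def)
        then have "G \<subseteq> Z" using eq[OF Gm] subset_span_Un1[of G X] by simp
        then show ?thesis using G'[OF Gm] by (simp add: family_B_def subspaces_of_dim_iff)
      qed
    qed
    moreover have "Z \<in> subspaces_of_dim scale UNIV (l + 1)"
      using Z(1) dZ by (simp add: subspaces_of_dim_iff)
    ultimately show ?thesis unfolding large_pair_structure_def using Z(2) by blast
  qed
qed

end

context cross_pair begin

text \<open>Closedness of \<F> forces a \<open>(t + 1)\<close>-dimensional cover \<open>T\<close> of
  \<G> to contain \<open>X\<close>: if \<open>T\<close> missed a vector \<open>v\<close> of
  \<open>X\<close>, some \<open>k\<close>-space above \<open>T\<close> would avoid \<open>v\<close>,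
  yet it meets all of \<G> as required, so it belongs to \<F> and has to contain
  \<open>X\<close>.\<close>

lemma structure_with_common_subspace:
  assumes X: "subspace X" "dim X = t" "\<And>F. F \<in> \<F> \<Longrightarrow> X \<subseteq> F"
    and nontrivial: "\<exists>G\<in>\<G>. \<not> X \<subseteq> G"
    and closed: "\<And>H. H \<in> subspaces_of_dim scale UNIV k \<Longrightarrow> \<forall>G\<in>\<G>. t \<le> dim (H \<inter> G) \<Longrightarrow> H \<in> \<F>"
  shows "real (card \<F>) * real (card \<G>) < \<phi> k * \<phi> l * bnd.\<Theta> \<or> large_pair_structure X"
proof (cases "t + 1 < \<tau> t \<G>")
  case True
  then show ?thesis using one_large_cover[OF True X] by blast
next
  case False
  interpret opp: cross_pair scale Basis q n l k t \<G> \<F> by (rule swap_pair)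
  obtain T\<^sub>0 where T0: "covers t \<G> T\<^sub>0" "dim T\<^sub>0 = \<tau> t \<G>" using opp.tau(1) by blast
  have sub0: "subspace T\<^sub>0" using T0 by (simp add: covers_def)
  have "dim T\<^sub>0 \<le> t + 1" "t + 1 \<le> dim UNIV" using False T0 n_large dim_space by auto
  \<comment> \<open>The minimal cover may have dimension \<open>t\<close>; enlarging a cover keeps
    it a cover.\<close>
  then obtain T where T: "subspace T" "T\<^sub>0 \<subseteq> T" "dim T = t + 1"
    using ex_between[OF sub0, of UNIV "t + 1"] by (metis subset_UNIV subspace_UNIV)
  have Tc: "t \<le> dim (G \<inter> T)" if "G \<in> \<G>" for G
  proof -
    have "t \<le> dim (G \<inter> T\<^sub>0)" using T0(1) that by (simp add: covers_def)
    also have "\<dots> \<le> dim (G \<inter> T)" using T(2) by (intro dim_subset) auto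
    finally show ?thesis .
  qed
  have "X \<subseteq> T"
  proof (rule ccontr)
    assume "\<not> X \<subseteq> T"
    then obtain v where v: "v \<in> X" "v \<notin> T" by blast
    let ?M = "span (insert v T)"
    have M: "dim ?M = t + 2" "T \<subseteq> ?M" "v \<in> ?M"
      using dim_insert_notin[OF T(1) v(2)] T(3) span_superset[of "insert v T"] by auto
    have "k - (t + 1) \<le> dim UNIV - dim ?M" using n_large dim_space M by simp
    then obtain H where H: "subspace H" "T \<subseteq> H" "dim H = dim T + (k - (t + 1))" "H \<inter> ?M = T"
      using ex_avoiding[of T ?M UNIV "k - (t + 1)"] T(1) M(2) by (metis subset_UNIV subspace_UNIV subspace_span)
    have dH: "dim H = k" using H(3) T(3) t_less by simp
    have "t \<le> dim (H \<inter> G)" if "G \<in> \<G>" for G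
    proof -
      have "dim (G \<inter> T) \<le> dim (H \<inter> G)" using H(2) by (intro dim_subset) auto
      then show ?thesis using Tc[OF that] by simp
    qed
    then have "H \<in> \<F>" using closed H(1) dH by (simp add: subspaces_of_dim_iff)
    then have "v \<in> H \<inter> ?M" using X(3) v(1) M(3) by blast
    then show False using H(4) v(2) by simp
  qed
  then interpret pointed_pair scale Basis q n k l t \<F> \<G> X T
    using X T Tc nontrivial by unfold_locales (auto simp: covers_def)
  show ?thesis by (rule pointed_structure)
qed

end

section \<open>Comparison of the extremal products\<close>

text \<open>The comparison is with upper bounds of the sizes of \<open>A\<close> and
  \<open>B\<close>, so estimates of the extremal families suffice. Positivity excludes the case
  where one family is empty and the other one is undetermined.\<close>

lemma card_product_le:
  fixes \<alpha> \<beta> :: real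
  assumes "finite A" "finite B" "F \<subseteq> A" "G \<subseteq> B" "real (card A) \<le> \<alpha>" "real (card B) \<le> \<beta>"
  shows "real (card F) * real (card G) \<le> \<alpha> * \<beta>"
    and "\<lbrakk>0 < \<alpha> * \<beta>; real (card F) * real (card G) = \<alpha> * \<beta>\<rbrakk> \<Longrightarrow> F = A \<and> G = B"
proof -
  have FA: "real (card F) \<le> real (card A)" and GB: "real (card G) \<le> real (card B)"
    using assms by (auto intro: card_mono)
  then show "real (card F) * real (card G) \<le> \<alpha> * \<beta>" using assms by (intro mult_mono) auto
  assume pos: "0 < \<alpha> * \<beta>" and eq: "real (card F) * real (card G) = \<alpha> * \<beta>"
  then have "0 < real (card F) * real (card G)" by simp
  then have F0: "0 < real (card F)" and G0: "0 < real (card G)" by (simp_all add: zero_less_mult_iff)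
  have "real (card F) = real (card A)"
  proof (rule ccontr)
    assume "real (card F) \<noteq> real (card A)"
    then have "real (card F) < \<alpha>" using FA assms(5) by simp
    then have "real (card F) * real (card G) < \<alpha> * real (card G)" using G0 by (intro mult_strict_right_mono)
    also have "\<dots> \<le> \<alpha> * \<beta>" using GB assms(5,6) by (intro mult_left_mono) auto
    finally show False using eq by simp
  qed
  moreover have "real (card G) = real (card B)"
  proof (rule ccontr)
    assume "real (card G) \<noteq> real (card B)"
    then have "real (card G) < \<beta>" using GB assms(6) by simp
    then have "real (card F) * real (card G) < real (card F) * \<beta>" using F0 by (intro mult_strict_left_mono)
    also have "\<dots> \<le> \<alpha> * \<beta>" using FA F0 G0 GB assms(5,6) by (intro mult_right_mono) auto
    finally show False using eq by simp
  qed
  ultimately show "F = A \<and> G = B" using assms(1-4) by (auto simp: card_subset_eq)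
qed

context cross_pair begin

section \<open>The two bounds as numbers\<close>

definition star_value :: real where
  "star_value = (gb (n - t) (k - t) - real q ^ ((l + 1 - t) * (k - t)) * gb (n - l - 1) (k - t))
    * (gb (n - t) (l - t) + real q ^ (l + 1 - t) * gb t 1)"

definition line_value :: real where
  "line_value = gb (n - t - 1) (k - t - 1)
    * (real q ^ (l - t) * gb (t + 1) 1 * gb (n - t - 1) (l - t) + gb (n - t - 1) (l - t - 1))"

lemma line_value_eq:
  "line_value = \<phi> k * \<phi> l * (1 + (real q * real q ^ t - 1) / (real q - 1) * ((real q ^ (n - t) - real q ^ (l - t)) / (real q ^ (l - t) - 1)))"
proof -
  have l: "l - t = Suc (l - t - 1)" using t_less by simp
  have le: "l - t - 1 \<le> n - t - 1" using n_large by simp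
  have B: "1 < real q ^ (l - t)" using bnd.pos by simp
  have "n - t - 1 - (l - t - 1) = n - l" using t_less n_large by simp
  then have "gb (n - t - 1) (l - t) * (real q ^ (l - t) - 1) = \<phi> l * (real q ^ (n - l) - 1)"
    using gauss_binom_right_Suc[OF q_ge_2 le] l by (simp add: \<phi>_def)
  then have "gb (n - t - 1) (l - t) = \<phi> l * (real q ^ (n - l) - 1) / (real q ^ (l - t) - 1)"
    using B by (simp add: field_simps)
  moreover have "real q ^ (l - t) * (real q ^ (n - l) - 1) = real q ^ (n - t) - real q ^ (l - t)"
    using t_less n_large by (simp add: right_diff_distrib flip: power_add)
  ultimately have 1: "real q ^ (l - t) * gb (n - t - 1) (l - t)
      = \<phi> l * ((real q ^ (n - t) - real q ^ (l - t)) / (real q ^ (l - t) - 1))"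
    by (simp only: times_divide_eq_right mult.left_commute[of "real q ^ (l - t)"])
  have 2: "gb (t + 1) 1 = (real q * real q ^ t - 1) / (real q - 1)"
    unfolding gb_point by simp
  have "real q ^ (l - t) * gb (t + 1) 1 * gb (n - t - 1) (l - t)
      = gb (t + 1) 1 * (real q ^ (l - t) * gb (n - t - 1) (l - t))"
    by (simp only: mult_ac)
  then show ?thesis unfolding line_value_def \<phi>_def[symmetric] 1 2 by (simp add: distrib_left mult_ac)
qed

lemma codim_bounds: "1 \<le> k - t" "k - t \<le> n - t" "k - t + (l - t + 1) < n - t"
  using t_less n_large by auto

lemma M_gt_1: "1 < real q ^ (n - t)"
  using q_ge_2 n_large by (intro one_less_power) auto

abbreviation "P \<equiv> avoid_prob q (n - t) (k - t) (l - t + 1)"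

text \<open>In the quotient by \<open>X\<close>, of dimension \<open>n - t\<close>, the space
  \<open>M\<close> has dimension \<open>l - t + 1\<close>; \<open>P\<close> is the probability that
  a random \<open>k\<close>-space through \<open>X\<close> meets \<open>M\<close> only in
  \<open>X\<close>.\<close>

lemma star_value_eq:
  "star_value = gb (n - t) (k - t) * (1 - P) * (gb (n - t) (l - t) + real q * real q ^ (l - t) * ((real q ^ t - 1) / (real q - 1)))"
proof -
  have eqs: "l + 1 - t = l - t + 1" "n - l - 1 = n - t - (l - t + 1)" using t_less by auto
  have "gb (n - t) (k - t) \<noteq> 0"
    using gauss_binom_pos[OF q_ge_2 codim_bounds(2)] by simp
  then have 1: "gb (n - t) (k - t) - real q ^ ((l + 1 - t) * (k - t)) * gb (n - l - 1) (k - t)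
      = gb (n - t) (k - t) * (1 - P)"
    unfolding eqs avoid_prob_def by (simp add: right_diff_distrib)
  have 2: "real q ^ (l + 1 - t) * gb t 1 = real q * real q ^ (l - t) * ((real q ^ t - 1) / (real q - 1))"
    unfolding eqs gb_point by simp
  show ?thesis unfolding star_value_def 1 2 ..
qed

lemma gb_l: "gb (n - t) (l - t) = (real q ^ (n - t) - 1) / (real q ^ (l - t) - 1) * \<phi> l"
proof -
  interpret opp: cross_pair scale Basis q n l k t \<G> \<F> by (rule swap_pair)
  show ?thesis using opp.gb_phi by (simp add: \<phi>_def opp.\<phi>_def)
qed

lemma Theta_le_star_value: "\<phi> k * \<phi> l * bnd.\<Theta> \<le> star_value"
proof -
  define s where "s = (real q * real q ^ (l - t) - 1) / (real q - 1) * ((real q ^ (k - t) - 1) / (real q ^ (n - t) - 1))"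
  have M1: "1 < real q ^ (n - t)" by (rule M_gt_1)
  have "1 < real q * real q ^ (l - t)"
    using q_ge_2 one_less_power[of "real q" "Suc (l - t)"] by simp
  then have s0: "0 < s" unfolding s_def using bnd.pos M1 by (intro mult_pos_pos divide_pos_pos) auto
  have "P \<le> 1 / (1 + s)"
    using avoid_prob_bounds(3)[OF q_ge_2 codim_bounds(1,2), of "l - t + 1"] codim_bounds(3) by (simp add: s_def)
  then have "s / (1 + s) \<le> 1 - P" using s0 by (simp add: field_simps)
  then have 1: "gb (n - t) (k - t) * (s / (1 + s)) \<le> gb (n - t) (k - t) * (1 - P)"
    by (intro mult_left_mono) auto
  have "gb (n - t) (k - t) * (s / (1 + s)) = \<phi> k * ((real q * real q ^ (l - t) - 1) / (real q - 1) / (1 + s))"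
  proof -
    have "u / v * f * (c * (v / u) / d) = f * (c / d)" if "u \<noteq> 0" "v \<noteq> 0" for u v f c d :: real
      using that by simp
    moreover have "s / (1 + s) = (real q * real q ^ (l - t) - 1) / (real q - 1)
        * ((real q ^ (k - t) - 1) / (real q ^ (n - t) - 1)) / (1 + s)"
      by (simp only: s_def)
    ultimately show ?thesis unfolding gb_phi using bnd.pos M1 by simp
  qed
  with 1 have 2: "\<phi> k * ((real q * real q ^ (l - t) - 1) / (real q - 1) / (1 + s)) \<le> gb (n - t) (k - t) * (1 - P)"
    by simp
  have "\<phi> k * \<phi> l * bnd.\<Theta> \<le> \<phi> k * \<phi> l * ((real q * real q ^ (l - t) - 1) / (real q - 1) / (1 + s)
    * ((real q ^ (n - t) - 1) / (real q ^ (l - t) - 1)))"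
    using bnd.Theta_le_star phi_pos unfolding s_def by (intro mult_left_mono) auto
  also have "\<dots> = (\<phi> k * ((real q * real q ^ (l - t) - 1) / (real q - 1) / (1 + s))) * gb (n - t) (l - t)"
    unfolding gb_l by simp
  also have "\<dots> \<le> star_value" unfolding star_value_eq
  proof (rule mult_mono[OF 2])
    show "gb (n - t) (l - t) \<le> gb (n - t) (l - t) + real q * real q ^ (l - t) * ((real q ^ t - 1) / (real q - 1))"
      using bnd.pos q_ge_2 by simp
    show "0 \<le> gb (n - t) (k - t) * (1 - P)"
      using 1 s0 order_trans[of 0 "gb (n - t) (k - t) * (s / (1 + s))"] by simp
  qed auto
  finally show ?thesis .
qed

lemma line_value_less_Theta:
  assumes "2 * t + 1 \<le> l"
  shows "line_value < \<phi> k * \<phi> l * bnd.\<Theta>"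
proof -
  have "real q * real q ^ t = real q ^ (t + 1)" by simp
  also have "\<dots> \<le> real q ^ (l - t)" using assms q_ge_2 by (intro power_increasing) auto
  finally show ?thesis unfolding line_value_eq
    using phi_pos by (intro mult_strict_left_mono bnd.line_less_Theta) auto
qed

lemma Theta_le_line_value:
  assumes "l \<le> 2 * t"
  shows "\<phi> k * \<phi> l * bnd.\<Theta> \<le> line_value"
proof -
  have "real q ^ (l - t) \<le> real q ^ t" using assms q_ge_2 by (intro power_increasing) auto
  then show ?thesis unfolding line_value_eq
    using phi_pos by (intro mult_left_mono bnd.Theta_le_line) auto
qed

lemma Theta_pos: "0 < bnd.\<Theta>"
proof -
  have "1 < real q * real q ^ t" by (rule bnd.qT)
  then show ?thesis unfolding bnd.Theta_eq using bnd.pos by simp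
qed

text \<open>The margin shrinks as \<open>l\<close> approaches \<open>2 * t\<close>, so three
  precisions are used: the union bound for \<open>l < 2 * t\<close>, a second-order estimate for
  \<open>l = 2 * t\<close> with \<open>t \<ge> 2\<close>, and the exact value of \<open>P\<close>
  for \<open>t = 1\<close>.\<close>

lemma star_less_line:
  assumes "l \<le> 2 * t" "l \<le> k" and exc: "(k, l, t) \<notin> {(2, 2, 1), (3, 2, 1), (4, 2, 1)}"
  shows "star_value < line_value"
proof -
  define A B T M where "A = real q ^ (k - t)" and "B = real q ^ (l - t)" and "T = real q ^ t"
    and "M = real q ^ (n - t)"
  have q1: "1 < real q" using q_ge_2 by simp
  note pos = bnd.pos[folded A_def B_def T_def M_def]
  have M1: "1 < M" unfolding M_def by (rule M_gt_1)
  define p where "p = (T - 1) / (real q - 1)"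
  have p0: "0 \<le> p" unfolding p_def T_def using q1 by simp
  have P1: "1 - P \<le> (real q * B - 1) / (real q - 1) * ((A - 1) / (M - 1))"
    using avoid_prob_bounds(4)[OF q_ge_2 codim_bounds(1,2), of "l - t + 1"] codim_bounds(3) by (simp add: A_def B_def M_def)
  have P0: "0 \<le> 1 - P"
  proof -
    have "P \<le> (M - real q ^ (l - t + 1)) / (M - 1)"
      using avoid_prob_bounds(2)[OF q_ge_2 codim_bounds(1,2), of "l - t + 1"] codim_bounds(3) by (simp add: M_def)
    also have "\<dots> \<le> 1" using M1 q1 by (simp add: one_le_power del: power_Suc)
    finally show ?thesis by simp
  qed
  have qB: "1 < real q * B" unfolding B_def using one_less_power[OF q1, of "Suc (l - t)"] by simp
  have gA: "gb (n - t) (k - t) = (M - 1) / (A - 1) * \<phi> k" and gB: "gb (n - t) (l - t) = (M - 1) / (B - 1) * \<phi> l"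
    using gb_phi gb_l by (simp_all add: A_def B_def M_def)
  have value_bound: "star_value < line_value"
    if \<nu>: "gb (n - t) (k - t) * (1 - P) \<le> \<phi> k * \<nu>" "0 \<le> \<nu>"
      and \<beta>: "gb (n - t) (l - t) + real q * B * p \<le> \<phi> l * \<beta>"
      and less: "\<nu> * \<beta> < 1 + (real q * T - 1) / (real q - 1) * ((M - B) / (B - 1))" for \<nu> \<beta>
  proof -
    have "star_value \<le> (\<phi> k * \<nu>) * (\<phi> l * \<beta>)"
      unfolding star_value_eq B_def[symmetric] T_def[symmetric] p_def[symmetric]
      by (rule mult_mono[OF \<nu>(1) \<beta>]) (use \<nu>(2) phi_pos p0 q1 pos in auto)
    also have "\<dots> = \<phi> k * \<phi> l * (\<nu> * \<beta>)" by simp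
    also have "\<dots> < \<phi> k * \<phi> l * (1 + (real q * T - 1) / (real q - 1) * ((M - B) / (B - 1)))"
      using less phi_pos by (intro mult_strict_left_mono) auto
    finally show ?thesis unfolding line_value_eq B_def T_def M_def .
  qed
  consider "l < 2 * t" | "l = 2 * t" "t = 1" | "l = 2 * t" "2 \<le> t" using assms(1) t_pos by linarith
  then show ?thesis
  proof cases
    case 1
    have qBT: "real q * B \<le> T"
    proof -
      have "real q * B = real q ^ (l - t + 1)" by (simp add: B_def)
      also have "\<dots> \<le> T" unfolding T_def using 1 q1 t_less by (intro power_increasing) auto
      finally show ?thesis .
    qed
    show ?thesis
    proof (rule value_bound)
      have "gb (n - t) (k - t) * (1 - P) \<le> gb (n - t) (k - t) * ((real q * B - 1) / (real q - 1) * ((A - 1) / (M - 1)))"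
        using P1 by (intro mult_left_mono) auto
      also have "\<dots> = \<phi> k * ((real q * B - 1) / (real q - 1))"
        unfolding gA using pos M1 by simp
      finally show "gb (n - t) (k - t) * (1 - P) \<le> \<phi> k * ((real q * B - 1) / (real q - 1))" .
      show "0 \<le> (real q * B - 1) / (real q - 1)" using qB q1 by simp
      \<comment> \<open>The summand \<open>q * B * p\<close> carries no factor
        \<open>\<phi> l\<close>. Comparing the binomial with the number of points gives
        \<open>1 / (q - 1) \<le> \<phi> l / (B - 1)\<close>, which bounds it by a multiple of
        \<open>\<phi> l\<close>.\<close>
      have "(M - 1) / (real q - 1) \<le> gb (n - t) (l - t)"
        unfolding M_def using t_less n_large by (intro gauss_binom_ge_points q_ge_2) auto
      then have "(M - 1) * (1 / (real q - 1)) \<le> (M - 1) * (\<phi> l / (B - 1))" unfolding gB by simp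
      then have "1 / (real q - 1) \<le> \<phi> l / (B - 1)" by (rule mult_left_le_imp_le) (use M1 in simp)
      then have "real q * B * (T - 1) * (1 / (real q - 1)) \<le> real q * B * (T - 1) * (\<phi> l / (B - 1))"
        using pos qBT qB by (intro mult_left_mono) auto
      moreover have "real q * B * p = real q * B * (T - 1) * (1 / (real q - 1))" by (simp add: p_def)
      moreover have "\<phi> l * ((M - 1 + u) / (B - 1)) = (M - 1) / (B - 1) * \<phi> l + u * (\<phi> l / (B - 1))" for u
        by (simp add: add_divide_distrib distrib_left mult.commute)
      ultimately show "gb (n - t) (l - t) + real q * B * p \<le> \<phi> l * ((M - 1 + real q * B * (T - 1)) / (B - 1))"
        unfolding gB by simp
      show "(real q * B - 1) / (real q - 1) * ((M - 1 + real q * B * (T - 1)) / (B - 1))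
        < 1 + (real q * T - 1) / (real q - 1) * ((M - B) / (B - 1))"
        using bnd.star_less_line_strict qBT unfolding B_def T_def M_def by blast
    qed
  next
    case 2
    have l: "l = 2" using 2 by simp
    have "5 \<le> k" using exc assms(2) 2 by auto
    have BT: "B = real q" "T = real q" unfolding B_def T_def using 2 by auto
    have Mq: "real q < M" using bnd.q_lt_M by (simp add: M_def)
    have pl: "\<phi> l = 1" unfolding \<phi>_def using 2 by simp
    have PP: "P = (M - A) / (M - 1) * ((M - A * real q) / (M - real q))"
    proof -
      have "P = avoid_prob q (n - t) (k - t) (Suc (Suc 0))" using 2 by (simp add: numeral_2_eq_2)
      then show ?thesis
        using avoid_prob_Suc[OF q_ge_2 codim_bounds(1,2), of 0] avoid_prob_Suc[OF q_ge_2 codim_bounds(1,2), of "Suc 0"] codim_bounds(3)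
        by (simp add: avoid_prob_0[OF q_ge_2 codim_bounds(1,2)] A_def M_def)
    qed
    have AM: "A \<le> M" using bnd.A_le_M by (simp add: A_def M_def)
    show ?thesis
    proof (rule value_bound)
      have "1 - P = (A - 1) / (M - 1) * (1 + real q * ((M - A) / (M - real q)))"
      proof -
        have 1: "(M - A * real q) / (M - real q) = 1 - real q * (A - 1) / (M - real q)"
          using Mq by (simp add: field_simps)
        have 2: "1 - (M - A) / (M - 1) = (A - 1) / (M - 1)" using M1 by (simp add: field_simps)
        have 3: "u / v * (1 - c * x / y) = u / v - x / v * (c * (u / y))" for u v c x y :: real
          by (simp add: right_diff_distrib mult_ac)
        have "1 - P = (1 - (M - A) / (M - 1)) + (A - 1) / (M - 1) * (real q * ((M - A) / (M - real q)))"
          unfolding PP 1 3 by simp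
        then show ?thesis unfolding 2 by (simp only: distrib_left mult_1_right)
      qed
      then have "gb (n - t) (k - t) * (1 - P) = \<phi> k * (1 + real q * ((M - A) / (M - real q)))"
        unfolding gA using pos M1 by simp
      then show "gb (n - t) (k - t) * (1 - P) \<le> \<phi> k * (1 + real q * ((M - A) / (M - real q)))" by simp
      show "0 \<le> 1 + real q * ((M - A) / (M - real q))" using AM Mq q1 by simp
      have "p = 1" unfolding p_def BT using q1 by simp
      then show "gb (n - t) (l - t) + real q * B * p \<le> \<phi> l * ((M - 1 + (real q)\<^sup>2 * (real q - 1)) / (real q - 1))"
        unfolding gB pl BT using q1 by (simp add: add_divide_distrib power2_eq_square)
      have "real q ^ 4 \<le> A" unfolding A_def using \<open>5 \<le> k\<close> 2 q1 by (intro power_increasing) auto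
      from bnd.star_less_line_one[OF _ _ this[unfolded A_def], folded B_def T_def M_def A_def]
      have "(1 + real q * ((M - A) / (M - real q))) * ((M - 1 + (real q)\<^sup>2 * (real q - 1)) / (real q - 1))
        < 1 + (real q + 1) * ((M - real q) / (real q - 1))" using BT by simp
      moreover have "(real q * T - 1) / (real q - 1) = real q + 1"
        unfolding BT using q1 by (simp add: field_simps)
      ultimately show "(1 + real q * ((M - A) / (M - real q))) * ((M - 1 + (real q)\<^sup>2 * (real q - 1)) / (real q - 1))
        < 1 + (real q * T - 1) / (real q - 1) * ((M - B) / (B - 1))" unfolding BT by simp
    qed
  next
    case 3
    have BT: "B = T" unfolding B_def T_def using 3 by simp
    have T2: "(real q)\<^sup>2 \<le> T" unfolding T_def using 3 q1 by (intro power_increasing) auto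
    have AT: "T \<le> A" unfolding A_def T_def using 3 assms(2) q1 by (intro power_increasing) auto
    define s where "s = (T - 1) / (real q - 1) * ((A - 1) / (M - 1))"
    define g where "g = (M - 1) / (T - 1) * ((M / real q - 1) / (real q - 1))"
    define e where "e = real q * T * p / g"
    have TM: "T < M" unfolding T_def M_def using n_large t_less q1 by (intro power_strict_increasing) auto
    have MA: "M - A * T > 0"
      using powers_less[OF q_ge_2 codim_bounds(1,2), of t] n_large t_less unfolding M_def A_def T_def by simp
    have T1: "1 < T" using pos BT by simp
    have s0: "0 \<le> s" unfolding s_def using pos T1 M1 q1 by simp
    let ?P = "avoid_prob q (n - t) (k - t) t"
    \<comment> \<open>The last of the \<open>t + 1\<close> dimensions is split off. In the resulting
      expression for \<open>1 - P\<close> the union bound serves for \<open>1 - ?P\<close> and the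
      harmonic bound for the factor \<open>?P\<close>; this keeps the second-order term.\<close>
    have PS: "P = ?P * ((M - A * T) / (M - T))"
      using avoid_prob_Suc[OF q_ge_2 codim_bounds(1,2), of t] n_large t_less 3 by (simp add: A_def M_def T_def)
    have b: "?P \<le> 1 / (1 + s)" "1 - ?P \<le> s"
      using avoid_prob_bounds(3,4)[OF q_ge_2 codim_bounds(1,2), of t] n_large t_less by (simp_all add: s_def A_def T_def M_def)
    have "1 - P = (1 - ?P) + ?P * (T * (A - 1) / (M - T))"
      unfolding PS using TM by (simp add: field_simps)
    also have "\<dots> \<le> s + 1 / (1 + s) * (T * (A - 1) / (M - T))"
      using b TM T1 pos by (intro add_mono mult_right_mono) auto
    also have "\<dots> = (A - 1) / (M - 1) * ((T - 1) / (real q - 1) + T * ((M - 1) / (M - T)) / (1 + s))"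
    proof -
      have "c * (x / y) + 1 / d * (u * x / z) = x / y * (c + u * (y / z) / d)" if "y \<noteq> 0"
        for c d u x y z :: real using that by (simp add: distrib_left mult_ac)
      then show ?thesis by (rule trans[OF arg_cong2[where f = "(+)", OF s_def refl]]) (use M1 in simp)
    qed
    finally have P_le: "1 - P \<le> (A - 1) / (M - 1) * ((T - 1) / (real q - 1) + T * ((M - 1) / (M - T)) / (1 + s))" .
    have g0: "0 < g"
    proof -
      have "real q < M" using bnd.q_lt_M by (simp add: M_def)
      then have "0 < M / real q - 1" using q1 by (simp add: field_simps)
      then show ?thesis unfolding g_def using M1 T1 q1 by simp
    qed
    show ?thesis
    proof (rule value_bound)
      have "gb (n - t) (k - t) * (1 - P) \<le> gb (n - t) (k - t) * ((A - 1) / (M - 1) * ((T - 1) / (real q - 1) + T * ((M - 1) / (M - T)) / (1 + s)))"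
        using P_le by (intro mult_left_mono) auto
      also have "\<dots> = \<phi> k * ((T - 1) / (real q - 1) + T * ((M - 1) / (M - T)) / (1 + s))"
        unfolding gA using pos M1 by simp
      finally show "gb (n - t) (k - t) * (1 - P) \<le> \<phi> k * ((T - 1) / (real q - 1) + T * ((M - 1) / (M - T)) / (1 + s))" .
      show "0 \<le> (T - 1) / (real q - 1) + T * ((M - 1) / (M - T)) / (1 + s)"
        using T1 q1 M1 TM s0 by (intro add_nonneg_nonneg divide_nonneg_nonneg mult_nonneg_nonneg) auto
      have "g \<le> gb (n - t) (l - t)"
      proof -
        have "M / real q = real q ^ (n - t - 1)"
          unfolding M_def using n_large q1 by (simp add: power_diff)
        then have "(M / real q - 1) / (real q - 1) \<le> \<phi> l"
          unfolding \<phi>_def using gauss_binom_ge_points[OF q_ge_2, of "l - t - 1" "n - t - 1"] 3 n_large by simp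
        then show ?thesis unfolding g_def gB BT using M1 T1 by (intro mult_left_mono) auto
      qed
      then have "g * e \<le> gb (n - t) (l - t) * e"
        unfolding e_def using g0 p0 T1 q1 by (intro mult_right_mono divide_nonneg_nonneg mult_nonneg_nonneg) auto
      moreover have "g * e = real q * B * p" unfolding e_def BT using g0 by simp
      ultimately have "gb (n - t) (l - t) + real q * B * p \<le> gb (n - t) (l - t) * (1 + e)"
        by (simp add: algebra_simps)
      also have "\<dots> = \<phi> l * ((M - 1) / (T - 1) * (1 + e))" unfolding gB BT by simp
      finally show "gb (n - t) (l - t) + real q * B * p \<le> \<phi> l * ((M - 1) / (T - 1) * (1 + e))" .
      show "((T - 1) / (real q - 1) + T * ((M - 1) / (M - T)) / (1 + s)) * ((M - 1) / (T - 1) * (1 + e))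
        < 1 + (real q * T - 1) / (real q - 1) * ((M - B) / (B - 1))"
        using bnd.star_less_line_diag[folded A_def B_def T_def M_def, OF BT T2 AT]
        unfolding e_def g_def s_def p_def BT .
    qed
  qed
qed

text \<open>\<open>P\<close> and \<open>opp.P\<close> lie one recursion step beyond the same
  symmetric value \<open>R\<close>, with denominators \<open>M - B\<close> and \<open>M - A\<close>.
  Hence \<open>1 - P\<close> is larger by \<open>opp.P * ((A - B) / (M - B))\<close>, and this
  outweighs the larger hyperplane summand of the exchanged product.\<close>

lemma star_value_swap:
  assumes "l < k"
  shows "cross_pair.star_value q n l k t < star_value"
proof -
  interpret opp: cross_pair scale Basis q n l k t \<G> \<F> by (rule swap_pair)
  define A B T M where "A = real q ^ (k - t)" and "B = real q ^ (l - t)" and "T = real q ^ t"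
    and "M = real q ^ (n - t)"
  have q1: "1 < real q" using q_ge_2 by simp
  note pos = bnd.pos[folded A_def B_def T_def M_def]
  define p where "p = (T - 1) / (real q - 1)"
  have p0: "0 \<le> p" unfolding p_def T_def using q1 by simp
  have BA: "real q * B \<le> A"
  proof -
    have "real q * B = real q ^ (l - t + 1)" by (simp add: B_def)
    also have "\<dots> \<le> A" unfolding A_def using assms q1 t_less by (intro power_increasing) auto
    finally show ?thesis .
  qed
  have lM: "A < M" "B < M" unfolding A_def B_def M_def
    using n_large q1 t_less by (auto intro!: power_strict_increasing)
  define R where "R = avoid_prob q (n - t) (k - t) (l - t)"
  have R: "R = avoid_prob q (n - t) (l - t) (k - t)"
    unfolding R_def using avoid_prob_commute[OF q_ge_2 codim_bounds(1,2)] codim_bounds(3) by simp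
  have P: "P = R * ((M - A * B) / (M - B))"
    using avoid_prob_Suc[OF q_ge_2 codim_bounds(1,2), of "l - t"] codim_bounds(3) by (simp add: R_def A_def B_def M_def)
  have oP: "opp.P = R * ((M - A * B) / (M - A))"
    using avoid_prob_Suc[OF q_ge_2 opp.codim_bounds(1,2), of "k - t"] opp.codim_bounds(3)
    by (simp add: R A_def B_def M_def mult.commute)
  have PoP: "1 - P = 1 - opp.P + opp.P * ((A - B) / (M - B))"
    unfolding P oP using lM by (simp add: divide_simps) (simp add: algebra_simps)
  have bounds: "1 - opp.P \<le> (real q * A - 1) / (real q - 1) * ((B - 1) / (M - 1))" "opp.P \<le> 1"
  proof -
    show "1 - opp.P \<le> (real q * A - 1) / (real q - 1) * ((B - 1) / (M - 1))"
      using avoid_prob_bounds(4)[OF q_ge_2 opp.codim_bounds(1,2), of "k - t + 1"] opp.codim_bounds(3)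
      by (simp add: A_def B_def M_def)
    have "opp.P \<le> (M - real q ^ (k - t + 1)) / (M - 1)"
      using avoid_prob_bounds(2)[OF q_ge_2 opp.codim_bounds(1,2), of "k - t + 1"] opp.codim_bounds(3) by (simp add: M_def)
    also have "\<dots> \<le> 1" using lM pos q1 by (simp add: one_le_power del: power_Suc)
    finally show "opp.P \<le> 1" .
  qed
  have g: "(M - 1) / (real q - 1) \<le> gb (n - t) (k - t)"
    unfolding M_def using t_less n_large by (intro gauss_binom_ge_points q_ge_2) auto
  have core: "(1 - opp.P) * (real q * A * p) < gb (n - t) (k - t) * (opp.P * ((A - B) / (M - B)))"
    using bnd.star_swap_core[folded A_def B_def T_def M_def, OF BA g bounds] unfolding p_def .
  have gl: "0 < gb (n - t) (l - t)" using gauss_binom_pos[OF q_ge_2] n_large by simp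
  have "opp.star_value = gb (n - t) (l - t) * (gb (n - t) (k - t) * (1 - opp.P) + (1 - opp.P) * (real q * A * p))"
    unfolding opp.star_value_eq A_def[symmetric] T_def[symmetric] p_def[symmetric]
    by (simp add: distrib_left mult_ac)
  also have "\<dots> < gb (n - t) (l - t) * (gb (n - t) (k - t) * (1 - opp.P) + gb (n - t) (k - t) * (opp.P * ((A - B) / (M - B))))"
    using core gl by (intro mult_strict_left_mono add_strict_left_mono) auto
  also have "\<dots> = gb (n - t) (k - t) * (1 - P) * gb (n - t) (l - t)"
    unfolding PoP by (simp add: algebra_simps)
  also have "\<dots> \<le> star_value"
  proof -
    have "P \<le> opp.P"
    proof -
      have "0 < M - A * B" using powers_less[OF q_ge_2 codim_bounds(1,2), of "l - t"] codim_bounds(3) unfolding M_def A_def B_def by simp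
      moreover have "0 < R" unfolding R_def using avoid_prob_bounds(1)[OF q_ge_2 codim_bounds(1,2)] codim_bounds(3) by simp
      moreover have "1 * B \<le> real q * B" using q1 pos by (intro mult_right_mono) auto
      then have "B \<le> A" using BA by linarith
      ultimately show ?thesis unfolding P oP using lM by (intro mult_left_mono divide_left_mono) auto
    qed
    then have "0 \<le> 1 - P" using bounds(2) by simp
    then show ?thesis unfolding star_value_eq B_def[symmetric] T_def[symmetric] p_def[symmetric]
      using p0 pos q1 by (intro mult_left_mono mult_nonneg_nonneg) auto
  qed
  finally show ?thesis .
qed

lemma line_value_swap:
  assumes "l < k"
  shows "cross_pair.line_value q n l k t < line_value"
proof -
  interpret opp: cross_pair scale Basis q n l k t \<G> \<F> by (rule swap_pair)
  have "real q ^ (l - t) < real q ^ (k - t)"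
    using assms q_ge_2 t_less by (intro power_strict_increasing) auto
  then have "\<phi> k * \<phi> l * (1 + (real q * real q ^ t - 1) / (real q - 1) * ((real q ^ (n - t) - real q ^ (k - t)) / (real q ^ (k - t) - 1)))
    < line_value"
    unfolding line_value_eq using phi_pos by (intro mult_strict_left_mono bnd.line_swap) auto
  then show ?thesis unfolding opp.line_value_eq by (simp add: \<phi>_def opp.\<phi>_def mult.commute)
qed

lemma star_line_values_pos: "0 < star_value" "0 < line_value"
proof -
  have "0 < \<phi> k * \<phi> l * bnd.\<Theta>" using phi_pos Theta_pos by simp
  then show "0 < star_value" using Theta_le_star_value by linarith
  have "\<phi> l \<le> real q ^ (l - t) * gb (t + 1) 1 * gb (n - t - 1) (l - t) + gb (n - t - 1) (l - t - 1)"
    by (simp add: \<phi>_def)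
  with phi_pos(2) have "0 < real q ^ (l - t) * gb (t + 1) 1 * gb (n - t - 1) (l - t) + gb (n - t - 1) (l - t - 1)"
    by linarith
  then show "0 < line_value" unfolding line_value_def \<phi>_def[symmetric]
    using phi_pos(1) by (intro mult_pos_pos)
qed

section \<open>Bounds and equality for closed pairs\<close>

definition star_pair :: bool where
  "star_pair \<longleftrightarrow> (\<exists>X \<in> subspaces_of_dim scale UNIV t. \<exists>M \<in> subspaces_of_dim scale UNIV (l + 1).
     X \<subseteq> M \<and> \<F> = family_A scale k (t + 1) X M \<and> \<G> = family_B scale l X M)"

definition line_pair :: bool where
  "line_pair \<longleftrightarrow> (\<exists>T \<in> subspaces_of_dim scale UNIV (t + 1). \<F> = family_C scale k T \<and> \<G> = family_D scale l t T)"

lemma large_pair_bounds: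
  assumes X: "subspace X" "dim X = t" and "large_pair_structure X"
  shows "(real (card \<F>) * real (card \<G>) \<le> star_value \<and> (real (card \<F>) * real (card \<G>) = star_value \<longrightarrow> star_pair))
    \<or> (real (card \<F>) * real (card \<G>) \<le> line_value \<and> (real (card \<F>) * real (card \<G>) = line_value \<longrightarrow> line_pair))"
  using assms(3) unfolding large_pair_structure_def
proof
  assume "\<exists>M\<in>subspaces_of_dim scale UNIV (l + 1). X \<subseteq> M \<and> \<F> \<subseteq> family_A scale k (t + 1) X M \<and> \<G> \<subseteq> family_B scale l X M"
  then obtain M where Mm: "M \<in> subspaces_of_dim scale UNIV (l + 1)" "X \<subseteq> M"
    and sub: "\<F> \<subseteq> family_A scale k (t + 1) X M" "\<G> \<subseteq> family_B scale l X M" by blast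
  have M: "subspace M" "dim M = l + 1" using Mm by (auto simp: subspaces_of_dim_iff)
  have A: "real (card (family_A scale k (t + 1) X M))
     \<le> gb (n - t) (k - t) - real q ^ ((l + 1 - t) * (k - t)) * gb (n - l - 1) (k - t)"
    using card_family_A[OF X M(1) Mm(2)] t_less M(2) dim_space by simp
  have B: "real (card (family_B scale l X M)) \<le> gb (n - t) (l - t) + real q ^ (l + 1 - t) * gb t 1"
    using card_family_B_le[OF X M(1) Mm(2) M(2)] t_less dim_space by simp
  note le = card_product_le[OF finite_family finite_family sub A B, folded star_value_def]
  have "X \<in> subspaces_of_dim scale UNIV t" using X by (simp add: subspaces_of_dim_iff)
  then show ?thesis
    using le(1) le(2)[OF star_line_values_pos(1)] Mm unfolding star_pair_def by blast
next
  assume "\<exists>T\<in>subspaces_of_dim scale UNIV (t + 1). \<F> \<subseteq> family_C scale k T \<and> \<G> \<subseteq> family_D scale l t T"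
  then obtain T where Tm: "T \<in> subspaces_of_dim scale UNIV (t + 1)"
    and sub: "\<F> \<subseteq> family_C scale k T" "\<G> \<subseteq> family_D scale l t T" by blast
  have T: "subspace T" "dim T = t + 1" using Tm by (auto simp: subspaces_of_dim_iff)
  have C: "real (card (family_C scale k T)) \<le> gb (n - t - 1) (k - t - 1)"
    using card_family_C[OF T] t_less dim_space by simp
  have D: "real (card (family_D scale l t T))
      \<le> real q ^ (l - t) * gb (t + 1) 1 * gb (n - t - 1) (l - t) + gb (n - t - 1) (l - t - 1)"
    using card_family_D_le[OF T] t_less dim_space by simp
  note le = card_product_le[OF finite_family finite_family sub C D, folded line_value_def]
  show ?thesis
    using le(1) le(2)[OF star_line_values_pos(2)] Tm unfolding line_pair_def by blast
qed

lemma product_cases: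
  assumes nontrivial: "dim (\<Inter> (\<F> \<union> \<G>)) < t"
    and closed: "\<And>H. H \<in> subspaces_of_dim scale UNIV k \<Longrightarrow> \<forall>G\<in>\<G>. t \<le> dim (H \<inter> G) \<Longrightarrow> H \<in> \<F>"
    and "\<tau> t \<F> = t"
  shows "real (card \<F>) * real (card \<G>) < \<phi> k * \<phi> l * bnd.\<Theta>
    \<or> (real (card \<F>) * real (card \<G>) \<le> star_value \<and> (real (card \<F>) * real (card \<G>) = star_value \<longrightarrow> star_pair))
    \<or> (real (card \<F>) * real (card \<G>) \<le> line_value \<and> (real (card \<F>) * real (card \<G>) = line_value \<longrightarrow> line_pair))"
proof -
  obtain X where X: "covers t \<F> X" "dim X = t" using tau(1) assms(3) by auto
  have sX: "subspace X" using X by (simp add: covers_def)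
  \<comment> \<open>A cover of dimension exactly \<open>t\<close> can meet a member in dimension
    \<open>t\<close> only by lying inside it.\<close>
  have XF: "X \<subseteq> F" if "F \<in> \<F>" for F
  proof -
    have "t \<le> dim (F \<inter> X)" using X(1) that by (simp add: covers_def)
    then have "F \<inter> X = X" using X sX F[OF that] subspace_inter by (intro subspace_dim_equal) auto
    then show ?thesis by blast
  qed
  have "\<exists>G\<in>\<G>. \<not> X \<subseteq> G"
  proof (rule ccontr)
    assume "\<not> (\<exists>G\<in>\<G>. \<not> X \<subseteq> G)"
    then have "X \<subseteq> \<Inter> (\<F> \<union> \<G>)" using XF by blast
    then have "dim X \<le> dim (\<Inter> (\<F> \<union> \<G>))" by (rule dim_subset)
    then show False using nontrivial X(2) by simp
  qed
  from structure_with_common_subspace[OF sX X(2) XF this closed] show ?thesis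
    using large_pair_bounds[OF sX X(2)] by blast
qed

text \<open>Five outcomes are possible: a product below \<Theta>, or one of the two structures in
  either order of the families. Exchanging the families gives strictly smaller values for
  \<open>l < k\<close> and equal ones for \<open>l = k\<close>; therefore the exchanged structures
  survive in the equality case only together with \<open>k = l\<close>.\<close>

lemma closed_pair_bounds:
  assumes "l \<le> k"
    and exc: "(k, l, t) \<notin> {(2, 2, 1), (3, 2, 1), (4, 2, 1)}"
    and nontrivial: "dim (\<Inter> (\<F> \<union> \<G>)) < t"
    and closed_F: "\<And>H. H \<in> subspaces_of_dim scale UNIV k \<Longrightarrow> \<forall>G\<in>\<G>. t \<le> dim (H \<inter> G) \<Longrightarrow> H \<in> \<F>"
    and closed_G: "\<And>H. H \<in> subspaces_of_dim scale UNIV l \<Longrightarrow> \<forall>F\<in>\<F>. t \<le> dim (H \<inter> F) \<Longrightarrow> H \<in> \<G>"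
  shows "2 * t + 1 \<le> l \<Longrightarrow> real (card \<F>) * real (card \<G>) \<le> star_value \<and>
      (real (card \<F>) * real (card \<G>) = star_value \<longrightarrow> star_pair \<or> k = l \<and> cross_pair.star_pair scale l k t \<G> \<F>)"
    and "l \<le> 2 * t \<Longrightarrow> real (card \<F>) * real (card \<G>) \<le> line_value \<and>
      (real (card \<F>) * real (card \<G>) = line_value \<longrightarrow> line_pair \<or> k = l \<and> cross_pair.line_pair scale l k t \<G> \<F>)"
proof -
  interpret opp: cross_pair scale Basis q n l k t \<G> \<F> by (rule swap_pair)
  let ?p = "real (card \<F>) * real (card \<G>)"
  let ?small = "\<phi> k * \<phi> l * bnd.\<Theta>"
  have opp_p: "real (card \<G>) * real (card \<F>) = ?p" by simp
  have opp_small: "opp.\<phi> l * opp.\<phi> k * bnd.\<Theta> = ?small" by (simp add: \<phi>_def opp.\<phi>_def)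
  have opp_nontrivial: "dim (\<Inter> (\<G> \<union> \<F>)) < t" using nontrivial by (simp add: Un_commute)
  have cases: "?p < ?small
    \<or> (?p \<le> star_value \<and> (?p = star_value \<longrightarrow> star_pair)) \<or> (?p \<le> line_value \<and> (?p = line_value \<longrightarrow> line_pair))
    \<or> (?p \<le> opp.star_value \<and> (?p = opp.star_value \<longrightarrow> opp.star_pair))
    \<or> (?p \<le> opp.line_value \<and> (?p = opp.line_value \<longrightarrow> opp.line_pair))"
  proof (cases "\<tau> t \<F> = t")
    case True
    then show ?thesis using product_cases[OF nontrivial closed_F True] by blast
  next
    case F: False
    show ?thesis
    proof (cases "\<tau> t \<G> = t")
      case True
      then show ?thesis
        using opp.product_cases[OF opp_nontrivial closed_G True] unfolding opp_p opp_small by blast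
    next
      case False
      then have "t < \<tau> t \<F>" "t < \<tau> t \<G>" using F tau(4) opp.tau(4) by linarith+
      then show ?thesis using no_small_covers by blast
    qed
  qed
  have swap: "l = k \<or> opp.star_value < star_value" "l = k \<or> opp.line_value < line_value"
    using assms(1) star_value_swap line_value_swap by linarith+
  have same: "opp.star_value = star_value" "opp.line_value = line_value" if "l = k"
    using that unfolding star_value_def opp.star_value_def line_value_def opp.line_value_def by simp_all
  show "?p \<le> star_value \<and> (?p = star_value \<longrightarrow> star_pair \<or> k = l \<and> opp.star_pair)"
    if l: "2 * t + 1 \<le> l"
  proof -
    have "line_value < star_value" using line_value_less_Theta[OF l] Theta_le_star_value by linarith
    moreover have "opp.line_value < star_value"
      using opp.line_value_less_Theta[unfolded opp_small] Theta_le_star_value l assms(1) by linarith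
    ultimately show ?thesis using cases swap(1) same(1) Theta_le_star_value by (cases "l = k") auto
  qed
  show "?p \<le> line_value \<and> (?p = line_value \<longrightarrow> line_pair \<or> k = l \<and> opp.line_pair)"
    if l: "l \<le> 2 * t"
  proof -
    have "star_value < line_value" using star_less_line[OF l assms(1) exc] .
    moreover from this have "opp.star_value < line_value" using swap(1) same(1) by auto
    ultimately show ?thesis using cases swap(2) same(2) Theta_le_line_value[OF l] by (cases "l = k") auto
  qed
qed

end

section \<open>Reduction of arbitrary pairs to closed ones\<close>

theorem theorem1p3:
  fixes scale :: "'a::{field,finite} \<Rightarrow> 'b::ab_group_add \<Rightarrow> 'b"
    and q n k1 k2 t :: nat
    and \<F>1 \<F>2 :: "'b set set"
  assumes "vector_space scale"
    and "q = CARD('a)"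
    and "vector_space.dim scale (UNIV :: 'b set) = n"
    and "n > 0" "k1 > 0" "k2 > 0" "t > 0"
    and "k1 \<ge> k2" "k2 \<ge> t + 1"
    and "n \<ge> k1 + k2 + t + 3"
    and "(k1, k2, t) \<notin> {(2, 2, 1), (3, 2, 1), (4, 2, 1)}"
    and "\<F>1 \<subseteq> subspaces_of_dim scale UNIV k1"
    and "\<F>2 \<subseteq> subspaces_of_dim scale UNIV k2"
    and "cross_intersecting scale t \<F>1 \<F>2"
    and "cross_nontrivial scale t \<F>1 \<F>2"
  shows
    "(k2 \<ge> 2 * t + 1 \<longrightarrow>
      (let bound =
          (gauss_binom q (n - t) (k1 - t)
            - real q ^ ((k2 + 1 - t) * (k1 - t)) * gauss_binom q (n - k2 - 1) (k1 - t))
          * (gauss_binom q (n - t) (k2 - t) + real q ^ (k2 + 1 - t) * gauss_binom q t 1)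
       in real (card \<F>1) * real (card \<F>2) \<le> bound \<and>
          (real (card \<F>1) * real (card \<F>2) = bound \<longrightarrow>
            (\<exists>X \<in> subspaces_of_dim scale UNIV t.
             \<exists>M \<in> subspaces_of_dim scale UNIV (k2 + 1).
               X \<subseteq> M \<and>
               (\<F>1 = family_A scale k1 (t + 1) X M \<and>
                \<F>2 = family_B scale k2 X M
                \<or>
                k1 = k2 \<and>
                \<F>1 = family_B scale k1 X M \<and>
                \<F>2 = family_A scale k2 (t + 1) X M)))))
    \<and>
    (t + 1 \<le> k2 \<and> k2 \<le> 2 * t \<longrightarrow>
      (let bound =
          gauss_binom q (n - t - 1) (k1 - t - 1)
          * (real q ^ (k2 - t) * gauss_binom q (t + 1) 1 * gauss_binom q (n - t - 1) (k2 - t)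
             + gauss_binom q (n - t - 1) (k2 - t - 1))
       in real (card \<F>1) * real (card \<F>2) \<le> bound \<and>
          (real (card \<F>1) * real (card \<F>2) = bound \<longrightarrow>
            (\<exists>T \<in> subspaces_of_dim scale UNIV (t + 1).
               \<F>1 = family_C scale k1 T \<and>
               \<F>2 = family_D scale k2 t T
               \<or>
               k1 = k2 \<and>
               \<F>1 = family_D scale k1 t T \<and>
               \<F>2 = family_C scale k2 T))))"
proof -
  interpret V: vector_space scale by fact
  obtain Basis where Basis: "V.independent Basis" "V.span Basis = UNIV" "card Basis = n"
    using V.basis_exists[of UNIV] assms(3) by (metis UNIV_I subset_UNIV subsetI subset_antisym)
  have "finite Basis" using Basis(3) assms(4) card_ge_0_finite by blast
  then interpret K: finite_field_space scale Basis q
    using Basis assms(2) by unfold_locales auto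
  define S where "S = (gauss_binom q (n - t) (k1 - t)
      - real q ^ ((k2 + 1 - t) * (k1 - t)) * gauss_binom q (n - k2 - 1) (k1 - t))
    * (gauss_binom q (n - t) (k2 - t) + real q ^ (k2 + 1 - t) * gauss_binom q t 1)"
  define L where "L = gauss_binom q (n - t - 1) (k1 - t - 1)
    * (real q ^ (k2 - t) * gauss_binom q (t + 1) 1 * gauss_binom q (n - t - 1) (k2 - t)
       + gauss_binom q (n - t - 1) (k2 - t - 1))"
  define star where "star \<longleftrightarrow> (\<exists>X \<in> subspaces_of_dim scale UNIV t. \<exists>M \<in> subspaces_of_dim scale UNIV (k2 + 1).
      X \<subseteq> M \<and> (\<F>1 = family_A scale k1 (t + 1) X M \<and> \<F>2 = family_B scale k2 X M
        \<or> k1 = k2 \<and> \<F>1 = family_B scale k1 X M \<and> \<F>2 = family_A scale k2 (t + 1) X M))"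
  define line where "line \<longleftrightarrow> (\<exists>T \<in> subspaces_of_dim scale UNIV (t + 1).
      \<F>1 = family_C scale k1 T \<and> \<F>2 = family_D scale k2 t T
      \<or> k1 = k2 \<and> \<F>1 = family_D scale k1 t T \<and> \<F>2 = family_C scale k2 T)"
  have pair: "cross_pair scale Basis q n k1 k2 t \<F> \<G>"
    if "\<F> \<subseteq> subspaces_of_dim scale UNIV k1" "\<G> \<subseteq> subspaces_of_dim scale UNIV k2" "\<F> \<noteq> {}" "\<G> \<noteq> {}"
      "\<And>F G. F \<in> \<F> \<Longrightarrow> G \<in> \<G> \<Longrightarrow> t \<le> V.dim (F \<inter> G)" for \<F> \<G>
    using that assms Basis(3) by unfold_locales simp_all
  \<comment> \<open>The values depend on the parameters alone, so any pair that satisfies the locale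
    can witness positivity; two nested spaces do. This settles the case of an empty family, whose
    product 0 stays strictly below both bounds.\<close>
  have pos: "0 < S" "0 < L"
  proof -
    have "k1 \<le> V.dim UNIV" using assms Basis(3) by simp
    then obtain F where F: "V.subspace F" "F \<subseteq> UNIV" "V.dim F = k1"
      by (rule K.ex_subspace_of_dim[OF V.subspace_UNIV])
    have "k2 \<le> V.dim F" using F assms by simp
    then obtain G where G: "V.subspace G" "G \<subseteq> F" "V.dim G = k2" by (rule K.ex_subspace_of_dim[OF F(1)])
    have "F \<inter> G = G" using G(2) by blast
    then interpret P: cross_pair scale Basis q n k1 k2 t "{F}" "{G}"
      using F G assms by (intro pair) (auto simp: K.subspaces_of_dim_iff)
    show "0 < S" "0 < L"
      using P.star_line_values_pos unfolding S_def L_def P.star_value_def P.line_value_def by simp_all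
  qed
  let ?p = "real (card \<F>1) * real (card \<F>2)"
  have main: "(2 * t + 1 \<le> k2 \<longrightarrow> ?p \<le> S \<and> (?p = S \<longrightarrow> star)) \<and> (k2 \<le> 2 * t \<longrightarrow> ?p \<le> L \<and> (?p = L \<longrightarrow> line))"
  proof (cases "\<F>1 = {} \<or> \<F>2 = {}")
    case True
    then have p0: "?p = 0" by auto
    show ?thesis unfolding p0 using pos by simp
  next
    case False
    define \<G>2 where "\<G>2 = {H \<in> subspaces_of_dim scale UNIV k2. \<forall>F\<in>\<F>1. t \<le> V.dim (H \<inter> F)}"
    define \<G>1 where "\<G>1 = {H \<in> subspaces_of_dim scale UNIV k1. \<forall>F\<in>\<G>2. t \<le> V.dim (H \<inter> F)}"
    have "t \<le> V.dim (H \<inter> F)" if "H \<in> \<F>2" "F \<in> \<F>1" for H F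
      using assms(14) that unfolding cross_intersecting_def by (subst Int_commute) blast
    then have sub2: "\<F>2 \<subseteq> \<G>2" using assms(13) unfolding \<G>2_def by blast
    have "t \<le> V.dim (H \<inter> G)" if "H \<in> \<F>1" "G \<in> \<G>2" for H G
      using that unfolding \<G>2_def by (subst Int_commute) blast
    then have sub1: "\<F>1 \<subseteq> \<G>1" using assms(12) unfolding \<G>1_def by blast
    interpret P: cross_pair scale Basis q n k1 k2 t \<G>1 \<G>2
    proof (rule pair)
      show "t \<le> V.dim (F \<inter> G)" if "F \<in> \<G>1" "G \<in> \<G>2" for F G using that by (simp add: \<G>1_def)
      show "\<G>1 \<subseteq> subspaces_of_dim scale UNIV k1" unfolding \<G>1_def by blast
      show "\<G>2 \<subseteq> subspaces_of_dim scale UNIV k2" unfolding \<G>2_def by blast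
    qed (use False sub1 sub2 in blast)+
    have nontrivial: "V.dim (\<Inter> (\<G>1 \<union> \<G>2)) < t"
    proof -
      have "V.dim (\<Inter> (\<G>1 \<union> \<G>2)) \<le> V.dim (\<Inter> (\<F>1 \<union> \<F>2))"
        using sub1 sub2 by (intro K.dim_subset Inter_anti_mono Un_mono)
      then show ?thesis using assms(15) by (simp add: cross_nontrivial_def)
    qed
    have closed1: "H \<in> \<G>1" if "H \<in> subspaces_of_dim scale UNIV k1" "\<forall>G\<in>\<G>2. t \<le> V.dim (H \<inter> G)" for H
      using that by (simp add: \<G>1_def)
    have closed2: "H \<in> \<G>2" if "H \<in> subspaces_of_dim scale UNIV k2" "\<forall>F\<in>\<G>1. t \<le> V.dim (H \<inter> F)" for H
    proof -
      have "\<forall>F\<in>\<F>1. t \<le> V.dim (H \<inter> F)" using that(2) sub1 by blast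
      with that(1) show ?thesis unfolding \<G>2_def by blast
    qed
    have eqs: "P.star_value = S" "P.line_value = L"
      unfolding S_def L_def P.star_value_def P.line_value_def by simp_all
    interpret Q: cross_pair scale Basis q n k2 k1 t \<G>2 \<G>1 by (rule P.swap_pair)
    let ?r = "real (card \<G>1) * real (card \<G>2)"
    note le = card_product_le[OF K.finite_family K.finite_family sub1 sub2 order_refl order_refl]
    \<comment> \<open>If the given product attains the bound, then so does that of the closed pair,
      and the closure has added nothing; the structure of the closed pair is then that of the given
      one.\<close>
    have ext: "\<F>1 = \<G>1 \<and> \<F>2 = \<G>2" if "?p = v" "0 < v" "?r \<le> v" for v
    proof (rule le(2))
      show "?p = ?r" using le(1) that by linarith
      then show "0 < ?r" using that by linarith
    qed
    show ?thesis
    proof (intro conjI impI)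
      assume l: "2 * t + 1 \<le> k2"
      have b: "?r \<le> S \<and> (?r = S \<longrightarrow> P.star_pair \<or> k1 = k2 \<and> Q.star_pair)"
        by (rule P.closed_pair_bounds(1)[unfolded eqs])
          (fact assms(8) assms(11) nontrivial closed1 closed2 l)+
      show "?p \<le> S" using b le(1) by linarith
      show star if p: "?p = S"
      proof -
        have e: "\<F>1 = \<G>1" "\<F>2 = \<G>2" using ext[OF p pos(1)] b by blast+
        have "P.star_pair \<or> k1 = k2 \<and> Q.star_pair" using b p[unfolded e] by blast
        then show ?thesis unfolding star_def e P.star_pair_def Q.star_pair_def by blast
      qed
    next
      assume l: "k2 \<le> 2 * t"
      have b: "?r \<le> L \<and> (?r = L \<longrightarrow> P.line_pair \<or> k1 = k2 \<and> Q.line_pair)"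
        by (rule P.closed_pair_bounds(2)[unfolded eqs])
          (fact assms(8) assms(11) nontrivial closed1 closed2 l)+
      show "?p \<le> L" using b le(1) by linarith
      show line if p: "?p = L"
      proof -
        have e: "\<F>1 = \<G>1" "\<F>2 = \<G>2" using ext[OF p pos(2)] b by blast+
        have "P.line_pair \<or> k1 = k2 \<and> Q.line_pair" using b p[unfolded e] by blast
        then show ?thesis unfolding line_def e P.line_pair_def Q.line_pair_def by blast
      qed
    qed
  qed
  then show ?thesis
    unfolding Let_def S_def[symmetric] L_def[symmetric] star_def[symmetric] line_def[symmetric] by blast
qed

end
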